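(* Let $V$ be a complex affine algebraic variety defined over a countable field $k\subset\mathbb{C}$ and let $(f_j)_{j\in J}$ be a generating family for $V$ with $J$ countably infinite. Then $CB(V')=T(I)$.
   Context: $k[V]$ is the coordinate ring of $V$ over $k$. A generating family is a family $(f_j)_{j\in J}$ of elements of $k[V]$, with $J$ finite or countable, generating $k[V]$ as a $k$-algebra. Put $V'=\{x\in V: f_j(x)\neq 0\ \forall j\in J\}$ (with the classical topology) and $\mathrm{Log}:V'\to\mathbb{R}^J$, $x\mapsto(\log|f_j(x)|)_{j\in J}$. $\mathbb{R}^J$ has the product topology, $\mathcal{S}=(\mathbb{R}^J\setminus\{0\})/\mathbb{R}_{>0}$ the quotient topology, $\pi:\mathbb{R}^J\setminus\{0\}\to\mathcal{S}$ is the projection. The set of ideal points $B(V')\subset\mathcal{S}$ is the set of $b\in\mathcal{S}$ for which there is a sequence $(x_n)\subset V'$, eventually leaving every compact subset of $V'$, with $\pi(\mathrm{Log}(x_n))\to b$. $CB(V')=\{0\}\cup\pi^{-1}(B(V'))$ if $V'\neq\emptyset$, and $CB(V')=\emptyset$ if $V'=\emptyset$. $k[V']$ is the localization of $k[V]$ at the multiplicative set generated by the $f_j$, and $I$ is the kernel of the $k$-algebra homomorphism $k[(X_j),(X_j^{-1})]\to k[V']$, $X_j\mapsto f_j$, from the Laurent polynomial ring in the variables $(X_j)_{j\in J}$. For $f=\sum_{\omega\in\mathbb{Z}^{\oplus J}}a_\omega X^\omega\in I$ let $A_f=\{\omega:a_\omega\neq0\}$ (finite), $f_0=\bigoplus_{\omega\in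 A_f}X^{\odot\omega}$, i.e. $f_0(x)=\max_{\omega\in A_f}\langle x,\omega\rangle$ with $\langle x,\omega\rangle=\sum_jx_j\omega_j$, and $$T(f_0)=\Big\{x\in\mathbb{R}^J:\ \forall w\in A_f,\ \langle x,w\rangle\le\max_{\omega\in A_f\setminus\{w\}}\langle x,\omega\rangle\Big\}$$ (maximum of the empty set is $-\infty$). $T(I)=\bigcap_{f\in I}T(f_0)$. *)

theory Defs
  imports
    "HOL-Analysis.Analysis"
    "HOL-Library.Poly_Mapping"
    "HOL-Algebra.Algebra"
begin

text \<open>Polynomials are finitely supported functions from exponent vectors to coefficients:
  exponents in \<^typ>\<open>nat\<close> for the coordinates of the affine space, exponents in \<^typ>\<open>int\<close>
  for Laurent polynomials. The class instances for \<^typ>\<open>'a \<Rightarrow>\<^sub>0 'b\<close> give the usual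
  (convolution) ring structure.\<close>

definition univ_ring :: "'a::comm_ring_1 ring" where
  "univ_ring = \<lparr>carrier = UNIV, monoid.mult = (*), one = 1, ring.zero = 0, add = (+)\<rparr>"

definition coeffs_in :: "complex set \<Rightarrow> ('m \<Rightarrow>\<^sub>0 complex) set" where
  "coeffs_in K = {p. range (Poly_Mapping.lookup p) \<subseteq> K}"

definition poly_eval :: "(('n::finite \<Rightarrow>\<^sub>0 nat) \<Rightarrow>\<^sub>0 complex) \<Rightarrow> complex ^ 'n \<Rightarrow> complex" where
  "poly_eval p x = (\<Sum>m\<in>Poly_Mapping.keys p. Poly_Mapping.lookup p m *
     (\<Prod>i\<in>UNIV. (x $ i) ^ Poly_Mapping.lookup m i))"

definition affine_variety_over :: "complex set \<Rightarrow> (complex ^ 'n::finite) set \<Rightarrow> bool" where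
  "affine_variety_over K V \<longleftrightarrow> (\<exists>P \<subseteq> coeffs_in K. V = {x. \<forall>p\<in>P. poly_eval p x = 0})"

text \<open>The coordinate ring consists of the functions on \<open>V\<close> given by polynomials over \<open>K\<close>.
  Functions on \<open>V\<close> are represented extensionally, i.e. with the value \<^const>\<open>undefined\<close>
  outside \<open>V\<close>.\<close>

definition coordinate_ring ::
  "complex set \<Rightarrow> (complex ^ 'n::finite) set \<Rightarrow> (complex ^ 'n \<Rightarrow> complex) ring" where
  "coordinate_ring K V =
    \<lparr>carrier = (\<lambda>p. restrict (poly_eval p) V) ` coeffs_in K,
     monoid.mult = (\<lambda>g h. \<lambda>x\<in>V. g x * h x),
     one = (\<lambda>x\<in>V. 1),
     ring.zero = (\<lambda>x\<in>V. 0),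
     add = (\<lambda>g h. \<lambda>x\<in>V. g x + h x)\<rparr>"

definition generating_family ::
  "complex set \<Rightarrow> (complex ^ 'n::finite) set \<Rightarrow> ('j \<Rightarrow> complex ^ 'n \<Rightarrow> complex) \<Rightarrow> bool" where
  "generating_family K V f \<longleftrightarrow>
     countable (UNIV :: 'j set) \<and>
     range f \<subseteq> carrier (coordinate_ring K V) \<and>
     generate_ring (coordinate_ring K V) ((\<lambda>c. \<lambda>x\<in>V. c) ` K \<union> range f) =
       carrier (coordinate_ring K V)"

definition nonvanishing :: "'x set \<Rightarrow> ('j \<Rightarrow> 'x \<Rightarrow> complex) \<Rightarrow> 'x set" where
  "nonvanishing V f = {x\<in>V. \<forall>j. f j x \<noteq> 0}"

definition Log_map :: "('j \<Rightarrow> 'x \<Rightarrow> complex) \<Rightarrow> 'x \<Rightarrow> 'j \<Rightarrow> real" where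
  "Log_map f x = (\<lambda>j. ln (cmod (f j x)))"

text \<open>The type \<^typ>\<open>'j \<Rightarrow> real\<close> carries the product topology. Points of the quotient of
  the complement of the origin by the positive reals are orbits.\<close>

definition ray :: "('j \<Rightarrow> real) \<Rightarrow> ('j \<Rightarrow> real) set" where
  "ray v = {(\<lambda>j. c * v j) | c. c > 0}"

definition ray_space :: "('j \<Rightarrow> real) set topology" where
  "ray_space = topology (\<lambda>U. U \<subseteq> ray ` (- {\<lambda>_. 0}) \<and>
     openin (top_of_set (- {\<lambda>_. 0})) {v \<in> - {\<lambda>_. 0}. ray v \<in> U})"

lemma openin_ray_space:
  fixes U :: "('j \<Rightarrow> real) set set"
  shows "openin ray_space U \<longleftrightarrow> U \<subseteq> ray ` (- {\<lambda>_. 0}) \<and>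
     openin (top_of_set (- {\<lambda>_. 0})) {v \<in> - {\<lambda>_. 0}. ray v \<in> U}"
proof -
  let ?P = "\<lambda>U :: ('j \<Rightarrow> real) set set. U \<subseteq> ray ` (- {\<lambda>_. 0}) \<and>
     openin (top_of_set (- {\<lambda>_. 0})) {v \<in> - {\<lambda>_. 0}. ray v \<in> U}"
  have "istopology ?P"
    unfolding istopology_def
  proof (intro conjI allI impI)
    fix S T assume S: "?P S" and T: "?P T"
    show "S \<inter> T \<subseteq> ray ` (- {\<lambda>_. 0})" using S by blast
    have "{v \<in> - {\<lambda>_. 0}. ray v \<in> S \<inter> T} =
      {v \<in> - {\<lambda>_. 0}. ray v \<in> S} \<inter> {v \<in> - {\<lambda>_. 0}. ray v \<in> T}" by blast
    moreover have "openin (top_of_set (- {\<lambda>_. 0}))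
        ({v \<in> - {\<lambda>_. 0}. ray v \<in> S} \<inter> {v \<in> - {\<lambda>_. 0}. ray v \<in> T})"
      by (rule openin_Int[OF conjunct2[OF S] conjunct2[OF T]])
    ultimately show "openin (top_of_set (- {\<lambda>_. 0})) {v \<in> - {\<lambda>_. 0}. ray v \<in> S \<inter> T}"
      by (rule ssubst)
  next
    fix \<K> assume K: "\<forall>S\<in>\<K>. ?P S"
    show "\<Union>\<K> \<subseteq> ray ` (- {\<lambda>_. 0})" using K by blast
    have "{v \<in> - {\<lambda>_. 0}. ray v \<in> \<Union>\<K>} = (\<Union>S\<in>\<K>. {v \<in> - {\<lambda>_. 0}. ray v \<in> S})"
      by blast
    moreover have "openin (top_of_set (- {\<lambda>_. 0})) (\<Union>S\<in>\<K>. {v \<in> - {\<lambda>_. 0}. ray v \<in> S})"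
      by (rule openin_Union) (use K in blast)
    ultimately show "openin (top_of_set (- {\<lambda>_. 0})) {v \<in> - {\<lambda>_. 0}. ray v \<in> \<Union>\<K>}"
      by (rule ssubst)
  qed
  then have "openin (topology ?P) = ?P" by (rule topology_inverse')
  then show ?thesis unfolding ray_space_def by (rule fun_cong)
qed

lemma quotient_map_ray: "quotient_map (top_of_set (- {\<lambda>_. 0})) ray_space ray"
proof -
  have "{v \<in> - {\<lambda>_. 0}. ray v \<in> ray ` (- {\<lambda>_. 0})} = (- {\<lambda>_. 0} :: ('j \<Rightarrow> real) set)"
    by blast
  then have "openin (ray_space :: ('j \<Rightarrow> real) set topology) (ray ` (- {\<lambda>_. 0}))"
    unfolding openin_ray_space by (metis (no_types) openin_subtopology_self subset_refl)
  then have "ray ` (- {\<lambda>_. 0}) \<subseteq> topspace (ray_space :: ('j \<Rightarrow> real) set topology)"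
    by (rule openin_subset)
  moreover have "topspace (ray_space :: ('j \<Rightarrow> real) set topology) \<subseteq> ray ` (- {\<lambda>_. 0})"
    using openin_topspace[of "ray_space :: ('j \<Rightarrow> real) set topology"]
    unfolding openin_ray_space by (rule conjunct1)
  ultimately have "topspace (ray_space :: ('j \<Rightarrow> real) set topology) = ray ` (- {\<lambda>_. 0})"
    by (rule subset_antisym[rotated])
  then show ?thesis
    unfolding quotient_map_def topspace_euclidean_subtopology openin_ray_space by blast
qed

definition ideal_points ::
  "'x::topological_space set \<Rightarrow> ('j \<Rightarrow> 'x \<Rightarrow> complex) \<Rightarrow> ('j \<Rightarrow> real) set set" where
  "ideal_points V f = {b. \<exists>x :: nat \<Rightarrow> 'x.
     (\<forall>n. x n \<in> nonvanishing V f) \<and>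
     (\<forall>C. compact C \<and> C \<subseteq> nonvanishing V f \<longrightarrow> (\<forall>\<^sub>F n in sequentially. x n \<notin> C)) \<and>
     limitin ray_space (\<lambda>n. ray (Log_map f (x n))) b sequentially}"

definition cone_ideal_points ::
  "'x::topological_space set \<Rightarrow> ('j \<Rightarrow> 'x \<Rightarrow> complex) \<Rightarrow> ('j \<Rightarrow> real) set" where
  "cone_ideal_points V f =
     (if nonvanishing V f = {} then {}
      else {\<lambda>_. 0} \<union> {v. v \<noteq> (\<lambda>_. 0) \<and> ray v \<in> ideal_points V f})"

definition fraction_rel :: "('a, 'c) ring_scheme \<Rightarrow> 'a set \<Rightarrow> (('a \<times> 'a) \<times> ('a \<times> 'a)) set" where
  "fraction_rel R S = {((a, s), (b, t)) | a s b t.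
     a \<in> carrier R \<and> s \<in> S \<and> b \<in> carrier R \<and> t \<in> S \<and>
     (\<exists>u\<in>S. u \<otimes>\<^bsub>R\<^esub> (a \<otimes>\<^bsub>R\<^esub> t \<ominus>\<^bsub>R\<^esub> b \<otimes>\<^bsub>R\<^esub> s) = \<zero>\<^bsub>R\<^esub>)}"

definition fraction :: "('a, 'c) ring_scheme \<Rightarrow> 'a set \<Rightarrow> 'a \<Rightarrow> 'a \<Rightarrow> ('a \<times> 'a) set" where
  "fraction R S a s = fraction_rel R S `` {(a, s)}"

text \<open>The unions in the operations range over representatives and are unions of a single set,
  since the operations are compatible with the equivalence relation.\<close>

definition localization :: "('a, 'c) ring_scheme \<Rightarrow> 'a set \<Rightarrow> ('a \<times> 'a) set ring" where
  "localization R S =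
    \<lparr>carrier = (carrier R \<times> S) // fraction_rel R S,
     monoid.mult = (\<lambda>A B. \<Union>(a, s)\<in>A. \<Union>(b, t)\<in>B. fraction R S (a \<otimes>\<^bsub>R\<^esub> b) (s \<otimes>\<^bsub>R\<^esub> t)),
     one = fraction R S \<one>\<^bsub>R\<^esub> \<one>\<^bsub>R\<^esub>,
     ring.zero = fraction R S \<zero>\<^bsub>R\<^esub> \<one>\<^bsub>R\<^esub>,
     add = (\<lambda>A B. \<Union>(a, s)\<in>A. \<Union>(b, t)\<in>B.
       fraction R S (a \<otimes>\<^bsub>R\<^esub> t \<oplus>\<^bsub>R\<^esub> b \<otimes>\<^bsub>R\<^esub> s) (s \<otimes>\<^bsub>R\<^esub> t))\<rparr>"

definition mult_set ::
  "complex set \<Rightarrow> (complex ^ 'n::finite) set \<Rightarrow> ('j \<Rightarrow> complex ^ 'n \<Rightarrow> complex) \<Rightarrow>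
   (complex ^ 'n \<Rightarrow> complex) set" where
  "mult_set K V f = (\<lambda>S. submonoid S (coordinate_ring K V)) hull (range f)"

definition localized_ring ::
  "complex set \<Rightarrow> (complex ^ 'n::finite) set \<Rightarrow> ('j \<Rightarrow> complex ^ 'n \<Rightarrow> complex) \<Rightarrow>
   ((complex ^ 'n \<Rightarrow> complex) \<times> (complex ^ 'n \<Rightarrow> complex)) set ring" where
  "localized_ring K V f = localization (coordinate_ring K V) (mult_set K V f)"

definition localized ::
  "complex set \<Rightarrow> (complex ^ 'n::finite) set \<Rightarrow> ('j \<Rightarrow> complex ^ 'n \<Rightarrow> complex) \<Rightarrow>
   (complex ^ 'n \<Rightarrow> complex) \<Rightarrow> ((complex ^ 'n \<Rightarrow> complex) \<times> (complex ^ 'n \<Rightarrow> complex)) set" where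
  "localized K V f g = fraction (coordinate_ring K V) (mult_set K V f) g \<one>\<^bsub>coordinate_ring K V\<^esub>"

definition laurent_ring :: "complex set \<Rightarrow> (('j \<Rightarrow>\<^sub>0 int) \<Rightarrow>\<^sub>0 complex) ring" where
  "laurent_ring K = univ_ring\<lparr>carrier := coeffs_in K\<rparr>"

definition laurent_eval ::
  "complex set \<Rightarrow> (complex ^ 'n::finite) set \<Rightarrow> ('j \<Rightarrow> complex ^ 'n \<Rightarrow> complex) \<Rightarrow>
   (('j \<Rightarrow>\<^sub>0 int) \<Rightarrow>\<^sub>0 complex) \<Rightarrow> ((complex ^ 'n \<Rightarrow> complex) \<times> (complex ^ 'n \<Rightarrow> complex)) set" where
  "laurent_eval K V f p = (let L = localized_ring K V f in
     \<Oplus>\<^bsub>L\<^esub> \<omega> \<in> Poly_Mapping.keys p.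
       localized K V f (\<lambda>x\<in>V. Poly_Mapping.lookup p \<omega>) \<otimes>\<^bsub>L\<^esub>
       (\<Otimes>\<^bsub>L\<^esub> j \<in> Poly_Mapping.keys \<omega>. localized K V f (f j) [^]\<^bsub>L\<^esub> Poly_Mapping.lookup \<omega> j))"

definition relation_ideal ::
  "complex set \<Rightarrow> (complex ^ 'n::finite) set \<Rightarrow> ('j \<Rightarrow> complex ^ 'n \<Rightarrow> complex) \<Rightarrow>
   (('j \<Rightarrow>\<^sub>0 int) \<Rightarrow>\<^sub>0 complex) set" where
  "relation_ideal K V f = a_kernel (laurent_ring K) (localized_ring K V f) (laurent_eval K V f)"

definition pairing :: "('j \<Rightarrow> real) \<Rightarrow> ('j \<Rightarrow>\<^sub>0 int) \<Rightarrow> real" where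
  "pairing x \<omega> = (\<Sum>j\<in>Poly_Mapping.keys \<omega>. x j * real_of_int (Poly_Mapping.lookup \<omega> j))"

text \<open>The supremum in \<^typ>\<open>ereal\<close> is the maximum of a finite set, and is \<open>-\<infinity>\<close> for the
  empty set.\<close>

definition tropical_zeros :: "(('j \<Rightarrow>\<^sub>0 int) \<Rightarrow>\<^sub>0 complex) \<Rightarrow> ('j \<Rightarrow> real) set" where
  "tropical_zeros p = {x. \<forall>w \<in> Poly_Mapping.keys p.
     ereal (pairing x w) \<le> (SUP \<omega> \<in> Poly_Mapping.keys p - {w}. ereal (pairing x \<omega>))}"

definition tropical_variety :: "(('j \<Rightarrow>\<^sub>0 int) \<Rightarrow>\<^sub>0 complex) set \<Rightarrow> ('j \<Rightarrow> real) set" where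
  "tropical_variety I = (\<Inter>p\<in>I. tropical_zeros p)"

end

theory Submission
  imports Defs "HOL-Computational_Algebra.Fundamental_Theorem_Algebra"
begin

text \<open>
  \<^bold>\<open>Ideal points are tropical.\<close> Suppose that \<open>c n * Log (x n)\<close> tends to \<open>v\<close> with positive
  \<open>c n\<close> tending to \<open>0\<close>, and let \<open>p\<close> be a relation between the \<open>f j\<close>. The terms of \<open>p\<close> at \<open>x n\<close>
  sum up to zero, so none of them can be larger than all others by a factor which tends to infinity;
  as the size of the monomial \<open>\<omega>\<close> at \<open>x n\<close> is roughly \<open>exp (\<langle>v, \<omega>\<rangle> / c n)\<close>, no exponent can be the
  only maximum of \<open>\<langle>v, \<omega>\<rangle>\<close> (\<open>dominated_by_others\<close>, \<open>cone_subset_tropical\<close>). That \<open>c n\<close> tends to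
  \<open>0\<close> is compactness: if one coordinate of \<open>Log\<close> whose limit direction is nonzero stayed bounded
  along a subsequence, all would, hence all elements of the coordinate ring would, and the points
  would stay in a compact subset of \<open>V'\<close> (\<open>Log_unbounded\<close>).

  \<^bold>\<open>Tropical points are limits.\<close> Let \<open>v\<close> be in the tropical variety. Give the monomial \<open>\<omega>\<close> the norm
  \<open>exp \<langle>v, \<omega>\<rangle>\<close>. That no relation has a single dominant monomial says that \<open>1\<close> still has norm \<open>1\<close> in the
  quotient of the Laurent polynomial ring over \<open>K\<close> by the ideal of relations. By Berkovich's theorem
  that the spectrum of a nonzero seminormed ring is not empty (\<open>exists_mult_seminorm\<close>) there is a
  multiplicative ultrametric seminorm \<open>\<nu>\<close> below the quotient seminorm. Units of norm \<open>r\<close> whose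
  inverses have norm \<open>1 / r\<close> keep their norm, so \<open>\<nu>\<close> is \<open>exp (v j)\<close> at the variable \<open>j\<close> and trivial
  on \<open>K\<close> (\<open>tropical_seminorm\<close>). The quotient by the kernel of \<open>\<nu>\<close> is a countable domain over \<open>K\<close>,
  and hence embeds into the field of complex numbers over \<open>K\<close> (\<open>extend_partial_hom\<close>).
  So \<open>\<nu>\<close> becomes a nonarchimedean absolute value on a countable subring of the complex numbers.

  It remains to see that this absolute value, at finitely many elements \<open>g\<close>, is a limit of
  \<open>g \<mapsto> cmod (D g) powr c\<close> with \<open>c\<close> tending to \<open>0\<close> and \<open>D\<close> embeddings over \<open>K\<close> into the complex
  numbers; such a \<open>D\<close>, extended to the whole ring, is a point of \<open>V'\<close> whose logarithms are \<open>ln (\<nu> g) / c\<close>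
  up to a small error (\<open>point_of_hom\<close>, \<open>approximating_points\<close>). This is the notion \<open>approximable\<close>, and it
  is proved by adjoining one generator at a time. For a transcendental generator \<open>y\<close> one extends the
  absolute value to all roots of the polynomials in \<open>y\<close> which occur; then the value of \<open>y - a\<close> at
  a root \<open>a\<close> is determined by the distances between the roots and by the distance of \<open>y\<close> to the nearest
  root, and a complex number on a circle of the corresponding radius has
  these distances to the images of the roots up to bounded factors, which do not matter as \<open>c\<close> tends to
  \<open>0\<close> (\<open>approximable_transcendental\<close>). After adjoining an algebraic generator, each
  element is a root of a polynomial over the smaller ring, and the scaled logarithm of its image is close to one
  of the finitely many slopes of a Newton polygon. Some monomial in the given elements
  tells the finitely many candidates apart, and the right value of this monomial is a slope for its own minimal
  polynomial, hence attained for a suitable choice of a root (\<open>approximable_algebraic\<close>).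

  Since an embedding sends nonzero elements to nonzero numbers, the points obtained satisfy all infinitely
  many conditions \<open>f j x \<noteq> 0\<close> at once; countability of \<open>K\<close> and of the family leaves room in the complex
  numbers for these embeddings.
\<close>

hide_const (open) module.smult up_ring.coeff up_ring.monom Polynomials.degree Polynomials.lead_coeff Coset.order

section \<open>Multiplicative seminorms below a given seminorm\<close>

definition subring_set :: "'a::comm_ring_1 set \<Rightarrow> bool" where
  "subring_set A \<longleftrightarrow> 1 \<in> A \<and> (\<forall>a\<in>A. \<forall>b\<in>A. a - b \<in> A \<and> a * b \<in> A)"

lemma subring_setD:
  assumes "subring_set A"
  shows "1 \<in> A" "0 \<in> A" "a \<in> A \<Longrightarrow> b \<in> A \<Longrightarrow> a - b \<in> A"
    "a \<in> A \<Longrightarrow> b \<in> A \<Longrightarrow> a * b \<in> A" "a \<in> A \<Longrightarrow> - a \<in> A"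
    "a \<in> A \<Longrightarrow> b \<in> A \<Longrightarrow> a + b \<in> A"
proof -
  show 1: "1 \<in> A" and d: "\<And>a b. a \<in> A \<Longrightarrow> b \<in> A \<Longrightarrow> a - b \<in> A"
    and "a \<in> A \<Longrightarrow> b \<in> A \<Longrightarrow> a * b \<in> A" for a b
    using assms unfolding subring_set_def by blast+
  show 0: "0 \<in> A" using d[OF 1 1] by simp
  show n: "- a \<in> A" if "a \<in> A" for a using d[OF 0 that] by simp
  show "a \<in> A \<Longrightarrow> b \<in> A \<Longrightarrow> a + b \<in> A" using d[OF _ n, of a b] by simp
qed

lemma subring_set_power: "subring_set A \<Longrightarrow> a \<in> A \<Longrightarrow> a ^ n \<in> A"
  by (induction n) (auto simp: subring_setD)

lemma subring_set_sum:
  assumes "subring_set A" "\<And>i. i \<in> I \<Longrightarrow> g i \<in> A"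
  shows "sum g I \<in> A"
  using assms(2) by (induction I rule: infinite_finite_induct) (auto simp: subring_setD[OF assms(1)])

lemma subring_set_prod:
  assumes "subring_set A" "\<And>i. i \<in> I \<Longrightarrow> g i \<in> A"
  shows "prod g I \<in> A"
  using assms(2) by (induction I rule: infinite_finite_induct) (auto simp: subring_setD[OF assms(1)])

lemma subring_set_poly:
  assumes "subring_set A" "\<And>i. coeff p i \<in> A" "x \<in> A"
  shows "poly p x \<in> A"
  unfolding poly_altdef
  by (intro subring_set_sum[OF assms(1)] subring_setD(4)[OF assms(1)] assms subring_set_power)

text \<open>An ultrametric submultiplicative seminorm is given by the pairs \<open>(a, t)\<close> with \<open>t\<close> an upper bound for the norm of
  \<open>a\<close>. Smaller seminorms have larger epigraphs, so unions of chains provide the lower bounds needed for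
  Zorn's lemma, without taking infima. The last condition keeps the seminorm from vanishing.\<close>

definition seminorm_epigraph :: "'a::comm_ring_1 set \<Rightarrow> ('a \<times> real) set \<Rightarrow> bool" where
  "seminorm_epigraph A T \<longleftrightarrow>
     T \<subseteq> A \<times> {0..} \<and> (\<forall>a\<in>A. \<exists>t. (a, t) \<in> T) \<and>
     (\<forall>a s t. (a, s) \<in> T \<longrightarrow> s \<le> t \<longrightarrow> (a, t) \<in> T) \<and>
     (0, 0) \<in> T \<and> (1, 1) \<in> T \<and>
     (\<forall>a s b t. (a, s) \<in> T \<longrightarrow> (b, t) \<in> T \<longrightarrow> (a - b, max s t) \<in> T \<and> (a * b, s * t) \<in> T) \<and>
     (\<forall>t. (1, t) \<in> T \<longrightarrow> 1 \<le> t)"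

lemma seminorm_epigraphI:
  assumes "T \<subseteq> A \<times> {0..}" "\<And>a. a \<in> A \<Longrightarrow> \<exists>t. (a, t) \<in> T"
    "\<And>a s t. (a, s) \<in> T \<Longrightarrow> s \<le> t \<Longrightarrow> (a, t) \<in> T"
    "(0, 0) \<in> T" "(1, 1) \<in> T"
    "\<And>a s b t. (a, s) \<in> T \<Longrightarrow> (b, t) \<in> T \<Longrightarrow> (a - b, max s t) \<in> T"
    "\<And>a s b t. (a, s) \<in> T \<Longrightarrow> (b, t) \<in> T \<Longrightarrow> (a * b, s * t) \<in> T"
    "\<And>t. (1, t) \<in> T \<Longrightarrow> 1 \<le> t"
  shows "seminorm_epigraph A T"
  unfolding seminorm_epigraph_def
  by (intro conjI allI impI ballI) (fact assms | (rule assms, assumption+))+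

definition mult_seminorm :: "'a::comm_ring_1 set \<Rightarrow> ('a \<Rightarrow> real) \<Rightarrow> bool" where
  "mult_seminorm A \<nu> \<longleftrightarrow> \<nu> 1 = 1 \<and> \<nu> 0 = 0 \<and>
     (\<forall>a\<in>A. 0 \<le> \<nu> a) \<and>
     (\<forall>a\<in>A. \<forall>b\<in>A. \<nu> (a * b) = \<nu> a * \<nu> b \<and> \<nu> (a - b) \<le> max (\<nu> a) (\<nu> b))"

locale epigraph =
  fixes A :: "'a::comm_ring_1 set" and T
  assumes A: "subring_set A" and T: "seminorm_epigraph A T"
begin

lemma in_A: "(a, t) \<in> T \<Longrightarrow> a \<in> A" and nonneg: "(a, t) \<in> T \<Longrightarrow> 0 \<le> t"
  and total: "a \<in> A \<Longrightarrow> \<exists>t. (a, t) \<in> T"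
  and up: "(a, s) \<in> T \<Longrightarrow> s \<le> t \<Longrightarrow> (a, t) \<in> T"
  and zero_in: "(0, 0) \<in> T" and one_in: "(1, 1) \<in> T"
  and diff_in: "(a, s) \<in> T \<Longrightarrow> (b, t) \<in> T \<Longrightarrow> (a - b, max s t) \<in> T"
  and mult_in: "(a, s) \<in> T \<Longrightarrow> (b, t) \<in> T \<Longrightarrow> (a * b, s * t) \<in> T"
  and unit: "(1, t) \<in> T \<Longrightarrow> 1 \<le> t"
  using T unfolding seminorm_epigraph_def by blast+

lemma zero_in': "0 \<le> t \<Longrightarrow> (0, t) \<in> T" using up zero_in by blast

lemma add_in: "(a, t) \<in> T \<Longrightarrow> (b, t) \<in> T \<Longrightarrow> (a + b, t) \<in> T"
  using diff_in[OF _ diff_in[OF zero_in], of a t b t] nonneg[of a t] by (simp add: max_def)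

lemma sum_in:
  assumes "0 \<le> t" "\<And>i. i \<in> I \<Longrightarrow> (g i, t) \<in> T"
  shows "(sum g I, t) \<in> T"
  using assms(2)
  by (induction I rule: infinite_finite_induct) (auto simp: zero_in' assms(1) intro: add_in)

lemma power_in: "(a, t) \<in> T \<Longrightarrow> (a ^ n, t ^ n) \<in> T"
  by (induction n) (auto simp: one_in mult_in)

definition sn :: "'a \<Rightarrow> real" where "sn a = Inf {t. (a, t) \<in> T}"

lemma bdd: "bdd_below {t. (a, t) \<in> T}"
  by (rule bdd_belowI[of _ 0]) (auto dest: nonneg)

lemma sn_le: "(a, t) \<in> T \<Longrightarrow> sn a \<le> t"
  unfolding sn_def by (rule cInf_lower[OF _ bdd]) auto

lemma sn_less: "a \<in> A \<Longrightarrow> sn a < t \<Longrightarrow> (a, t) \<in> T"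
  unfolding sn_def using total[of a] up[of a]
  by (subst (asm) cInf_less_iff[OF _ bdd]) (auto intro: less_imp_le)

lemma sn_greatest: "a \<in> A \<Longrightarrow> (\<And>t. (a, t) \<in> T \<Longrightarrow> c \<le> t) \<Longrightarrow> c \<le> sn a"
  unfolding sn_def by (rule cInf_greatest) (use total in auto)

lemma sn_nonneg: "a \<in> A \<Longrightarrow> 0 \<le> sn a" by (rule sn_greatest) (auto dest: nonneg)

lemma sn_0: "sn 0 = 0" using sn_le[OF zero_in] sn_nonneg[of 0] subring_setD[OF A] by force

lemma sn_1: "sn 1 = 1" using sn_le[OF one_in] sn_greatest[of 1 1] unit subring_setD[OF A] by force

lemma sn_diff: assumes "a \<in> A" "b \<in> A" shows "sn (a - b) \<le> max (sn a) (sn b)"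
proof (rule dense_ge)
  fix z assume z: "max (sn a) (sn b) < z"
  then have "(a, z) \<in> T" "(b, z) \<in> T" using sn_less assms by auto
  then show "sn (a - b) \<le> z" using sn_le diff_in by (metis max.idem)
qed

lemma sn_mult: assumes "a \<in> A" "b \<in> A" shows "sn (a * b) \<le> sn a * sn b"
proof -
  have "sn (a * b) \<le> (sn a + e) * (sn b + e)" if "e > 0" for e
    using that mult_in[of a "sn a + e" b "sn b + e"] sn_less assms sn_le by simp
  then have *: "\<forall>\<^sub>F e in at_right 0. sn (a * b) \<le> (sn a + e) * (sn b + e)"
    by (auto simp: eventually_at_filter)
  have "((\<lambda>e. (sn a + e) * (sn b + e)) \<longlongrightarrow> (sn a + 0) * (sn b + 0)) (at_right 0)"
    by (intro tendsto_intros)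
  from tendsto_lowerbound[OF this *] show ?thesis by simp
qed

lemma sn_power: "a \<in> A \<Longrightarrow> sn (a ^ n) \<le> sn a ^ n"
proof (induction n)
  case (Suc n)
  then show ?case using sn_mult[of a "a ^ n"] subring_set_power[OF A, of a n] sn_nonneg[of a]
    by (smt (verit) mult_left_mono power_Suc)
qed (simp add: sn_1)

end

locale max_epigraph = epigraph +
  assumes maximal: "\<And>T'. seminorm_epigraph A T' \<Longrightarrow> T \<subseteq> T' \<Longrightarrow> T' = T"
begin

text \<open>A minimal seminorm cannot be lowered at \<open>b\<close> by assigning to a sum \<open>\<Sum>i. c i * b ^ i\<close> the
  largest size of the \<open>c i\<close>, weighted by \<open>\<rho> ^ i\<close>. The lowered seminorm is nonzero: if \<open>1\<close> had size \<open>t < 1\<close>, then \<open>1 = 1 ^ k\<close> would have size \<open>t ^ k\<close>,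
  while the bound for the powers of \<open>b\<close> yields \<open>1 \<le> C * t ^ k\<close>.\<close>

lemma adjoin:
  assumes b: "b \<in> A" and \<rho>: "\<rho> > 0" and C: "C \<ge> 0" and pw: "\<And>i. (b ^ i, C * \<rho> ^ i) \<in> T"
  shows "(b, \<rho>) \<in> T"
proof -
  define T' where "T' = {(a, t). 0 \<le> t \<and> (\<exists>p. (\<forall>i. (coeff p i, t / \<rho> ^ i) \<in> T) \<and> poly p b = a)}"
  have c0: "(c, t) \<in> T \<Longrightarrow> (c, t) \<in> T'" for c t
    unfolding T'_def using \<rho>
    by (auto intro!: exI[of _ "[:c:]"] zero_in' divide_nonneg_pos simp: coeff_pCons split: nat.split dest: nonneg)
  have m: "(a * a', s * t) \<in> T'" if "(a, s) \<in> T'" "(a', t) \<in> T'" for a s a' t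
  proof -
    from that obtain p q where p: "\<And>i. (coeff p i, s / \<rho> ^ i) \<in> T" "poly p b = a" "0 \<le> s"
      and q: "\<And>i. (coeff q i, t / \<rho> ^ i) \<in> T" "poly q b = a'" "0 \<le> t" unfolding T'_def by blast
    have "(coeff (p * q) i, s * t / \<rho> ^ i) \<in> T" for i
      unfolding coeff_mult
    proof (rule sum_in)
      show "0 \<le> s * t / \<rho> ^ i" using p q \<rho> by simp
      fix j assume "j \<in> {..i}"
      then have "\<rho> ^ i = \<rho> ^ j * \<rho> ^ (i - j)" by (simp add: power_add[symmetric])
      then show "(coeff p j * coeff q (i - j), s * t / \<rho> ^ i) \<in> T"
        using mult_in[OF p(1)[of j] q(1)[of "i - j"]] by simp
    qed
    then show ?thesis unfolding T'_def using p q by (auto intro!: exI[of _ "p * q"])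
  qed
  have d: "(a - a', max s t) \<in> T'" if "(a, s) \<in> T'" "(a', t) \<in> T'" for a s a' t
  proof -
    from that obtain p q where p: "\<And>i. (coeff p i, s / \<rho> ^ i) \<in> T" "poly p b = a" "0 \<le> s"
      and q: "\<And>i. (coeff q i, t / \<rho> ^ i) \<in> T" "poly q b = a'" "0 \<le> t" unfolding T'_def by blast
    have "(coeff (p - q) i, max s t / \<rho> ^ i) \<in> T" for i
      using diff_in[OF p(1)[of i] q(1)[of i]] \<rho> by (simp add: max_divide_distrib_right)
    then show ?thesis unfolding T'_def using p q by (auto intro!: exI[of _ "p - q"])
  qed
  have u: "(a, t) \<in> T'" if at: "(a, s) \<in> T'" "s \<le> t" for a s t
  proof -
    from at obtain p where p: "\<And>i. (coeff p i, s / \<rho> ^ i) \<in> T" "poly p b = a" "0 \<le> s"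
      unfolding T'_def by blast
    have "(coeff p i, t / \<rho> ^ i) \<in> T" for i
      by (rule up[OF p(1)]) (use at(2) \<rho> in \<open>simp add: divide_right_mono\<close>)
    then show ?thesis unfolding T'_def using p at(2) by auto
  qed
  have un: "1 \<le> t" if one: "(1, t) \<in> T'" for t
  proof (rule ccontr)
    assume "\<not> 1 \<le> t"
    have t0: "0 \<le> t" using one unfolding T'_def by blast
    have 1: "1 \<le> C * t ^ k" for k
    proof -
      have "(1, t ^ k) \<in> T'"
        by (induction k) (use c0 one_in m[OF one] in auto)
      then obtain p where p: "\<And>i. (coeff p i, t ^ k / \<rho> ^ i) \<in> T" "poly p b = 1"
        unfolding T'_def by blast
      have "(poly p b, C * t ^ k) \<in> T"
        unfolding poly_altdef
      proof (rule sum_in)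
        show "0 \<le> C * t ^ k" using C t0 by simp
        show "(coeff p i * b ^ i, C * t ^ k) \<in> T" for i
          using mult_in[OF p(1)[of i] pw[of i]] \<rho> by (simp add: mult.commute)
      qed
      then show ?thesis using p(2) unit by simp
    qed
    have "(\<lambda>k. C * t ^ k) \<longlonglongrightarrow> C * 0"
      by (intro tendsto_intros LIMSEQ_power_zero) (use t0 \<open>\<not> 1 \<le> t\<close> in auto)
    then show False using 1 LIMSEQ_le_const[of "\<lambda>k. C * t ^ k" "C * 0" 1] by auto
  qed
  have sub: "T' \<subseteq> A \<times> {0..}"
  proof
    fix x assume x: "x \<in> T'"
    have "\<exists>p. (\<forall>i. (coeff p i, snd x / \<rho> ^ i) \<in> T) \<and> poly p b = fst x" and 0: "0 \<le> snd x"
      using x[unfolded T'_def mem_Collect_eq case_prod_beta] by (blast, blast)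
    then obtain p where p: "\<And>i. (coeff p i, snd x / \<rho> ^ i) \<in> T" "poly p b = fst x" by blast
    have "poly p b \<in> A" by (rule subring_set_poly[OF A in_A[OF p(1)] b])
    then show "x \<in> A \<times> {0..}" using p(2) 0 by (simp add: mem_Times_iff)
  qed
  have tot: "\<exists>t. (a, t) \<in> T'" if "a \<in> A" for a using total[OF that] c0 by blast
  have "seminorm_epigraph A T'"
    by (rule seminorm_epigraphI) (fact sub tot u c0[OF zero_in] c0[OF one_in] d m un)+
  moreover have "T \<subseteq> T'" using c0 by auto
  ultimately have "T' = T" by (rule maximal)
  moreover have "(b, \<rho>) \<in> T'"
    unfolding T'_def using \<rho> one_in
    by (auto intro!: exI[of _ "[:0, 1:]"] simp: coeff_pCons zero_in' split: nat.split)
  ultimately show ?thesis by simp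
qed

text \<open>Otherwise the powers of \<open>b\<close> would be bounded by those of some \<open>\<rho>\<close> below its norm, up to a constant
  which takes care of odd exponents.\<close>

lemma sn_square: assumes b: "b \<in> A" shows "sn (b\<^sup>2) = (sn b)\<^sup>2"
proof (rule ccontr)
  assume "\<not> ?thesis"
  then have less: "sn (b\<^sup>2) < (sn b)\<^sup>2" using sn_power[OF b, of 2] by simp
  then obtain r where r: "sn (b\<^sup>2) < r" "r < (sn b)\<^sup>2" using dense by blast
  have b2: "b\<^sup>2 \<in> A" using b subring_set_power[OF A] by blast
  then have r0: "r > 0" using sn_nonneg r by (meson order.strict_trans1)
  define \<rho> where "\<rho> = sqrt r"
  have \<rho>: "\<rho> > 0" "\<rho>\<^sup>2 = r" "\<rho> < sn b"
    using r0 r(2) sn_nonneg[OF b] by (auto simp: \<rho>_def real_less_lsqrt)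
  have bT: "(b, sn b + 1) \<in> T" using sn_less[OF b] by simp
  define C where "C = max 1 ((sn b + 1) / \<rho>)"
  have "(b ^ i, C * \<rho> ^ i) \<in> T" for i
  proof (cases "even i")
    case True
    then obtain k where k: "i = 2 * k" by blast
    have "((b\<^sup>2) ^ k, r ^ k) \<in> T" by (rule power_in[OF sn_less[OF b2 r(1)]])
    then have "(b ^ i, 1 * \<rho> ^ i) \<in> T" unfolding k by (simp add: power_mult \<rho>(2))
    moreover have "1 * \<rho> ^ i \<le> C * \<rho> ^ i" by (intro mult_right_mono) (use \<rho> in \<open>auto simp: C_def\<close>)
    ultimately show ?thesis by (rule up)
  next
    case False
    then obtain k where k: "i = 2 * k + 1" by (metis oddE)
    have "((b\<^sup>2) ^ k * b, r ^ k * (sn b + 1)) \<in> T"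
      by (rule mult_in[OF power_in[OF sn_less[OF b2 r(1)]] bT])
    then have "(b ^ i, (sn b + 1) / \<rho> * \<rho> ^ i) \<in> T"
      unfolding k power_add power_mult \<rho>(2) using \<rho>(1) by (simp add: mult.commute)
    moreover have "(sn b + 1) / \<rho> * \<rho> ^ i \<le> C * \<rho> ^ i"
      by (intro mult_right_mono) (use \<rho> in \<open>auto simp: C_def\<close>)
    ultimately show ?thesis by (rule up)
  qed
  then have "(b, \<rho>) \<in> T" using adjoin[OF b \<rho>(1), of C] by (auto simp: C_def)
  then show False using sn_le \<rho>(3) by force
qed

lemma sn_power_eq: assumes b: "b \<in> A" shows "sn (b ^ n) = sn b ^ n"
proof -
  have pw2: "sn (b ^ (2 ^ k)) = sn b ^ (2 ^ k)" for k
  proof (induction k)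
    case (Suc k)
    have "sn ((b ^ 2 ^ k)\<^sup>2) = (sn (b ^ 2 ^ k))\<^sup>2" by (rule sn_square[OF subring_set_power[OF A b]])
    then show ?case unfolding power_Suc2 power_mult Suc .
  qed simp
  define N :: nat where "N = 2 ^ n"
  have n: "n \<le> N" unfolding N_def by (simp add: less_imp_le)
  have "sn b ^ n * sn b ^ (N - n) = sn (b ^ n * b ^ (N - n))"
    using pw2[of n] n by (simp add: power_add[symmetric] N_def)
  also have "\<dots> \<le> sn (b ^ n) * sn (b ^ (N - n))" by (intro sn_mult subring_set_power A b)
  also have "\<dots> \<le> sn (b ^ n) * sn b ^ (N - n)"
    by (intro mult_left_mono sn_power b sn_nonneg subring_set_power A)
  finally have *: "sn b ^ n * sn b ^ (N - n) \<le> sn (b ^ n) * sn b ^ (N - n)" .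
  show ?thesis
  proof (cases "sn b = 0")
    case True
    then show ?thesis using sn_power[OF b, of n] sn_nonneg[OF subring_set_power[OF A b], of n]
      by (cases n) (auto simp: sn_1)
  next
    case False
    then have "sn b ^ (N - n) > 0" using sn_nonneg[OF b] by simp
    then show ?thesis using * sn_power[OF b, of n] by simp
  qed
qed

text \<open>The limit of \<open>sn (a * b ^ n) / sn b ^ n\<close> is again a seminorm below \<open>sn\<close>, where multiplicativity on the powers of
  \<open>b\<close> is used. By minimality it is \<open>sn\<close>; but by its construction it is at most \<open>sn (a * b) / sn b\<close> at \<open>a\<close>.\<close>

lemma sn_mult_eq: assumes a: "a \<in> A" and b: "b \<in> A" shows "sn (a * b) = sn a * sn b"
proof (cases "sn b = 0")
  case True
  then show ?thesis using sn_mult[OF a b] sn_nonneg[OF subring_setD(4)[OF A a b]] by simp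
next
  case False
  then have b0: "sn b > 0" using sn_nonneg[OF b] by simp
  have bA: "b ^ n \<in> A" for n by (rule subring_set_power[OF A b])
  have bT: "(b ^ n, sn b ^ n * (1 + e)) \<in> T" if "e > 0" for n e
    by (rule sn_less) (use that b0 bA sn_power_eq[OF b] in auto)
  define T' where "T' = {(a, t). a \<in> A \<and> 0 \<le> t \<and> (\<forall>e>0. \<exists>n. (a * b ^ n, (t + e) * sn b ^ n) \<in> T)}"
  have c0: "(c, t) \<in> T \<Longrightarrow> (c, t) \<in> T'" for c t
    unfolding T'_def by (auto dest: nonneg in_A intro!: exI[of _ 0] intro: up)
  have shift: "\<exists>n. \<forall>m\<ge>n. (a * b ^ m, (t + e) * sn b ^ m) \<in> T" if at: "(a, t) \<in> T'" and e: "e > 0" for a t e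
  proof -
    have t0: "t \<ge> 0" using at by (simp add: T'_def)
    have aA: "a \<in> A" using at by (simp add: T'_def)
    have "\<forall>e>0. \<exists>n. (a * b ^ n, (t + e) * sn b ^ n) \<in> T" using at unfolding T'_def by blast
    from this[rule_format, of "e / 2"] e
    obtain n where n: "(a * b ^ n, (t + e / 2) * sn b ^ n) \<in> T" by auto
    have "(a * b ^ m, (t + e) * sn b ^ m) \<in> T" if "m \<ge> n" for m
    proof (rule sn_less)
      show "a * b ^ m \<in> A" using aA bA subring_setD(4)[OF A] by blast
      have "sn (a * b ^ m) = sn ((a * b ^ n) * b ^ (m - n))"
        using that by (simp add: mult.assoc power_add[symmetric])
      also have "\<dots> \<le> sn (a * b ^ n) * sn (b ^ (m - n))"
        by (intro sn_mult bA subring_setD(4)[OF A] aA)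
      also have "\<dots> \<le> ((t + e / 2) * sn b ^ n) * sn b ^ (m - n)"
        unfolding sn_power_eq[OF b] by (intro mult_right_mono sn_le n) (use b0 in auto)
      also have "\<dots> = (t + e / 2) * sn b ^ m" using that by (simp add: mult.assoc power_add[symmetric])
      also have "\<dots> < (t + e) * sn b ^ m" using b0 e by simp
      finally show "sn (a * b ^ m) < (t + e) * sn b ^ m" .
    qed
    then show ?thesis by blast
  qed
  have m: "(x * y, s * t) \<in> T'" if x: "(x, s) \<in> T'" and y: "(y, t) \<in> T'" for x s y t
  proof -
    have "\<exists>n. (x * y * b ^ n, (s * t + e) * sn b ^ n) \<in> T" if e: "e > 0" for e
    proof -
      have s0: "s \<ge> 0" and t0: "t \<ge> 0" using x y by (simp_all add: T'_def)
      define d where "d = min 1 (e / (s + t + 1))"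
      have d: "d > 0" "d \<le> 1" using s0 t0 e by (simp_all add: d_def)
      have "d \<le> e / (s + t + 1)" by (simp add: d_def)
      then have d3: "d * (s + t + 1) \<le> e" using s0 t0 by (subst (asm) pos_le_divide_eq) simp_all
      have "(s + d) * (t + d) = s * t + d * (s + t + d)" by (simp add: algebra_simps)
      also have "\<dots> \<le> s * t + d * (s + t + 1)"
        by (intro add_left_mono mult_left_mono) (use d in simp_all)
      also have "\<dots> \<le> s * t + e" using d3 by simp
      finally have le: "(s + d) * (t + d) \<le> s * t + e" .
      obtain n k where n: "(x * b ^ n, (s + d) * sn b ^ n) \<in> T" and k: "(y * b ^ k, (t + d) * sn b ^ k) \<in> T"
        using shift[OF x d(1)] shift[OF y d(1)] by blast
      have "(x * y * b ^ (n + k), ((s + d) * (t + d)) * sn b ^ (n + k)) \<in> T"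
        using mult_in[OF n k] by (simp add: power_add mult_ac)
      then have "(x * y * b ^ (n + k), (s * t + e) * sn b ^ (n + k)) \<in> T"
        by (rule up) (use le b0 in \<open>simp add: mult_right_mono\<close>)
      then show ?thesis by blast
    qed
    moreover have "x * y \<in> A" "0 \<le> s * t" using x y by (simp_all add: T'_def subring_setD(4)[OF A])
    ultimately show ?thesis unfolding T'_def by blast
  qed
  have d: "(x - y, max s t) \<in> T'" if x: "(x, s) \<in> T'" and y: "(y, t) \<in> T'" for x s y t
  proof -
    have "\<exists>n. ((x - y) * b ^ n, (max s t + e) * sn b ^ n) \<in> T" if e: "e > 0" for e
    proof -
      obtain n k where n: "\<forall>m\<ge>n. (x * b ^ m, (s + e) * sn b ^ m) \<in> T"
        and k: "\<forall>m\<ge>k. (y * b ^ m, (t + e) * sn b ^ m) \<in> T"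
        using shift[OF x e] shift[OF y e] by blast
      have "(x * b ^ max n k - y * b ^ max n k, max ((s + e) * sn b ^ max n k) ((t + e) * sn b ^ max n k)) \<in> T"
        using n k by (intro diff_in) auto
      moreover have "max ((s + e) * sn b ^ max n k) ((t + e) * sn b ^ max n k) \<le> (max s t + e) * sn b ^ max n k"
        using b0 by (auto intro!: mult_right_mono)
      ultimately have "((x - y) * b ^ max n k, (max s t + e) * sn b ^ max n k) \<in> T"
        unfolding left_diff_distrib[symmetric] by (rule up)
      then show ?thesis by blast
    qed
    moreover have "x - y \<in> A" "0 \<le> max s t"
      using x y by (simp_all add: T'_def subring_setD(3)[OF A] max_def)
    ultimately show ?thesis unfolding T'_def by blast
  qed
  have u: "(x, t) \<in> T'" if "(x, s) \<in> T'" "s \<le> t" for x s t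
  proof -
    have "\<exists>n. (x * b ^ n, (t + e) * sn b ^ n) \<in> T" if e: "e > 0" for e
    proof -
      obtain n where "\<forall>m\<ge>n. (x * b ^ m, (s + e) * sn b ^ m) \<in> T"
        using shift[OF \<open>(x, s) \<in> T'\<close> e] by blast
      then have "(x * b ^ n, (s + e) * sn b ^ n) \<in> T" by simp
      moreover have "(s + e) * sn b ^ n \<le> (t + e) * sn b ^ n"
        by (intro mult_right_mono) (use b0 \<open>s \<le> t\<close> in auto)
      ultimately have "(x * b ^ n, (t + e) * sn b ^ n) \<in> T" by (rule up)
      then show ?thesis by blast
    qed
    moreover have "x \<in> A" "0 \<le> t" using that by (simp_all add: T'_def)
    ultimately show ?thesis unfolding T'_def by blast
  qed
  have un: "1 \<le> t" if "(1, t) \<in> T'" for t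
  proof (rule field_le_epsilon)
    fix e :: real assume "e > 0"
    then obtain n where "(1 * b ^ n, (t + e) * sn b ^ n) \<in> T" using \<open>(1, t) \<in> T'\<close> unfolding T'_def by blast
    then have "sn b ^ n \<le> (t + e) * sn b ^ n" using sn_le[of "b ^ n"] sn_power_eq[OF b] by simp
    then show "1 \<le> t + e" using b0 by simp
  qed
  have sub: "T' \<subseteq> A \<times> {0..}" by (auto simp: T'_def)
  have tot: "\<exists>t. (a, t) \<in> T'" if "a \<in> A" for a using total[OF that] c0 by blast
  have "seminorm_epigraph A T'"
    by (rule seminorm_epigraphI) (fact sub tot u c0[OF zero_in] c0[OF one_in] d m un)+
  moreover have "T \<subseteq> T'" using c0 by auto
  ultimately have TT: "T' = T" by (rule maximal)
  have ab: "a * b \<in> A" by (rule subring_setD(4)[OF A a b])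
  have "(a * b ^ 1, (sn (a * b) / sn b + e) * sn b ^ 1) \<in> T" if "e > 0" for e
    using that b0 ab by (auto intro!: sn_less simp: distrib_right)
  then have "(a, sn (a * b) / sn b) \<in> T'"
    unfolding T'_def using a b0 sn_nonneg[OF ab] by (auto intro!: exI[of _ 1])
  then have "sn a \<le> sn (a * b) / sn b" unfolding TT by (rule sn_le)
  then have "sn a * sn b \<le> sn (a * b)" using b0 by (simp add: field_simps)
  then show ?thesis using sn_mult[OF a b] by simp
qed

end

text \<open>The algebraic form of Berkovich's theorem that the spectrum of a nonzero seminormed
  ring is nonempty.\<close>

theorem exists_mult_seminorm:
  assumes A: "subring_set A" and T: "seminorm_epigraph A T"
  obtains \<nu> where "mult_seminorm A \<nu>" "\<And>a t. (a, t) \<in> T \<Longrightarrow> \<nu> a \<le> t"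
proof -
  let ?S = "{T'. T \<subseteq> T' \<and> seminorm_epigraph A T'}"
  have "\<exists>M\<in>?S. \<forall>Xs\<in>?S. M \<subseteq> Xs \<longrightarrow> Xs = M"
  proof (rule subset_Zorn_nonempty)
    show "?S \<noteq> {}" using T by blast
    fix \<C> assume ne: "\<C> \<noteq> {}" and ch: "subset.chain ?S \<C>"
    have ep: "epigraph A Xs" if "Xs \<in> \<C>" for Xs
    proof -
      have "\<C> \<subseteq> ?S" using ch unfolding subset.chain_def by blast
      then show ?thesis using that A unfolding epigraph_def by blast
    qed
    have two: "\<exists>Xs\<in>\<C>. x \<in> Xs \<and> y \<in> Xs" if "x \<in> \<Union>\<C>" "y \<in> \<Union>\<C>" for x y
    proof -
      from that obtain Xs Y where XY: "Xs \<in> \<C>" "x \<in> Xs" "Y \<in> \<C>" "y \<in> Y" by blast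
      then have "Xs \<subseteq> Y \<or> Y \<subseteq> Xs" using ch unfolding subset.chain_def by blast
      then show ?thesis using XY by blast
    qed
    obtain X0 where X0: "X0 \<in> \<C>" using ne by blast
    have "seminorm_epigraph A (\<Union>\<C>)"
      unfolding seminorm_epigraph_def
    proof (intro conjI allI impI ballI)
      show "\<Union>\<C> \<subseteq> A \<times> {0..}"
      proof
        fix x assume "x \<in> \<Union>\<C>"
        then obtain Xs where Xs: "Xs \<in> \<C>" "(fst x, snd x) \<in> Xs" by auto
        show "x \<in> A \<times> {0..}"
          using epigraph.in_A[OF ep[OF Xs(1)] Xs(2)] epigraph.nonneg[OF ep[OF Xs(1)] Xs(2)]
          by (simp add: mem_Times_iff)
      qed
      show "\<exists>t. (a, t) \<in> \<Union>\<C>" if "a \<in> A" for a using epigraph.total[OF ep[OF X0] that] X0 by blast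
      show "(a, t) \<in> \<Union>\<C>" if "(a, s) \<in> \<Union>\<C>" "s \<le> t" for a s t
      proof -
        from that(1) obtain Xs where Xs: "Xs \<in> \<C>" "(a, s) \<in> Xs" by blast
        from epigraph.up[OF ep[OF Xs(1)] Xs(2) that(2)] Xs(1) show ?thesis by blast
      qed
      show "(0, 0) \<in> \<Union>\<C>" using epigraph.zero_in[OF ep[OF X0]] X0 by blast
      show "(1, 1) \<in> \<Union>\<C>" using epigraph.one_in[OF ep[OF X0]] X0 by blast
      show "1 \<le> t" if "(1, t) \<in> \<Union>\<C>" for t
      proof -
        from that obtain Xs where Xs: "Xs \<in> \<C>" "(1, t) \<in> Xs" by blast
        show ?thesis by (rule epigraph.unit[OF ep[OF Xs(1)] Xs(2)])
      qed
      fix a s b t assume "(a, s) \<in> \<Union>\<C>" "(b, t) \<in> \<Union>\<C>"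
      from two[OF this] obtain Xs where Xs: "Xs \<in> \<C>" "(a, s) \<in> Xs" "(b, t) \<in> Xs" by blast
      show "(a - b, max s t) \<in> \<Union>\<C>" "(a * b, s * t) \<in> \<Union>\<C>"
        using epigraph.diff_in[OF ep[OF Xs(1)] Xs(2,3)] epigraph.mult_in[OF ep[OF Xs(1)] Xs(2,3)] Xs(1) by blast+
    qed
    moreover have "T \<subseteq> X0" using ch X0 unfolding subset.chain_def by blast
    then have "T \<subseteq> \<Union>\<C>" using X0 by blast
    ultimately show "\<Union>\<C> \<in> ?S" by blast
  qed
  then obtain M where "M \<in> ?S" and mx: "\<forall>Xs\<in>?S. M \<subseteq> Xs \<longrightarrow> Xs = M" by (rule bexE)
  then have M: "T \<subseteq> M" "seminorm_epigraph A M" by simp_all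
  interpret max_epigraph A M
  proof
    show "Xs = M" if Xs: "seminorm_epigraph A Xs" "M \<subseteq> Xs" for Xs
    proof -
      have "Xs \<in> ?S" using Xs M(1) by simp
      with mx Xs(2) show ?thesis by simp
    qed
  qed (fact A, fact M(2))
  have "mult_seminorm A sn"
    unfolding mult_seminorm_def by (simp add: sn_0 sn_1 sn_nonneg sn_mult_eq sn_diff)
  moreover have "sn a \<le> t" if "(a, t) \<in> T" for a t by (rule sn_le) (use that M(1) in blast)
  ultimately show thesis by (rule that)
qed

section \<open>Homomorphisms to the complex numbers with prescribed kernel\<close>

lemma countable_poly_over:
  assumes "countable C" shows "countable {q :: 'a::zero poly. \<forall>i. coeff q i \<in> C}"
proof -
  have "{q. \<forall>i. coeff q i \<in> C} \<subseteq> Poly ` lists C"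
  proof
    fix q :: "'a poly" assume "q \<in> {q. \<forall>i. coeff q i \<in> C}"
    then have "set (coeffs q) \<subseteq> C" by (auto simp: coeffs_def)
    then have "coeffs q \<in> lists C" by (auto simp: lists_eq_set)
    then show "q \<in> Poly ` lists C" by (metis Poly_coeffs image_eqI)
  qed
  then show ?thesis using assms by (meson countable_image countable_lists countable_subset)
qed

lemma poly_as_sum:
  fixes p :: "'a::comm_ring_1 poly"
  assumes "degree p \<le> n" shows "poly p x = (\<Sum>i\<le>n. coeff p i * x ^ i)"
  unfolding poly_altdef by (rule sum.mono_neutral_left) (use assms in \<open>auto simp: coeff_eq_0\<close>)

definition prime_on :: "'r::comm_ring_1 set \<Rightarrow> 'r set \<Rightarrow> bool" where
  "prime_on A Z \<longleftrightarrow> 0 \<in> Z \<and> 1 \<notin> Z \<and>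
     (\<forall>a\<in>A. \<forall>b\<in>A. (a \<in> Z \<longrightarrow> b \<in> Z \<longrightarrow> a - b \<in> Z) \<and> (b \<in> Z \<longrightarrow> a * b \<in> Z) \<and>
        (a * b \<in> Z \<longrightarrow> a \<in> Z \<or> b \<in> Z))"

text \<open>Homomorphisms on subrings are represented by their graphs, so that extension is inclusion and composition
  is composition of relations. Prescribing the kernel makes them embeddings of the quotient by \<open>Z\<close>.\<close>

definition partial_hom :: "'r::comm_ring_1 set \<Rightarrow> ('r \<times> complex) set \<Rightarrow> bool" where
  "partial_hom Z D \<longleftrightarrow> (1, 1) \<in> D \<and>
     (\<forall>a x b y. (a, x) \<in> D \<longrightarrow> (b, y) \<in> D \<longrightarrow> (a - b, x - y) \<in> D \<and> (a * b, x * y) \<in> D) \<and>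
     (\<forall>a x. (a, x) \<in> D \<longrightarrow> (x = 0 \<longleftrightarrow> a \<in> Z))"

definition pair_poly :: "('a::zero \<times> 'b::zero) set \<Rightarrow> 'a poly \<Rightarrow> 'b poly \<Rightarrow> bool" where
  "pair_poly D p q \<longleftrightarrow> (\<forall>i. (coeff p i, coeff q i) \<in> D)"

definition adjoin :: "('r::comm_ring_1 \<times> complex) set \<Rightarrow> 'r \<Rightarrow> complex \<Rightarrow> ('r \<times> complex) set" where
  "adjoin D s \<zeta> = {(poly p s, poly q \<zeta>) | p q. pair_poly D p q}"

locale hom_graph =
  fixes A Z :: "'r::comm_ring_1 set" and D :: "('r \<times> complex) set"
  assumes A: "subring_set A" and Z: "prime_on A Z" and D: "partial_hom Z D" and dom: "fst ` D \<subseteq> A"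
begin

lemma in_dom: "(a, x) \<in> D \<Longrightarrow> a \<in> A" using dom by force

lemma one_D: "(1, 1) \<in> D" using D by (simp add: partial_hom_def)
lemma diff_D: "(a, x) \<in> D \<Longrightarrow> (b, y) \<in> D \<Longrightarrow> (a - b, x - y) \<in> D"
  using D by (simp add: partial_hom_def)
lemma mult_D: "(a, x) \<in> D \<Longrightarrow> (b, y) \<in> D \<Longrightarrow> (a * b, x * y) \<in> D"
  using D by (simp add: partial_hom_def)
lemma ker_D: "(a, x) \<in> D \<Longrightarrow> x = 0 \<longleftrightarrow> a \<in> Z"
  using D by (simp add: partial_hom_def)
lemma zero_D: "(0, 0) \<in> D" using diff_D[OF one_D one_D] by simp
lemma neg_D: "(a, x) \<in> D \<Longrightarrow> (- a, - x) \<in> D" using diff_D[OF zero_D] by force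
lemma add_D: "(a, x) \<in> D \<Longrightarrow> (b, y) \<in> D \<Longrightarrow> (a + b, x + y) \<in> D"
  using diff_D[OF _ neg_D, of a x b y] by simp
lemma power_D: "(a, x) \<in> D \<Longrightarrow> (a ^ n, x ^ n) \<in> D"
  by (induction n) (simp_all add: one_D mult_D)
lemma sum_D: "(\<And>i. i \<in> I \<Longrightarrow> (g i, h i) \<in> D) \<Longrightarrow> (sum g I, sum h I) \<in> D"
  by (induction I rule: infinite_finite_induct) (simp_all add: zero_D add_D)
lemma prod_D: "(\<And>i. i \<in> I \<Longrightarrow> (g i, h i) \<in> D) \<Longrightarrow> (prod g I, prod h I) \<in> D"
  by (induction I rule: infinite_finite_induct) (simp_all add: one_D mult_D)

lemma Z0: "0 \<in> Z" and Z1: "1 \<notin> Z"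
  and Z_diff: "a \<in> A \<Longrightarrow> b \<in> A \<Longrightarrow> a \<in> Z \<Longrightarrow> b \<in> Z \<Longrightarrow> a - b \<in> Z"
  and Z_mult: "a \<in> A \<Longrightarrow> b \<in> A \<Longrightarrow> b \<in> Z \<Longrightarrow> a * b \<in> Z"
  and Z_prime: "a \<in> A \<Longrightarrow> b \<in> A \<Longrightarrow> a * b \<in> Z \<Longrightarrow> a \<in> Z \<or> b \<in> Z"
  using Z by (simp_all add: prime_on_def)

lemma Z_mult': "a \<in> A \<Longrightarrow> b \<in> A \<Longrightarrow> a \<in> Z \<Longrightarrow> a * b \<in> Z"
  using Z_mult[of b a] by (simp add: mult.commute)

lemma Z_add: assumes "a \<in> A" "b \<in> A" "a \<in> Z" "b \<in> Z" shows "a + b \<in> Z"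
proof -
  have m1: "- 1 \<in> A" using subring_setD(1,5)[OF A] by blast
  have "a - - 1 * b \<in> Z"
    by (rule Z_diff[OF assms(1) subring_setD(4)[OF A m1 assms(2)] assms(3) Z_mult[OF m1 assms(2,4)]])
  then show ?thesis by simp
qed

lemma Z_sum: assumes "\<And>i. i \<in> I \<Longrightarrow> g i \<in> A \<and> g i \<in> Z" shows "sum g I \<in> Z"
proof -
  have "sum g I \<in> A \<and> sum g I \<in> Z"
    using assms
  proof (induction I rule: infinite_finite_induct)
    case (insert x F)
    then have "g x \<in> A" "g x \<in> Z" "sum g F \<in> A" "sum g F \<in> Z" by simp_all
    then show ?case using insert.hyps Z_add subring_setD(6)[OF A] by simp
  qed (simp_all add: Z0 subring_setD[OF A])
  then show ?thesis by simp
qed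

lemma fun_D: "(a, x) \<in> D \<Longrightarrow> (a, y) \<in> D \<Longrightarrow> x = y"
  using ker_D[OF diff_D, of a x a y] Z0 by simp

lemma pp_0: "pair_poly D 0 0" by (simp add: pair_poly_def zero_D)
lemma pp_const: "(a, x) \<in> D \<Longrightarrow> pair_poly D [:a:] [:x:]"
  by (simp add: pair_poly_def coeff_pCons zero_D split: nat.split)
lemma pp_monom: "(a, x) \<in> D \<Longrightarrow> pair_poly D (monom a n) (monom x n)"
  by (simp add: pair_poly_def zero_D)
lemma pp_diff: "pair_poly D p q \<Longrightarrow> pair_poly D p' q' \<Longrightarrow> pair_poly D (p - p') (q - q')"
  by (simp add: pair_poly_def diff_D)
lemma pp_add: "pair_poly D p q \<Longrightarrow> pair_poly D p' q' \<Longrightarrow> pair_poly D (p + p') (q + q')"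
  by (simp add: pair_poly_def add_D)
lemma pp_mult: "pair_poly D p q \<Longrightarrow> pair_poly D p' q' \<Longrightarrow> pair_poly D (p * p') (q * q')"
  unfolding pair_poly_def coeff_mult by (intro allI sum_D mult_D) simp_all
lemma pp_smult: "(a, x) \<in> D \<Longrightarrow> pair_poly D p q \<Longrightarrow> pair_poly D (smult a p) (smult x q)"
  by (simp add: pair_poly_def mult_D)

lemma pp_coeff: "pair_poly D p q \<Longrightarrow> (coeff p i, coeff q i) \<in> D" by (simp add: pair_poly_def)

lemma pp_in_A: assumes "pair_poly D p q" "s \<in> A" shows "poly p s \<in> A"
  by (rule subring_set_poly[OF A in_dom[OF pp_coeff[OF assms(1)]] assms(2)])

lemma poly_D:
  assumes pq: "pair_poly D p q" and s: "(s, \<zeta>) \<in> D" shows "(poly p s, poly q \<zeta>) \<in> D"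
proof -
  define n where "n = max (degree p) (degree q)"
  have "poly p s = (\<Sum>i\<le>n. coeff p i * s ^ i)" "poly q \<zeta> = (\<Sum>i\<le>n. coeff q i * \<zeta> ^ i)"
    unfolding n_def by (intro poly_as_sum, simp)+
  then show ?thesis by (simp add: sum_D mult_D power_D pp_coeff[OF pq] s)
qed

lemma poly_in_Z:
  assumes pq: "pair_poly D p 0" and s: "s \<in> A" shows "poly p s \<in> Z"
  unfolding poly_altdef
proof (rule Z_sum)
  fix i
  have c: "(coeff p i, 0) \<in> D" using pp_coeff[OF pq, of i] by simp
  have "coeff p i \<in> A" "coeff p i \<in> Z" "s ^ i \<in> A"
    using in_dom[OF c] ker_D[OF c] subring_set_power[OF A s] by auto
  then show "coeff p i * s ^ i \<in> A \<and> coeff p i * s ^ i \<in> Z"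
    using Z_mult' subring_setD(4)[OF A] by simp
qed

lemma countable_ran: assumes "countable A" shows "countable (snd ` D)"
proof -
  have "inj_on fst D"
  proof (rule inj_onI)
    fix z w assume zw: "z \<in> D" "w \<in> D" "fst z = fst w"
    obtain a x b y where e: "z = (a, x)" "w = (b, y)" by (cases z, cases w, blast)
    then have "b = a" using zw(3) by simp
    then have "x = y" using zw(1,2) unfolding e by (intro fun_D[of a]) simp_all
    then show "z = w" using e \<open>b = a\<close> by simp
  qed
  from countable_image_inj_on[OF countable_subset[OF dom assms] this]
  show ?thesis by (rule countable_image)
qed

lemma sub_adjoin: "D \<subseteq> adjoin D s \<zeta>"
proof
  fix z assume "z \<in> D"
  then have "pair_poly D [:fst z:] [:snd z:]" by (intro pp_const) simp
  then show "z \<in> adjoin D s \<zeta>"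
    unfolding adjoin_def
    by (intro CollectI exI[of _ "[:fst z:]"] exI[of _ "[:snd z:]"]) simp
qed

lemma in_adjoin: "(s, \<zeta>) \<in> adjoin D s \<zeta>"
proof -
  have "pair_poly D (monom 1 1) (monom 1 1)" by (rule pp_monom[OF one_D])
  then show ?thesis unfolding adjoin_def
    by (intro CollectI exI[of _ "monom 1 1"]) (simp add: poly_monom)
qed

lemma dom_adjoin: assumes "s \<in> A" shows "fst ` adjoin D s \<zeta> \<subseteq> A"
proof
  fix a assume "a \<in> fst ` adjoin D s \<zeta>"
  then obtain p q where "pair_poly D p q" "a = poly p s" unfolding adjoin_def by auto
  then show "a \<in> A" using pp_in_A[OF _ assms] by blast
qed

lemma pp_exists: assumes p: "\<forall>i. coeff p i \<in> fst ` D" shows "\<exists>q. pair_poly D p q"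
proof -
  define g where "g a = (SOME x. (a, x) \<in> D)" for a
  have g: "(a, g a) \<in> D" if a: "a \<in> fst ` D" for a
  proof -
    from a obtain x where "(a, x) \<in> D" by auto
    then show ?thesis unfolding g_def by (rule someI)
  qed
  have "0 \<in> fst ` D" by (rule image_eqI[OF _ zero_D]) simp
  then have "g 0 = 0" by (rule fun_D[OF g zero_D])
  then have "pair_poly D p (map_poly g p)" unfolding pair_poly_def using p g
    by (simp add: coeff_map_poly)
  then show ?thesis ..
qed

lemma adjoin_dom: "fst ` adjoin D s \<zeta> = {poly p s |p. \<forall>i. coeff p i \<in> fst ` D}"
proof -
  have 2: "\<forall>i. coeff p i \<in> fst ` D" if "pair_poly D p q" for p q
  proof
    show "coeff p i \<in> fst ` D" for i by (rule image_eqI[OF _ pp_coeff[OF that]]) simp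
  qed
  show ?thesis
  proof (intro equalityI subsetI)
    fix a assume "a \<in> fst ` adjoin D s \<zeta>"
    then obtain p q where "pair_poly D p q" "a = poly p s" unfolding adjoin_def by auto
    then show "a \<in> {poly p s |p. \<forall>i. coeff p i \<in> fst ` D}" using 2 by blast
  next
    fix a assume "a \<in> {poly p s |p. \<forall>i. coeff p i \<in> fst ` D}"
    then obtain p where p: "a = poly p s" "\<forall>i. coeff p i \<in> fst ` D" by blast
    from pp_exists[OF p(2)] obtain q where "pair_poly D p q" ..
    then have "(a, poly q \<zeta>) \<in> adjoin D s \<zeta>" unfolding adjoin_def p(1) by blast
    then show "a \<in> fst ` adjoin D s \<zeta>" by (rule image_eqI[rotated]) simp
  qed
qed

text \<open>Differences and products of polynomial pairs are polynomial pairs; only the description of the kernel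
  depends on the element that is adjoined.\<close>

lemma adjoin_hom:
  assumes "\<And>p q. pair_poly D p q \<Longrightarrow> poly q \<zeta> = 0 \<longleftrightarrow> poly p s \<in> Z"
  shows "partial_hom Z (adjoin D s \<zeta>)"
  unfolding partial_hom_def
proof (intro conjI allI impI)
  show "(1, 1) \<in> adjoin D s \<zeta>" using sub_adjoin one_D by blast
  show "x = 0 \<longleftrightarrow> a \<in> Z" if "(a, x) \<in> adjoin D s \<zeta>" for a x
  proof -
    from that obtain p q where "pair_poly D p q" "a = poly p s" "x = poly q \<zeta>"
      unfolding adjoin_def by blast
    then show ?thesis using assms[of p q] by simp
  qed
  fix a x b y assume ax: "(a, x) \<in> adjoin D s \<zeta>" and bY: "(b, y) \<in> adjoin D s \<zeta>"
  from ax obtain p q where p: "pair_poly D p q" "a = poly p s" "x = poly q \<zeta>"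
    unfolding adjoin_def by blast
  from bY obtain p' q' where p': "pair_poly D p' q'" "b = poly p' s" "y = poly q' \<zeta>"
    unfolding adjoin_def by blast
  show "(a - b, x - y) \<in> adjoin D s \<zeta>" unfolding adjoin_def
    using pp_diff[OF p(1) p'(1)] p(2,3) p'(2,3)
    by (intro CollectI exI[of _ "p - p'"] exI[of _ "q - q'"]) simp
  show "(a * b, x * y) \<in> adjoin D s \<zeta>" unfolding adjoin_def
    using pp_mult[OF p(1) p'(1)] p(2,3) p'(2,3)
    by (intro CollectI exI[of _ "p * p'"] exI[of _ "q * q'"]) simp
qed

lemma adjoin_transcendental:
  assumes s: "s \<in> A" and tr: "\<And>p q. pair_poly D p q \<Longrightarrow> poly p s \<in> Z \<Longrightarrow> q = 0"
    and \<zeta>: "\<And>p q. pair_poly D p q \<Longrightarrow> q \<noteq> 0 \<Longrightarrow> poly q \<zeta> \<noteq> 0"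
  shows "partial_hom Z (adjoin D s \<zeta>)"
proof (rule adjoin_hom)
  fix p q assume pq: "pair_poly D p q"
  show "poly q \<zeta> = 0 \<longleftrightarrow> poly p s \<in> Z"
  proof
    assume "poly q \<zeta> = 0"
    then have "q = 0" using \<zeta>[OF pq] by blast
    then show "poly p s \<in> Z" using poly_in_Z[OF _ s] pq by blast
  next
    assume "poly p s \<in> Z"
    then show "poly q \<zeta> = 0" using tr[OF pq] by simp
  qed
qed

text \<open>Leading coefficients need not be invertible in the ring, so division requires a factor \<open>u\<close>. Its
  image is a power of the leading coefficient of \<open>h'\<close>, hence not zero.\<close>

lemma pseudo_division:
  assumes h: "pair_poly D h h'" "h' \<noteq> 0" and p: "pair_poly D p q"
  shows "\<exists>u u' k k' r r'. (u, u') \<in> D \<and> u' \<noteq> 0 \<and> pair_poly D k k' \<and> pair_poly D r r' \<and>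
    smult u p = k * h + r \<and> smult u' q = k' * h' + r' \<and> (r' = 0 \<or> degree r' < degree h')"
  using p
proof (induction "if q = 0 then 0 else Suc (degree q)" arbitrary: p q rule: less_induct)
  case less
  show ?case
  proof (cases "q = 0 \<or> degree q < degree h'")
    case True
    then show ?thesis
      using one_D pp_0 less.prems
      by (intro exI[of _ 1] exI[of _ 0] exI[of _ p] exI[of _ q]) simp
  next
    case False
    define e d where "e = degree q" and "d = degree h'"
    have ed: "d \<le> e" and q0: "q \<noteq> 0" using False by (auto simp: e_def d_def)
    define m m' where "m = monom (coeff p e) (e - d)" and "m' = monom (coeff q e) (e - d)"
    have mm: "pair_poly D m m'" unfolding m_def m'_def by (intro pp_monom pp_coeff less.prems)
    have lD: "(coeff h d, coeff h' d) \<in> D" by (rule pp_coeff[OF h(1)])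
    define p1 q1 where "p1 = smult (coeff h d) p - m * h" and "q1 = smult (coeff h' d) q - m' * h'"
    have pq1: "pair_poly D p1 q1" unfolding p1_def q1_def
      by (intro pp_diff pp_smult pp_mult lD less.prems mm h)
    have deg: "degree q1 \<le> e"
      unfolding q1_def m'_def e_def d_def
      by (rule degree_diff_le) (use ed in \<open>auto simp: e_def d_def intro!: order_trans[OF degree_mult_le] order_trans[OF add_mono[OF degree_monom_le order_refl]]\<close>)
    have "coeff q1 e = coeff h' d * coeff q e - coeff (m' * h') e" by (simp add: q1_def)
    also have "coeff (m' * h') e = coeff q e * coeff h' d"
      unfolding m'_def using ed by (simp add: coeff_monom_mult)
    finally have "coeff q1 e = 0" by simp
    then have "q1 = 0 \<or> degree q1 < e" using deg
      by (metis le_neq_implies_less leading_coeff_0_iff)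
    then have "(if q1 = 0 then 0 else Suc (degree q1)) < (if q = 0 then 0 else Suc (degree q))"
      using q0 by (auto simp: e_def)
    from less.hyps[OF this pq1] obtain u u' k k' r r' where
      *: "(u, u') \<in> D" "u' \<noteq> 0" "pair_poly D k k'" "pair_poly D r r'"
      "smult u p1 = k * h + r" "smult u' q1 = k' * h' + r'" "r' = 0 \<or> degree r' < degree h'" by blast
    have "smult (u * coeff h d) p = (k + smult u m) * h + r"
      using *(5) by (simp add: p1_def smult_diff_right algebra_simps)
    moreover have "smult (u' * coeff h' d) q = (k' + smult u' m') * h' + r'"
      using *(6) by (simp add: q1_def smult_diff_right algebra_simps)
    moreover have "u' * coeff h' d \<noteq> 0" using *(2) h(2) by (simp add: d_def)
    ultimately show ?thesis
      using mult_D[OF *(1) lD] pp_add[OF *(3) pp_smult[OF *(1) mm]] *(4,7)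
      by (intro exI[of _ "u * coeff h d"] exI[of _ "u' * coeff h' d"] exI[of _ "k + smult u m"]
          exI[of _ "k' + smult u' m'"] exI[of _ r] exI[of _ r'] conjI)
  qed
qed

text \<open>If the value of \<open>p\<close> at \<open>s\<close> lies in \<open>Z\<close>, then the remainder modulo \<open>h\<close> is a relation of smaller degree
  and vanishes. Conversely, among the polynomials with image vanishing at \<open>\<zeta>\<close> and value outside of \<open>Z\<close>
  one of least degree would have smaller degree than \<open>h\<close> and divide it up to a factor; since \<open>Z\<close> is prime,
  the cofactor would be a relation of smaller degree than \<open>h\<close>.\<close>

lemma adjoin_algebraic:
  assumes s: "s \<in> A" and h: "pair_poly D h h'" "h' \<noteq> 0" "poly h s \<in> Z"
    and least: "\<And>p q. pair_poly D p q \<Longrightarrow> poly p s \<in> Z \<Longrightarrow> q \<noteq> 0 \<Longrightarrow> degree h' \<le> degree q"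
    and \<zeta>: "poly h' \<zeta> = 0"
  shows "partial_hom Z (adjoin D s \<zeta>)"
proof (rule adjoin_hom)
  fix p q assume pq: "pair_poly D p q"
  show "poly q \<zeta> = 0 \<longleftrightarrow> poly p s \<in> Z"
  proof
    assume ps: "poly p s \<in> Z"
    from pseudo_division[OF h(1,2) pq] obtain u u' k k' r r' where
      *: "(u, u') \<in> D" "u' \<noteq> 0" "pair_poly D k k'" "pair_poly D r r'"
      "smult u p = k * h + r" "smult u' q = k' * h' + r'" "r' = 0 \<or> degree r' < degree h'" by blast
    have "poly r s = u * poly p s - poly k s * poly h s"
      using arg_cong[OF *(5), of "\<lambda>x. poly x s"] by simp
    also have "\<dots> \<in> Z"
      by (intro Z_diff Z_mult ps h(3) subring_setD(4)[OF A] in_dom[OF *(1)] pp_in_A[OF pq s]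
          pp_in_A[OF h(1) s] pp_in_A[OF *(3) s])
    finally have "r' = 0" using least[OF *(4)] *(7) by force
    then have "u' * poly q \<zeta> = 0"
      using arg_cong[OF *(6), of "\<lambda>x. poly x \<zeta>"] \<zeta> by simp
    then show "poly q \<zeta> = 0" using *(2) by simp
  next
    assume q\<zeta>: "poly q \<zeta> = 0"
    define bad where "bad x \<longleftrightarrow> (case x of (p, q) \<Rightarrow> pair_poly D p q \<and> poly q \<zeta> = 0 \<and> poly p s \<notin> Z)" for x
    have bad_iff: "bad (p, q) \<longleftrightarrow> pair_poly D p q \<and> poly q \<zeta> = 0 \<and> poly p s \<notin> Z" for p q
      by (simp add: bad_def)
    have bad0: "q \<noteq> 0" if "bad (p, q)" for p q using that poly_in_Z[OF _ s] by (auto simp: bad_iff)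
    show "poly p s \<in> Z"
    proof (rule ccontr)
      assume "poly p s \<notin> Z"
      then have "bad (p, q)" using pq q\<zeta> by (simp add: bad_iff)
      from ex_has_least_nat[of bad, OF this, of "\<lambda>x. degree (snd x)"]
      obtain r r' where bad: "bad (r, r')" and min: "\<And>a b. bad (a, b) \<Longrightarrow> degree r' \<le> degree b" by auto
      have r: "pair_poly D r r'" "poly r' \<zeta> = 0" "poly r s \<notin> Z" "r' \<noteq> 0"
        using bad bad0 by (auto simp: bad_iff)
      have deg: "degree r' < degree h'"
      proof -
        from pseudo_division[OF h(1,2) r(1)] obtain u u' k k' t t' where
          *: "(u, u') \<in> D" "u' \<noteq> 0" "pair_poly D k k'" "pair_poly D t t'"
          "smult u r = k * h + t" "smult u' r' = k' * h' + t'" "t' = 0 \<or> degree t' < degree h'" by blast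
        have "poly t' \<zeta> = 0" using arg_cong[OF *(6), of "\<lambda>x. poly x \<zeta>"] r(2) \<zeta> by simp
        moreover have "poly t s \<notin> Z"
        proof
          assume "poly t s \<in> Z"
          then have "poly k s * poly h s + poly t s \<in> Z"
            by (intro Z_add Z_mult h(3) subring_setD(4)[OF A] pp_in_A[OF h(1) s]
                pp_in_A[OF *(3) s] pp_in_A[OF *(4) s])
          also have "poly k s * poly h s + poly t s = u * poly r s"
            using arg_cong[OF *(5), of "\<lambda>x. poly x s"] by simp
          finally have "u \<in> Z \<or> poly r s \<in> Z" by (intro Z_prime in_dom[OF *(1)] pp_in_A[OF r(1) s])
          then show False using r(3) ker_D[OF *(1)] *(2) by blast
        qed
        ultimately have b: "bad (t, t')" using *(4) by (simp add: bad_iff)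
        show ?thesis using min[OF b] bad0[OF b] *(7) by auto
      qed
      have deg1: "degree r' \<noteq> 0"
      proof
        assume "degree r' = 0"
        then obtain c where "r' = [:c:]" by (metis degree_eq_zeroE)
        then show False using r by simp
      qed
      from pseudo_division[OF r(1,4) h(1)] obtain u u' k k' t t' where
        *: "(u, u') \<in> D" "u' \<noteq> 0" "pair_poly D k k'" "pair_poly D t t'"
        "smult u h = k * r + t" "smult u' h' = k' * r' + t'" "t' = 0 \<or> degree t' < degree r'" by blast
      have t\<zeta>: "poly t' \<zeta> = 0" using arg_cong[OF *(6), of "\<lambda>x. poly x \<zeta>"] r(2) \<zeta> by simp
      have ts: "poly t s \<in> Z"
      proof (rule ccontr)
        assume "poly t s \<notin> Z"
        then have "bad (t, t')" using t\<zeta> *(4) by (simp add: bad_iff)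
        then show False using min bad0 *(7) by force
      qed
      have t0: "t' = 0" using least[OF *(4) ts] *(7) deg by force
      have "u * poly h s - poly t s \<in> Z"
        by (intro Z_diff Z_mult ts h(3) subring_setD(4)[OF A] in_dom[OF *(1)] pp_in_A[OF h(1) s] pp_in_A[OF *(4) s])
      also have "u * poly h s - poly t s = poly k s * poly r s"
        using arg_cong[OF *(5), of "\<lambda>x. poly x s"] by simp
      finally have "poly k s \<in> Z \<or> poly r s \<in> Z" by (intro Z_prime pp_in_A[OF *(3) s] pp_in_A[OF r(1) s])
      then have ks: "poly k s \<in> Z" using r(3) by simp
      have eq: "smult u' h' = k' * r'" using *(6) t0 by simp
      then have k0: "k' \<noteq> 0" using h(2) *(2) by auto
      have "degree h' = degree k' + degree r'"
        using arg_cong[OF eq, of degree] *(2) k0 r(4) by (simp add: degree_mult_eq)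
      then show False using least[OF *(3) ks k0] deg1 by simp
    qed
  qed
qed

end

text \<open>Zorn's lemma reduces this to adjoining one element. If it is algebraic, its image is a root of the image of a least
  relation; otherwise there are only countably many values to avoid.\<close>

theorem extend_partial_hom:
  assumes A: "subring_set A" and cA: "countable A" and Z: "prime_on A Z"
    and D0: "partial_hom Z D0" "fst ` D0 \<subseteq> A"
  obtains D where "D0 \<subseteq> D" "partial_hom Z D" "fst ` D = A"
proof -
  let ?S = "{D. D0 \<subseteq> D \<and> partial_hom Z D \<and> fst ` D \<subseteq> A}"
  have "\<exists>M\<in>?S. \<forall>Xs\<in>?S. M \<subseteq> Xs \<longrightarrow> Xs = M"
  proof (rule subset_Zorn_nonempty)
    show "?S \<noteq> {}" using D0 by blast
    fix \<C> assume ne: "\<C> \<noteq> {}" and ch: "subset.chain ?S \<C>"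
    have inS: "D0 \<subseteq> Xs" "partial_hom Z Xs" "fst ` Xs \<subseteq> A" if "Xs \<in> \<C>" for Xs
    proof -
      have "Xs \<in> ?S" using ch that unfolding subset.chain_def by blast
      then show "D0 \<subseteq> Xs" "partial_hom Z Xs" "fst ` Xs \<subseteq> A" by simp_all
    qed
    have gr: "hom_graph A Z Xs" if "Xs \<in> \<C>" for Xs
      using inS[OF that] A Z by (simp add: hom_graph_def)
    obtain X0 where X0: "X0 \<in> \<C>" using ne by blast
    have "partial_hom Z (\<Union>\<C>)"
      unfolding partial_hom_def
    proof (intro conjI allI impI)
      show "(1, 1) \<in> \<Union>\<C>" using hom_graph.one_D[OF gr[OF X0]] X0 by blast
      show "x = 0 \<longleftrightarrow> a \<in> Z" if ax: "(a, x) \<in> \<Union>\<C>" for a x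
      proof -
        from ax obtain Xs where "Xs \<in> \<C>" "(a, x) \<in> Xs" by blast
        then show ?thesis using hom_graph.ker_D[OF gr] by blast
      qed
      fix a x b y assume "(a, x) \<in> \<Union>\<C>" "(b, y) \<in> \<Union>\<C>"
      then obtain Xs Y where XY: "Xs \<in> \<C>" "(a, x) \<in> Xs" "Y \<in> \<C>" "(b, y) \<in> Y" by blast
      then have "Xs \<subseteq> Y \<or> Y \<subseteq> Xs" using ch unfolding subset.chain_def by blast
      then obtain W where W: "W \<in> \<C>" "(a, x) \<in> W" "(b, y) \<in> W" using XY by blast
      show "(a - b, x - y) \<in> \<Union>\<C>" using hom_graph.diff_D[OF gr[OF W(1)] W(2,3)] W(1) by blast
      show "(a * b, x * y) \<in> \<Union>\<C>" using hom_graph.mult_D[OF gr[OF W(1)] W(2,3)] W(1) by blast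
    qed
    moreover have "D0 \<subseteq> \<Union>\<C>" using inS(1)[OF X0] X0 by blast
    moreover have "fst ` \<Union>\<C> \<subseteq> A" using inS(3) by blast
    ultimately show "\<Union>\<C> \<in> ?S" by simp
  qed
  then obtain M where M: "M \<in> ?S" and mx: "\<forall>Xs\<in>?S. M \<subseteq> Xs \<longrightarrow> Xs = M" by (rule bexE)
  interpret hom_graph A Z M using M A Z by (simp add: hom_graph_def)
  have dn: "s \<in> fst ` M" if s: "s \<in> A" and ad: "partial_hom Z (adjoin M s \<zeta>)" for s \<zeta>
  proof -
    have "adjoin M s \<zeta> \<in> ?S" using ad sub_adjoin[of s \<zeta>] dom_adjoin[OF s, of \<zeta>] M by auto
    with mx sub_adjoin[of s \<zeta>] have "adjoin M s \<zeta> = M" by simp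
    then have "(s, \<zeta>) \<in> M" using in_adjoin[of s \<zeta>] by simp
    then show ?thesis by force
  qed
  have "s \<in> fst ` M" if s: "s \<in> A" for s
  proof (cases "\<exists>p q. pair_poly M p q \<and> poly p s \<in> Z \<and> q \<noteq> 0")
    case True
    define P where "P x \<longleftrightarrow> pair_poly M (fst x) (snd x) \<and> poly (fst x) s \<in> Z \<and> snd x \<noteq> 0" for x
    from True obtain x where "P x" unfolding P_def by auto
    from ex_has_least_nat[of P, OF this, of "\<lambda>x. degree (snd x)"]
    obtain z where z: "P z" and least: "\<And>y. P y \<Longrightarrow> degree (snd z) \<le> degree (snd y)" by blast
    define h h' where "h = fst z" and "h' = snd z"
    have h: "pair_poly M h h'" "h' \<noteq> 0" "poly h s \<in> Z" using z by (simp_all add: P_def h_def h'_def)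
    have least': "degree h' \<le> degree q" if "pair_poly M p q" "poly p s \<in> Z" "q \<noteq> 0" for p q
      using least[of "(p, q)"] that by (simp add: P_def h'_def)
    have "degree h' \<noteq> 0"
    proof
      assume "degree h' = 0"
      then obtain c where c: "h' = [:c:]" by (metis degree_eq_zeroE)
      have hc: "(coeff h 0, c) \<in> M" using pp_coeff[OF h(1), of 0] c by simp
      have "pair_poly M (h - [:coeff h 0:]) (h' - [:c:])" by (intro pp_diff h(1) pp_const hc)
      then have "pair_poly M (h - [:coeff h 0:]) 0" using c by simp
      then have "poly (h - [:coeff h 0:]) s \<in> Z" by (rule poly_in_Z[OF _ s])
      then have "poly h s - poly (h - [:coeff h 0:]) s \<in> Z"
        by (intro Z_diff h(3) pp_in_A[OF h(1) s] pp_in_A[OF pp_diff[OF h(1) pp_const[OF hc]] s])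
      then have "coeff h 0 \<in> Z" by simp
      then show False using ker_D[OF hc] c h(2) by simp
    qed
    then have "\<not> constant (poly h')" by (simp add: constant_degree)
    then obtain \<zeta> where \<zeta>: "poly h' \<zeta> = 0" using fundamental_theorem_of_algebra by blast
    show ?thesis by (rule dn[OF s adjoin_algebraic[OF s h(1,2,3) least' \<zeta>]])
  next
    case False
    let ?Q = "{q. \<forall>i. coeff q i \<in> snd ` M} - {0}"
    define U where "U = (\<Union>q\<in>?Q. {\<zeta>. poly q \<zeta> = 0})"
    have "countable U"
      unfolding U_def by (intro countable_UN countable_Diff countable_poly_over countable_ran[OF cA])
        (simp add: countable_finite poly_roots_finite)
    then have "U \<noteq> UNIV" using uncountable_UNIV_complex by auto
    then obtain \<zeta> where \<zeta>U: "\<zeta> \<notin> U" by blast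
    have \<zeta>: "poly q \<zeta> \<noteq> 0" if "pair_poly M p q" "q \<noteq> 0" for p q
    proof -
      have "coeff q i \<in> snd ` M" for i by (rule image_eqI[OF _ pp_coeff[OF that(1)]]) simp
      then have "q \<in> ?Q" using that(2) by simp
      then show ?thesis using \<zeta>U unfolding U_def by simp
    qed
    show ?thesis
    proof (rule dn[OF s adjoin_transcendental[OF s _ \<zeta>]])
      show "q = 0" if "pair_poly M p q" "poly p s \<in> Z" for p q using False that by blast
    qed
  qed
  then have "fst ` M = A" using dom by (intro equalityI subsetI) auto
  then show thesis using that[of M] M by simp
qed

lemma partial_hom_restrict:
  assumes "partial_hom Z D" "subring_set A" shows "partial_hom Z {z \<in> D. fst z \<in> A}"
  using assms unfolding partial_hom_def subring_set_def by simp

lemma partial_hom_comp: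
  assumes D1: "partial_hom Z D1" and D2: "partial_hom {0} D2" shows "partial_hom Z (D1 O D2)"
  unfolding partial_hom_def
proof (intro conjI allI impI)
  show "(1, 1) \<in> D1 O D2"
    by (rule relcompI[of 1 1]) (use assms in \<open>simp_all add: partial_hom_def\<close>)
  show "x = 0 \<longleftrightarrow> a \<in> Z" if "(a, x) \<in> D1 O D2" for a x
  proof -
    from that obtain u where u: "(a, u) \<in> D1" "(u, x) \<in> D2" by blast
    then show ?thesis using assms unfolding partial_hom_def by simp
  qed
  fix a x b y assume "(a, x) \<in> D1 O D2" "(b, y) \<in> D1 O D2"
  then obtain u w where u: "(a, u) \<in> D1" "(u, x) \<in> D2" and w: "(b, w) \<in> D1" "(w, y) \<in> D2" by blast
  have "(a - b, u - w) \<in> D1" "(u - w, x - y) \<in> D2" "(a * b, u * w) \<in> D1" "(u * w, x * y) \<in> D2"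
    using assms u w unfolding partial_hom_def by simp_all
  then show "(a - b, x - y) \<in> D1 O D2" "(a * b, x * y) \<in> D1 O D2"
    by (auto intro: relcompI)
qed

section \<open>Ultrametric absolute values and algebraic elements\<close>

lemma mult_seminormD:
  assumes "mult_seminorm A \<nu>"
  shows "\<nu> 1 = 1" "\<nu> 0 = 0" "a \<in> A \<Longrightarrow> 0 \<le> \<nu> a"
    "a \<in> A \<Longrightarrow> b \<in> A \<Longrightarrow> \<nu> (a * b) = \<nu> a * \<nu> b"
    "a \<in> A \<Longrightarrow> b \<in> A \<Longrightarrow> \<nu> (a - b) \<le> max (\<nu> a) (\<nu> b)"
  using assms by (simp_all add: mult_seminorm_def)

locale mult_seminormed =
  fixes A :: "'a::comm_ring_1 set" and \<nu> :: "'a \<Rightarrow> real"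
  assumes A: "subring_set A" and \<nu>: "mult_seminorm A \<nu>"
begin

lemmas sub = subring_setD[OF A]
lemmas sn = mult_seminormD[OF \<nu>]

lemma \<nu>_minus: assumes "a \<in> A" shows "\<nu> (- a) = \<nu> a"
proof -
  have "\<nu> (- b) \<le> \<nu> b" if "b \<in> A" for b
    using sn(5)[OF sub(2) that] sn(2) sn(3)[OF that] by simp
  from this[OF assms] this[OF sub(5)[OF assms]] show ?thesis by simp
qed

lemma \<nu>_add: "a \<in> A \<Longrightarrow> b \<in> A \<Longrightarrow> \<nu> (a + b) \<le> max (\<nu> a) (\<nu> b)"
  using sn(5)[of a "- b"] \<nu>_minus[of b] sub(5)[of b] by simp

lemma \<nu>_power: assumes "a \<in> A" shows "\<nu> (a ^ n) = \<nu> a ^ n"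
  by (induction n) (simp_all add: sn(1) sn(4)[OF assms subring_set_power[OF A assms]])

lemma \<nu>_prod: "(\<And>i. i \<in> I \<Longrightarrow> g i \<in> A) \<Longrightarrow> \<nu> (prod g I) = (\<Prod>i\<in>I. \<nu> (g i))"
proof (induction I rule: infinite_finite_induct)
  case (insert x F)
  then have "g x \<in> A" "prod g F \<in> A" using subring_set_prod[OF A, of F g] by auto
  then show ?case using insert by (simp add: sn(4))
qed (simp_all add: sn(1))

lemma \<nu>_sum_le:
  assumes "0 \<le> t" "\<And>i. i \<in> I \<Longrightarrow> g i \<in> A" "\<And>i. i \<in> I \<Longrightarrow> \<nu> (g i) \<le> t"
  shows "\<nu> (sum g I) \<le> t"
  using assms(2,3)
proof (induction I rule: infinite_finite_induct)
  case (insert x F)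
  have "g x \<in> A" "sum g F \<in> A" using subring_set_sum[OF A, of F g] insert.prems by auto
  then have "\<nu> (g x + sum g F) \<le> max (\<nu> (g x)) (\<nu> (sum g F))" by (rule \<nu>_add)
  also have "\<dots> \<le> t" using insert by simp
  finally show ?case using insert.hyps by simp
qed (simp_all add: assms(1) sn(2))

lemma \<nu>_add_eq: assumes ab: "a \<in> A" "b \<in> A" "\<nu> a < \<nu> b" shows "\<nu> (a + b) = \<nu> b"
proof -
  have "\<nu> ((a + b) - a) \<le> max (\<nu> (a + b)) (\<nu> a)" by (rule sn(5)) (use ab sub(6) in auto)
  then show ?thesis using \<nu>_add[OF ab(1,2)] ab(3) by simp
qed

text \<open>The ultrametric counterpart of tropical vanishing: a term larger than all others could not
  be cancelled.\<close>

lemma max_attained_twice: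
  assumes I: "finite I" and t: "\<And>i. i \<in> I \<Longrightarrow> t i \<in> A" and s0: "(\<Sum>i\<in>I. t i) = 0"
    and j: "j \<in> I" "0 < \<nu> (t j)"
  shows "\<exists>i\<in>I. i \<noteq> j \<and> \<nu> (t j) \<le> \<nu> (t i)"
proof (rule ccontr)
  assume neg: "\<not> ?thesis"
  define m where "m = Max (insert 0 ((\<lambda>i. \<nu> (t i)) ` (I - {j})))"
  have m: "m < \<nu> (t j)" unfolding m_def proof (subst Max_less_iff)
    show "\<forall>a\<in>insert 0 ((\<lambda>i. \<nu> (t i)) ` (I - {j})). a < \<nu> (t j)"
      using neg j(2) by (simp add: not_le) blast
  qed (simp_all add: I)
  have "\<nu> (\<Sum>i\<in>I - {j}. t i) \<le> m"
  proof (rule \<nu>_sum_le)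
    show "0 \<le> m" unfolding m_def by (rule Max_ge) (simp_all add: I)
    show "\<nu> (t i) \<le> m" if "i \<in> I - {j}" for i unfolding m_def by (rule Max_ge) (use I that in simp_all)
    show "t i \<in> A" if "i \<in> I - {j}" for i using t that by simp
  qed
  moreover have tj: "t j = - (\<Sum>i\<in>I - {j}. t i)"
    using s0 sum.remove[OF I j(1), of t] unfolding eq_neg_iff_add_eq_0 by (rule trans[OF sym, rotated])
  have "(\<Sum>i\<in>I - {j}. t i) \<in> A" by (rule subring_set_sum[OF A], rule t) simp
  then have "\<nu> (t j) = \<nu> (\<Sum>i\<in>I - {j}. t i)" unfolding tj by (rule \<nu>_minus)
  ultimately show False using m by linarith
qed

end

definition poly_ring :: "'a::comm_ring_1 set \<Rightarrow> 'a \<Rightarrow> 'a set" where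
  "poly_ring B z = {poly p z |p. \<forall>i. coeff p i \<in> B}"

definition algebraic_over :: "complex set \<Rightarrow> complex \<Rightarrow> bool" where
  "algebraic_over B z \<longleftrightarrow> (\<exists>p. p \<noteq> 0 \<and> (\<forall>i. coeff p i \<in> B) \<and> poly p z = 0)"

lemma poly_ringI: "(\<And>i. coeff p i \<in> B) \<Longrightarrow> poly p z \<in> poly_ring B z"
  unfolding poly_ring_def by blast

lemma poly_ringD: "a \<in> poly_ring B z \<Longrightarrow> \<exists>p. (\<forall>i. coeff p i \<in> B) \<and> a = poly p z"
  unfolding poly_ring_def by blast

lemma coeff_mult_in:
  assumes "subring_set B" "\<And>i. coeff p i \<in> B" "\<And>i. coeff q i \<in> B" shows "coeff (p * q) i \<in> B"
  unfolding coeff_mult by (intro subring_set_sum subring_setD(4) assms)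

lemma poly_ring_base: assumes "subring_set B" "b \<in> B" shows "b \<in> poly_ring B z"
proof -
  have "coeff [:b:] i \<in> B" for i using assms(2) subring_setD(2)[OF assms(1)] by (cases i) auto
  then have "poly [:b:] z \<in> poly_ring B z" by (rule poly_ringI)
  then show ?thesis by simp
qed

lemma poly_ring_gen: assumes "subring_set B" shows "z \<in> poly_ring B z"
proof -
  have "coeff (monom 1 1) i \<in> B" for i using subring_setD(1,2)[OF assms] by (cases "i = 1") auto
  then have "poly (monom 1 1) z \<in> poly_ring B z" by (rule poly_ringI)
  then show ?thesis by (simp add: poly_monom)
qed

lemma poly_ring_subring: assumes B: "subring_set B" shows "subring_set (poly_ring B z)"
  unfolding subring_set_def
proof (intro conjI ballI)
  show "1 \<in> poly_ring B z" by (rule poly_ring_base[OF B subring_setD(1)[OF B]])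
  fix a b assume "a \<in> poly_ring B z" "b \<in> poly_ring B z"
  from poly_ringD[OF this(1)] poly_ringD[OF this(2)] obtain p q where
    p: "\<And>i. coeff p i \<in> B" "a = poly p z" and q: "\<And>i. coeff q i \<in> B" "b = poly q z" by blast
  have "coeff (p - q) i \<in> B" for i using p(1) q(1) subring_setD(3)[OF B] by simp
  then have "poly (p - q) z \<in> poly_ring B z" by (rule poly_ringI)
  then show "a - b \<in> poly_ring B z" by (simp add: p q)
  have "poly (p * q) z \<in> poly_ring B z" by (rule poly_ringI) (rule coeff_mult_in[OF B p(1) q(1)])
  then show "a * b \<in> poly_ring B z" by (simp add: p q)
qed

lemma poly_ring_least:
  assumes "subring_set C" "B \<subseteq> C" "z \<in> C" shows "poly_ring B z \<subseteq> C"
proof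
  fix a assume "a \<in> poly_ring B z"
  from poly_ringD[OF this] obtain p where "\<And>i. coeff p i \<in> B" "a = poly p z" by blast
  then show "a \<in> C" using assms(2) by (auto intro!: subring_set_poly[OF assms(1) _ assms(3)])
qed

lemma poly_ring_countable: assumes "countable B" shows "countable (poly_ring B z)"
proof -
  have "poly_ring B z = (\<lambda>p. poly p z) ` {p. \<forall>i. coeff p i \<in> B}" unfolding poly_ring_def by auto
  then show ?thesis using countable_image[OF countable_poly_over[OF assms]] by simp
qed

lemma countable_algebraic: assumes "countable B" shows "countable {z. algebraic_over B z}"
proof -
  have "{z. algebraic_over B z} = (\<Union>q\<in>{q. \<forall>i. coeff q i \<in> B} - {0}. {z. poly q z = 0})"
    unfolding algebraic_over_def by auto
  moreover have "countable \<dots>"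
    by (intro countable_UN countable_Diff countable_poly_over assms)
      (simp add: countable_finite poly_roots_finite)
  ultimately show ?thesis by simp
qed

lemma prime_zero: "prime_on A ({0} :: complex set)"
  unfolding prime_on_def by simp

lemma partial_hom_Id: assumes "subring_set B" shows "partial_hom {0} (Id_on (B :: complex set))"
  using assms unfolding partial_hom_def subring_set_def by (auto simp: Id_on_iff)

text \<open>By counting. If \<open>g\<close> were transcendental over \<open>B\<close>, it could be sent to any transcendental number by a
  homomorphism over \<open>B\<close>, which moves \<open>z\<close> to one of the finitely many roots of its equation; hence all these
  numbers would be roots of finitely many polynomials, but there are uncountably many.\<close>

lemma algebraic_trans:
  assumes B: "subring_set B" and cB: "countable B" and z: "algebraic_over B z"
    and g: "algebraic_over (poly_ring B z) g"
  shows "algebraic_over B g"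
proof (rule ccontr)
  assume ng: "\<not> algebraic_over B g"
  let ?C = "poly_ring B z"
  let ?A = "poly_ring ?C g"
  have C: "subring_set ?C" by (rule poly_ring_subring[OF B])
  have A: "subring_set ?A" by (rule poly_ring_subring[OF C])
  have gA: "g \<in> ?A" by (rule poly_ring_gen[OF C])
  have BA: "b \<in> ?A" if "b \<in> B" for b by (rule poly_ring_base[OF C poly_ring_base[OF B that]])
  interpret I: hom_graph ?A "{0}" "Id_on B"
    by unfold_locales (use A partial_hom_Id[OF B] prime_zero BA in \<open>auto simp: Id_on_iff\<close>)
  obtain h where h: "h \<noteq> 0" "\<forall>i. coeff h i \<in> B" "poly h z = 0" using z unfolding algebraic_over_def by blast
  obtain P where P: "P \<noteq> 0" "\<forall>i. coeff P i \<in> ?C" "poly P g = 0" using g unfolding algebraic_over_def by blast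
  have "\<forall>i. \<exists>c. (\<forall>j. coeff c j \<in> B) \<and> coeff P i = poly c z" using poly_ringD P(2) by blast
  then obtain c where c: "\<And>i j. coeff (c i) j \<in> B" "\<And>i. coeff P i = poly (c i) z" by metis
  define F where "F y = (\<Sum>i\<le>degree P. monom (poly (c i) y) i)" for y
  define W where "W = (\<Union>y\<in>{y. poly h y = 0 \<and> F y \<noteq> 0}. {x. poly (F y) x = 0})"
  have finW: "finite W"
    unfolding W_def by (intro finite_UN_I finite_subset[OF _ poly_roots_finite[OF h(1)]] poly_roots_finite) auto
  have pp: "pair_poly (Id_on B) q r \<longleftrightarrow> q = r \<and> (\<forall>i. coeff q i \<in> B)" for q r
    unfolding pair_poly_def Id_on_iff by (auto intro: poly_eqI)
  have "\<zeta> \<in> W" if \<zeta>: "\<not> algebraic_over B \<zeta>" for \<zeta>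
  proof -
    have "partial_hom {0} (adjoin (Id_on B) g \<zeta>)"
    proof (rule I.adjoin_transcendental[OF gA])
      show "r = 0" if "pair_poly (Id_on B) q r" "poly q g \<in> {0}" for q r
        using that ng unfolding algebraic_over_def pp by auto
      show "poly r \<zeta> \<noteq> 0" if "pair_poly (Id_on B) q r" "r \<noteq> 0" for q r
        using that \<zeta> unfolding algebraic_over_def pp by auto
    qed
    from extend_partial_hom[OF A poly_ring_countable[OF poly_ring_countable[OF cB]] prime_zero this I.dom_adjoin[OF gA]]
    obtain D where D: "adjoin (Id_on B) g \<zeta> \<subseteq> D" "partial_hom {0} D" "fst ` D = ?A" .
    interpret D: hom_graph ?A "{0}" D
      by unfold_locales (use A D prime_zero in auto)
    have "z \<in> fst ` D" using D(3) poly_ring_base[OF C poly_ring_gen[OF B]] by simp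
    then obtain y where y: "(z, y) \<in> D" by auto
    have IdD: "Id_on B \<subseteq> D" using I.sub_adjoin D(1) by (rule subset_trans)
    have ppD: "pair_poly D q q" if "\<forall>i. coeff q i \<in> B" for q
      unfolding pair_poly_def using that IdD by (auto simp: Id_on_iff)
    have "(poly h z, poly h y) \<in> D" by (rule D.poly_D[OF ppD[OF h(2)] y])
    then have hy: "poly h y = 0" using D.ker_D h(3) by simp
    have cD: "(coeff P i, poly (c i) y) \<in> D" for i
      unfolding c(2) by (rule D.poly_D[OF ppD y]) (use c(1) in simp)
    have coF: "coeff (F y) i = (if i \<le> degree P then poly (c i) y else 0)" for i
      unfolding F_def by (simp add: coeff_sum)
    have "(coeff P i, coeff (F y) i) \<in> D" for i
      using cD[of i] D.zero_D by (simp add: coF coeff_eq_0)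
    then have PF: "pair_poly D P (F y)" unfolding pair_poly_def by blast
    have g\<zeta>: "(g, \<zeta>) \<in> D" using I.in_adjoin[of g \<zeta>] D(1) by auto
    have "(poly P g, poly (F y) \<zeta>) \<in> D" by (rule D.poly_D[OF PF g\<zeta>])
    then have "poly (F y) \<zeta> = 0" using D.ker_D P(3) by simp
    moreover have "F y \<noteq> 0"
    proof
      assume "F y = 0"
      then have "(lead_coeff P, 0) \<in> D" using D.pp_coeff[OF PF, of "degree P"] by simp
      then have "lead_coeff P = 0" using D.ker_D by force
      then show False using P(1) by simp
    qed
    ultimately show ?thesis unfolding W_def using hy by blast
  qed
  then have "UNIV \<subseteq> {z. algebraic_over B z} \<union> W" by auto
  moreover have "countable ({z. algebraic_over B z} \<union> W)"
    using countable_algebraic[OF cB] finW by (simp add: countable_finite)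
  ultimately have "countable (UNIV :: complex set)" by (rule countable_subset)
  then show False using uncountable_UNIV_complex by simp
qed

lemma algebraic_over_mem: assumes "subring_set B" "g \<in> B" shows "algebraic_over B g"
proof -
  have "coeff [:- g, 1:] i \<in> B" for i
    using subring_setD[OF assms(1)] assms(2) by (auto simp: coeff_pCons split: nat.split)
  then show ?thesis unfolding algebraic_over_def by (intro exI[of _ "[:- g, 1:]"]) auto
qed

lemma algebraic_over_mono: "algebraic_over B z \<Longrightarrow> B \<subseteq> C \<Longrightarrow> algebraic_over C z"
  unfolding algebraic_over_def by blast

lemma algebraic_poly_ring:
  assumes B: "subring_set B" and cB: "countable B" and z: "algebraic_over B z" and g: "g \<in> poly_ring B z"
  shows "algebraic_over B g"
  by (rule algebraic_trans[OF B cB z algebraic_over_mem[OF poly_ring_subring[OF B] g]])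

lemma algebraic_nonzero_const:
  assumes B: "subring_set B" and a: "algebraic_over B a" "a \<noteq> 0"
  obtains c q where "c \<noteq> 0" "\<And>i. coeff (pCons c q) i \<in> B" "c + a * poly q a = 0"
proof -
  obtain p where p: "p \<noteq> 0" "\<forall>i. coeff p i \<in> B" "poly p a = 0" using a(1) unfolding algebraic_over_def by blast
  from p have "\<exists>c q. c \<noteq> 0 \<and> (\<forall>i. coeff (pCons c q) i \<in> B) \<and> c + a * poly q a = 0"
  proof (induction p)
    case (pCons c q)
    show ?case
    proof (cases "c = 0")
      case True
      have "\<forall>i. coeff q i \<in> B"
      proof
        show "coeff q i \<in> B" for i using pCons.prems(2)[rule_format, of "Suc i"] by simp
      qed
      moreover have "q \<noteq> 0" "poly q a = 0" using True pCons.prems a(2) by auto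
      ultimately show ?thesis using pCons.IH by simp
    next
      case False
      then show ?thesis using pCons.prems by (intro exI[of _ c] exI[of _ q]) simp
    qed
  qed simp
  then show thesis using that by blast
qed

definition abs_value :: "complex set \<Rightarrow> complex set \<Rightarrow> (complex \<Rightarrow> real) \<Rightarrow> bool" where
  "abs_value K B \<nu> \<longleftrightarrow> mult_seminorm B \<nu> \<and> (\<forall>b\<in>B. b \<noteq> 0 \<longrightarrow> 0 < \<nu> b) \<and> (\<forall>c\<in>K. c \<noteq> 0 \<longrightarrow> \<nu> c = 1)"

text \<open>The Gauss norm with radius \<open>\<rho>\<close>, so large that the leading term dominates in the minimal equation \<open>h\<close> of \<open>z\<close>, induces
  a quotient seminorm on the ring generated by \<open>z\<close>. Pseudo-division by \<open>h\<close> does not increase it, so it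
  restricts to \<open>\<nu>\<close> on \<open>B\<close>. A multiplicative seminorm below it extends \<open>\<nu>\<close>, because inverses of elements
  of \<open>B\<close> are included in the ring \<open>A\<close>. It is positive on nonzero elements as these divide nonzero
  elements of \<open>B\<close>.\<close>

lemma abs_value_extend:
  assumes B: "subring_set B" and cB: "countable B" and KB: "K \<subseteq> B" and av: "abs_value K B \<nu>"
    and z: "algebraic_over B z"
  obtains \<mu> where "abs_value K (poly_ring B z) \<mu>" "\<And>b. b \<in> B \<Longrightarrow> \<mu> b = \<nu> b"
proof -
  interpret mult_seminormed B \<nu> using B av by unfold_locales (auto simp: abs_value_def)
  have pos: "0 < \<nu> b" if "b \<in> B" "b \<noteq> 0" for b using av that by (simp add: abs_value_def)
  define P where "P p \<longleftrightarrow> p \<noteq> 0 \<and> (\<forall>i. coeff p i \<in> B) \<and> poly p z = 0" for p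
  obtain p0 where "P p0" using z unfolding algebraic_over_def P_def by blast
  from ex_has_least_nat[of P, OF this, of degree]
  obtain h where hP: "P h" and least: "\<And>p. P p \<Longrightarrow> degree h \<le> degree p" by blast
  define n where "n = degree h"
  define l where "l = coeff h n"
  have h: "h \<noteq> 0" "\<And>i. coeff h i \<in> B" "poly h z = 0" using hP by (auto simp: P_def)
  have l: "l \<in> B" "l \<noteq> 0" using h by (simp_all add: l_def n_def)
  have n0: "n \<noteq> 0"
  proof
    assume "n = 0"
    then obtain c where "h = [:c:]" unfolding n_def by (metis degree_eq_zeroE)
    then show False using h by simp
  qed
  have zeroB: "0 \<in> B" by (rule sub(2))
  define \<rho> where "\<rho> = Max (insert 1 ((\<lambda>i. \<nu> (coeff h i) / \<nu> l) ` {..n}))"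
  have \<rho>1: "1 \<le> \<rho>" unfolding \<rho>_def by (intro Max_ge) auto
  then have \<rho>0: "0 < \<rho>" by simp
  have hb: "\<nu> (coeff h i) * \<rho> ^ i \<le> \<nu> l * \<rho> ^ n" for i
  proof -
    consider "i > n" | "i = n" | "i < n" by linarith
    then show ?thesis
    proof cases
      case 1
      then show ?thesis using sn(2) pos[OF l] \<rho>0 by (simp add: coeff_eq_0 n_def)
    next
      case 2
      then show ?thesis by (simp add: l_def)
    next
      case 3
      have "\<nu> (coeff h i) / \<nu> l \<le> \<rho>" unfolding \<rho>_def using 3 by (intro Max_ge) auto
      then have "\<nu> (coeff h i) \<le> \<nu> l * \<rho>" using pos[OF l] by (simp add: field_simps)
      also have "\<dots> \<le> \<nu> l * \<rho> ^ (n - i)"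
        using pos[OF l] 3 \<rho>1 self_le_power[OF \<rho>1, of "n - i"] by (intro mult_left_mono) auto
      finally have "\<nu> (coeff h i) * \<rho> ^ i \<le> \<nu> l * \<rho> ^ (n - i) * \<rho> ^ i"
        using \<rho>0 by (intro mult_right_mono) auto
      then show ?thesis using 3 by (simp add: mult.assoc power_add[symmetric])
    qed
  qed
  define bdd where "bdd p t \<longleftrightarrow> (\<forall>i. coeff p i \<in> B \<and> \<nu> (coeff p i) * \<rho> ^ i \<le> t)" for p t
  have bddD: "coeff p i \<in> B" "\<nu> (coeff p i) * \<rho> ^ i \<le> t" if "bdd p t" for p t i
    using that by (simp_all add: bdd_def)
  have bdd0: "0 \<le> t" if "bdd p t" for p t
    using bddD[OF that, of 0] sn(3)[of "coeff p 0"] by simp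
  have bdd_const: "bdd [:b:] (\<nu> b)" if "b \<in> B" for b
    unfolding bdd_def using that zeroB sn(2) sn(3)[OF that] by (simp add: coeff_pCons split: nat.split)
  have bdd_diff: "bdd (p - q) (max s t)" if "bdd p s" "bdd q t" for p q s t
    unfolding bdd_def
  proof (intro allI conjI)
    fix i
    note p = bddD[OF that(1), of i] and q = bddD[OF that(2), of i]
    show "coeff (p - q) i \<in> B" using p q sub(3) by simp
    have "\<nu> (coeff p i - coeff q i) * \<rho> ^ i \<le> max (\<nu> (coeff p i)) (\<nu> (coeff q i)) * \<rho> ^ i"
      using sn(5)[OF p(1) q(1)] \<rho>0 by (intro mult_right_mono) auto
    also have "\<dots> \<le> max s t" using p(2) q(2) by (auto simp: max_def)
    finally show "\<nu> (coeff (p - q) i) * \<rho> ^ i \<le> max s t" by simp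
  qed
  have bdd_mult: "bdd (p * q) (s * t)" if "bdd p s" "bdd q t" for p q s t
    unfolding bdd_def
  proof (intro allI conjI)
    fix i
    show "coeff (p * q) i \<in> B" by (rule coeff_mult_in[OF B bddD(1)[OF that(1)] bddD(1)[OF that(2)]])
    have "\<nu> (coeff (p * q) i) \<le> s * t / \<rho> ^ i"
      unfolding coeff_mult
    proof (rule \<nu>_sum_le)
      show "0 \<le> s * t / \<rho> ^ i" using bdd0[OF that(1)] bdd0[OF that(2)] \<rho>0 by simp
      fix j assume "j \<in> {..i}"
      then have e: "\<rho> ^ i = \<rho> ^ j * \<rho> ^ (i - j)" by (simp add: power_add[symmetric])
      note p = bddD[OF that(1), of j] and q = bddD[OF that(2), of "i - j"]
      show "coeff p j * coeff q (i - j) \<in> B" by (rule sub(4)[OF p(1) q(1)])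
      have "(\<nu> (coeff p j) * \<rho> ^ j) * (\<nu> (coeff q (i - j)) * \<rho> ^ (i - j)) \<le> s * t"
        by (intro mult_mono p(2) q(2)) (use bdd0[OF that(1)] sn(3)[OF q(1)] \<rho>0 in auto)
      then show "\<nu> (coeff p j * coeff q (i - j)) \<le> s * t / \<rho> ^ i"
        using \<rho>0 unfolding sn(4)[OF p(1) q(1)] e by (simp add: field_simps)
    qed
    then show "\<nu> (coeff (p * q) i) * \<rho> ^ i \<le> s * t" using \<rho>0 by (simp add: field_simps)
  qed
  have bdd_up: "bdd p t" if "bdd p s" "s \<le> t" for p s t
    unfolding bdd_def using bddD[OF that(1)] that(2) by (meson order_trans)
  have bdd_smult: "bdd (smult b p) (\<nu> b * t)" if "b \<in> B" "bdd p t" for b p t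
    using bdd_mult[OF bdd_const[OF that(1)] that(2)] by simp
  have bdd_ex: "\<exists>t. bdd p t" if "\<And>i. coeff p i \<in> B" for p
  proof -
    have "\<nu> (coeff p i) * \<rho> ^ i \<le> (\<Sum>i\<le>degree p. \<nu> (coeff p i) * \<rho> ^ i)" for i
    proof (cases "i \<le> degree p")
      case True
      then show ?thesis using sn(3)[OF that] \<rho>0 by (intro member_le_sum) auto
    next
      case False
      then show ?thesis using sn(2) sn(3)[OF that] \<rho>0 by (auto simp: coeff_eq_0 intro!: sum_nonneg)
    qed
    then show ?thesis unfolding bdd_def using that by blast
  qed
  have unit: "1 \<le> t" if "bdd p (t * \<nu> b)" "b \<in> B" "b \<noteq> 0" "poly p z = b" for p t b
    using that
  proof (induction "degree p" arbitrary: p b rule: less_induct)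
    case less
    note p = less.prems
    show ?case
    proof (cases "degree p < n")
      case True
      have "p - [:b:] = 0"
      proof (rule ccontr)
        assume ne: "p - [:b:] \<noteq> 0"
        have "P (p - [:b:])"
          unfolding P_def using ne p(4) bddD(1)[OF bdd_diff[OF p(1) bdd_const[OF p(2)]]] by simp
        from least[OF this] have "n \<le> degree (p - [:b:])" by (simp add: n_def)
        also have "\<dots> \<le> degree p" by (rule degree_diff_le) simp_all
        finally show False using True by simp
      qed
      then have "p = [:b:]" by simp
      then have "\<nu> b \<le> t * \<nu> b" using bddD(2)[OF p(1), of 0] by simp
      then show ?thesis using pos[OF p(2,3)] by simp
    next
      case False
      define e c where "e = degree p" and "c = coeff p e"
      have en: "n \<le> e" using False by (simp add: e_def)
      have c: "c \<in> B" "\<nu> c * \<rho> ^ e \<le> t * \<nu> b" using bddD[OF p(1), of e] by (simp_all add: c_def)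
      define m where "m = monom c (e - n)"
      have cm: "coeff m i = (if e - n = i then c else 0)" for i by (simp add: m_def)
      have bm: "bdd m (\<nu> c * \<rho> ^ (e - n))"
        unfolding bdd_def cm using c(1) zeroB sn(2) sn(3)[OF c(1)] \<rho>0 by simp
      have bh: "bdd h (\<nu> l * \<rho> ^ n)" unfolding bdd_def using h(2) hb by simp
      have "bdd (m * h) (\<nu> c * \<rho> ^ (e - n) * (\<nu> l * \<rho> ^ n))" by (rule bdd_mult[OF bm bh])
      moreover have "\<nu> c * \<rho> ^ (e - n) * (\<nu> l * \<rho> ^ n) = \<nu> l * (\<nu> c * \<rho> ^ e)"
        using en by (simp add: power_add[symmetric] mult_ac)
      moreover have "\<nu> l * (\<nu> c * \<rho> ^ e) \<le> \<nu> l * (t * \<nu> b)"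
        using c(2) pos[OF l] by (intro mult_left_mono) auto
      ultimately have bmh: "bdd (m * h) (\<nu> l * (t * \<nu> b))" using bdd_up by simp
      define p1 where "p1 = smult l p - m * h"
      have "bdd p1 (\<nu> l * (t * \<nu> b))"
        using bdd_diff[OF bdd_smult[OF l(1) p(1)] bmh] by (simp add: p1_def)
      then have b1: "bdd p1 (t * \<nu> (l * b))" unfolding sn(4)[OF l(1) p(2)] by (simp add: mult_ac)
      have v1: "poly p1 z = l * b" using h(3) p(4) by (simp add: p1_def)
      have lb: "l * b \<in> B" "l * b \<noteq> 0" using sub(4)[OF l(1) p(2)] l(2) p(3) by auto
      have "degree (m * h) \<le> degree m + degree h" by (rule degree_mult_le)
      also have "\<dots> \<le> (e - n) + n" unfolding m_def n_def by (intro add_mono degree_monom_le order_refl)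
      finally have "degree (m * h) \<le> e" using en by simp
      moreover have "degree (smult l p) \<le> e" by (simp add: e_def)
      ultimately have d1: "degree p1 \<le> e" unfolding p1_def by (rule degree_diff_le[rotated])
      have "coeff (m * h) e = c * l" unfolding m_def using en by (simp add: coeff_monom_mult l_def)
      then have z1: "coeff p1 e = 0" by (simp add: p1_def c_def)
      have "p1 \<noteq> 0" using v1 lb(2) by auto
      then have "degree p1 \<noteq> e" using z1 by (metis leading_coeff_0_iff)
      then have "degree p1 < degree p" using d1 by (simp add: e_def)
      from less.hyps[OF this b1 lb v1] show ?thesis .
    qed
  qed
  define A where "A = {a. \<exists>b\<in>B. b \<noteq> 0 \<and> b * a \<in> poly_ring B z}"
  define T where "T = {(a, t). 0 \<le> t \<and> (\<exists>b p. b \<in> B \<and> b \<noteq> 0 \<and> bdd p (t * \<nu> b) \<and> b * a = poly p z)}"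
  have TI: "(a, t) \<in> T" if "0 \<le> t" "b \<in> B" "b \<noteq> 0" "bdd p (t * \<nu> b)" "b * a = poly p z" for a t b p
    using that unfolding T_def by blast
  have TE: "\<exists>b p. 0 \<le> t \<and> b \<in> B \<and> b \<noteq> 0 \<and> bdd p (t * \<nu> b) \<and> b * a = poly p z" if "(a, t) \<in> T" for a t
    using that unfolding T_def by simp
  have R: "subring_set (poly_ring B z)" by (rule poly_ring_subring[OF B])
  have inA: "a \<in> A" if "a \<in> poly_ring B z" for a
    unfolding A_def using that sub(1) by (intro CollectI bexI[of _ 1]) auto
  have A: "subring_set A"
    unfolding subring_set_def
  proof (intro conjI ballI)
    show "1 \<in> A" by (rule inA[OF subring_setD(1)[OF R]])
    fix a a' assume "a \<in> A" "a' \<in> A"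
    then obtain b b' where b: "b \<in> B" "b \<noteq> 0" "b * a \<in> poly_ring B z"
      and b': "b' \<in> B" "b' \<noteq> 0" "b' * a' \<in> poly_ring B z" unfolding A_def by blast
    have bb: "b * b' \<in> B" "b * b' \<noteq> 0" using sub(4)[OF b(1) b'(1)] b(2) b'(2) by auto
    note R' = subring_setD[OF R] poly_ring_base[OF B, of _ z]
    have "b' * (b * a) - b * (b' * a') \<in> poly_ring B z" by (intro R'(3,4) R'(7) b b')
    then have "(b * b') * (a - a') \<in> poly_ring B z" by (simp add: algebra_simps)
    then show "a - a' \<in> A" unfolding A_def using bb by blast
    have "(b * a) * (b' * a') \<in> poly_ring B z" by (intro R'(4) b b')
    then have "(b * b') * (a * a') \<in> poly_ring B z" by (simp add: mult_ac)
    then show "a * a' \<in> A" unfolding A_def using bb by blast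
  qed
  have "seminorm_epigraph A T"
  proof (rule seminorm_epigraphI)
    show "T \<subseteq> A \<times> {0..}"
    proof
      fix x assume x: "x \<in> T"
      obtain a t where at: "x = (a, t)" by (cases x)
      from TE[OF x[unfolded at]] obtain b p where
        b: "0 \<le> t" "b \<in> B" "b \<noteq> 0" "bdd p (t * \<nu> b)" "b * a = poly p z" by blast
      have "poly p z \<in> poly_ring B z" by (rule poly_ringI) (rule bddD(1)[OF b(4)])
      then have "b * a \<in> poly_ring B z" using b(5) by simp
      then have "a \<in> A" unfolding A_def using b(2,3) by blast
      then show "x \<in> A \<times> {0..}" using at b(1) by simp
    qed
    show "\<exists>t. (a, t) \<in> T" if "a \<in> A" for a
    proof -
      from that obtain b where b: "b \<in> B" "b \<noteq> 0" "b * a \<in> poly_ring B z" unfolding A_def by blast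
      from poly_ringD[OF b(3)] obtain p where p: "\<And>i. coeff p i \<in> B" "b * a = poly p z" by blast
      from bdd_ex[OF p(1)] obtain t where t: "bdd p t" by blast
      have "bdd p (t / \<nu> b * \<nu> b)" using t pos[OF b(1,2)] by simp
      then have "(a, t / \<nu> b) \<in> T"
        using bdd0[OF t] pos[OF b(1,2)] by (intro TI[OF _ b(1,2) _ p(2)]) auto
      then show ?thesis ..
    qed
    show "(a, t) \<in> T" if at: "(a, s) \<in> T" "s \<le> t" for a s t
    proof -
      from TE[OF at(1)] obtain b p where
        b: "0 \<le> s" "b \<in> B" "b \<noteq> 0" "bdd p (s * \<nu> b)" "b * a = poly p z" by blast
      have "s * \<nu> b \<le> t * \<nu> b" using at(2) pos[OF b(2,3)] by simp
      then have "bdd p (t * \<nu> b)" by (rule bdd_up[OF b(4)])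
      then show ?thesis using b at(2) by (intro TI[of t b p]) auto
    qed
    have base: "(b, \<nu> b) \<in> T" if "b \<in> B" for b
      using TI[of "\<nu> b" 1 "[:b:]" b] sn(1,3) sub(1) that bdd_const[OF that] by simp
    show "(0, 0) \<in> T" "(1, 1) \<in> T" using base[OF zeroB] base[OF sub(1)] sn(1,2) by simp_all
    show "1 \<le> t" if "(1, t) \<in> T" for t
    proof -
      from TE[OF that] obtain b p where
        b: "0 \<le> t" "b \<in> B" "b \<noteq> 0" "bdd p (t * \<nu> b)" "b * 1 = poly p z" by blast
      then show ?thesis by (intro unit[OF b(4,2,3)]) simp
    qed
    fix a s a' t assume "(a, s) \<in> T" "(a', t) \<in> T"
    from TE[OF this(1)] TE[OF this(2)] obtain b p b' p' where
      b: "0 \<le> s" "b \<in> B" "b \<noteq> 0" "bdd p (s * \<nu> b)" "b * a = poly p z" and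
      b': "0 \<le> t" "b' \<in> B" "b' \<noteq> 0" "bdd p' (t * \<nu> b')" "b' * a' = poly p' z" by blast
    have bb: "b * b' \<in> B" "b * b' \<noteq> 0" using sub(4)[OF b(2) b'(2)] b(3) b'(3) by auto
    have e: "\<nu> (b * b') = \<nu> b * \<nu> b'" by (rule sn(4)[OF b(2) b'(2)])
    have "bdd (smult b' p - smult b p') (max (\<nu> b' * (s * \<nu> b)) (\<nu> b * (t * \<nu> b')))"
      by (intro bdd_diff bdd_smult b b')
    moreover have "max (\<nu> b' * (s * \<nu> b)) (\<nu> b * (t * \<nu> b')) = max s t * \<nu> (b * b')"
      using pos[OF b(2,3)] pos[OF b'(2,3)] unfolding e max_mult_distrib_right by (simp add: mult_ac)
    ultimately have "bdd (smult b' p - smult b p') (max s t * \<nu> (b * b'))" by simp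
    moreover have "(b * b') * (a - a') = b' * (b * a) - b * (b' * a')" by (simp add: algebra_simps)
    then have "(b * b') * (a - a') = poly (smult b' p - smult b p') z" unfolding b(5) b'(5) by simp
    ultimately show "(a - a', max s t) \<in> T" using b(1) by (intro TI[OF _ bb]) auto
    have "bdd (p * p') (s * \<nu> b * (t * \<nu> b'))" by (rule bdd_mult[OF b(4) b'(4)])
    then have "bdd (p * p') (s * t * \<nu> (b * b'))" unfolding e by (simp add: mult_ac)
    moreover have "(b * b') * (a * a') = (b * a) * (b' * a')" by (simp add: mult_ac)
    then have "(b * b') * (a * a') = poly (p * p') z" unfolding b(5) b'(5) by simp
    ultimately show "(a * a', s * t) \<in> T" using b(1) b'(1) by (intro TI[OF _ bb]) auto
  qed
  from exists_mult_seminorm[OF A this] obtain \<mu> where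
    \<mu>: "mult_seminorm A \<mu>" and \<mu>T: "\<And>a t. (a, t) \<in> T \<Longrightarrow> \<mu> a \<le> t" by blast
  interpret M: mult_seminormed A \<mu> using A \<mu> by unfold_locales
  have BA: "b \<in> A" if "b \<in> B" for b by (rule inA[OF poly_ring_base[OF B that]])
  have ext: "\<mu> b = \<nu> b" if b: "b \<in> B" for b
  proof (cases "b = 0")
    case True
    then show ?thesis using M.sn(2) sn(2) by simp
  next
    case False
    have "(b, \<nu> b) \<in> T" using TI[of "\<nu> b" 1 "[:b:]" b] sn(1,3) sub(1) b bdd_const[OF b] by simp
    then have 1: "\<mu> b \<le> \<nu> b" by (rule \<mu>T)
    have "bdd [:1:] (1 / \<nu> b * \<nu> b)" using bdd_const[OF sub(1)] sn(1) pos[OF b False] by simp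
    then have iT: "(1 / b, 1 / \<nu> b) \<in> T"
      using pos[OF b False] False by (intro TI[OF _ b False]) auto
    have iA: "1 / b \<in> A" unfolding A_def
      using b False poly_ring_base[OF B sub(1)] by (intro CollectI bexI[of _ b]) auto
    have "\<mu> b * \<mu> (1 / b) = 1" using M.sn(4)[OF BA[OF b] iA] M.sn(1) False by simp
    moreover have "\<mu> b * \<mu> (1 / b) \<le> \<mu> b * (1 / \<nu> b)"
      by (intro mult_left_mono \<mu>T[OF iT] M.sn(3)[OF BA[OF b]])
    ultimately have "\<nu> b \<le> \<mu> b" using pos[OF b False] by (simp add: field_simps)
    then show ?thesis using 1 by simp
  qed
  have "mult_seminorm (poly_ring B z) \<mu>"
    unfolding mult_seminorm_def using M.sn inA by simp
  moreover have "0 < \<mu> a" if a: "a \<in> poly_ring B z" "a \<noteq> 0" for a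
  proof -
    obtain c q where c: "c \<noteq> 0" "\<And>i. coeff (pCons c q) i \<in> B" "c + a * poly q a = 0"
      using algebraic_nonzero_const[OF B algebraic_poly_ring[OF B cB z a(1)] a(2)] by blast
    have cB: "c \<in> B" using c(2)[of 0] by simp
    have qB: "coeff q i \<in> B" for i using c(2)[of "Suc i"] by simp
    have aA: "a \<in> A" by (rule inA[OF a(1)])
    have qA: "poly q a \<in> A" by (rule subring_set_poly[OF A BA[OF qB] aA])
    have "c = - (a * poly q a)" using c(3) by (simp add: eq_neg_iff_add_eq_0)
    then have "\<nu> c = \<mu> (- (a * poly q a))" using ext[OF cB] by simp
    also have "\<dots> = \<mu> a * \<mu> (poly q a)" using M.\<nu>_minus[OF M.sub(4)[OF aA qA]] M.sn(4)[OF aA qA] by simp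
    finally have "\<mu> a \<noteq> 0" using pos[OF cB c(1)] by auto
    then show ?thesis using M.sn(3)[OF aA] by simp
  qed
  moreover have "\<mu> c = 1" if "c \<in> K" "c \<noteq> 0" for c
    using that ext[of c] KB av by (auto simp: abs_value_def)
  ultimately have "abs_value K (poly_ring B z) \<mu>" unfolding abs_value_def by simp
  then show thesis using ext by (rule that)
qed

section \<open>Sizes of roots of complex polynomials\<close>

text \<open>A linear factor \<open>X - w\<close> is close to \<open>X\<close> if \<open>w\<close> is small and close to a multiple of \<open>1\<close> if \<open>w\<close> is large.\<close>

lemma coeffs_near_monomial:
  fixes q :: "complex poly"
  assumes "q \<noteq> 0" and \<delta>: "0 < \<delta>" "\<delta> \<le> 1"
    and "\<And>w. poly q w = 0 \<Longrightarrow> cmod w \<le> \<delta> \<or> 1 / \<delta> \<le> cmod w"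
  shows "\<exists>c k. c \<noteq> 0 \<and>
    (\<forall>i. cmod (coeff q i - (if i = k then c else 0)) \<le> cmod c * ((3 ^ degree q - 1) * \<delta>))"
  using assms(1,4)
proof (induction "degree q" arbitrary: q)
  case 0
  then obtain c where c: "q = [:c:]" by (metis degree_eq_zeroE)
  then show ?case using 0 by (intro exI[of _ c] exI[of _ 0]) (simp add: coeff_pCons split: nat.split)
next
  case (Suc m)
  then have "\<not> constant (poly q)" by (simp add: constant_degree)
  then obtain w where w: "poly q w = 0" using fundamental_theorem_of_algebra by blast
  then obtain r where r: "q = [:- w, 1:] * r" using poly_eq_0_iff_dvd by (metis dvdE)
  have r0: "r \<noteq> 0" using Suc.prems(1) r by auto
  have "degree q = 1 + degree r" unfolding r using r0 by (subst degree_mult_eq) auto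
  then have deg: "m = degree r" using Suc.hyps(2) by simp
  have roots: "cmod x \<le> \<delta> \<or> 1 / \<delta> \<le> cmod x" if "poly r x = 0" for x
    using Suc.prems(2)[of x] that by (simp add: r)
  from Suc.hyps(1)[OF deg r0 roots] obtain c k where c: "c \<noteq> 0"
    and ck: "\<And>i. cmod (coeff r i - (if i = k then c else 0)) \<le> cmod c * ((3 ^ degree r - 1) * \<delta>)" by blast
  define \<eta> where "\<eta> = (3 ^ m - 1) * \<delta>"
  have \<eta>0: "0 \<le> \<eta>" unfolding \<eta>_def using \<delta> by simp
  have ck': "cmod (coeff r i - (if i = k then c else 0)) \<le> cmod c * \<eta>" for i
    using ck[of i] by (simp add: \<eta>_def deg)
  have size: "cmod (coeff r i) \<le> cmod c * (1 + \<eta>)" for i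
  proof -
    have "cmod (coeff r i) \<le> cmod (coeff r i - (if i = k then c else 0)) + cmod (if i = k then c else 0)"
      by (metis diff_add_cancel norm_triangle_ineq)
    also have "\<dots> \<le> cmod c * \<eta> + cmod c" by (intro add_mono ck') auto
    finally show ?thesis by (simp add: algebra_simps)
  qed
  have "\<eta> + \<delta> * (1 + \<eta>) \<le> \<eta> + \<delta> + \<eta>"
    using mult_right_mono[OF \<delta>(2) \<eta>0] by (simp add: algebra_simps)
  also have "\<dots> \<le> (3 ^ Suc m - 1) * \<delta>"
    unfolding \<eta>_def using \<delta> by (simp add: algebra_simps)
  finally have new: "\<eta> + \<delta> * (1 + \<eta>) \<le> (3 ^ degree q - 1) * \<delta>" using Suc.hyps(2) by simp
  define r' where "r' i = (case i of 0 \<Rightarrow> 0 | Suc j \<Rightarrow> coeff r j)" for i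
  have cq: "coeff q i = r' i - w * coeff r i" for i
    unfolding r r'_def by (cases i) (simp_all add: algebra_simps)
  have r'size: "cmod (r' i) \<le> cmod c * (1 + \<eta>)" for i
    unfolding r'_def using size \<eta>0 by (simp split: nat.split)
  have r'near: "cmod (r' i - (if i = Suc k then c else 0)) \<le> cmod c * \<eta>" for i
  proof (cases i)
    case (Suc j)
    then show ?thesis using ck'[of j] by (simp add: r'_def)
  qed (use \<eta>0 in \<open>simp add: r'_def\<close>)
  from Suc.prems(2)[OF w] show ?case
  proof
    assume w\<delta>: "cmod w \<le> \<delta>"
    have "cmod (coeff q i - (if i = Suc k then c else 0)) \<le> cmod c * ((3 ^ degree q - 1) * \<delta>)" for i
    proof -
      have "cmod (coeff q i - (if i = Suc k then c else 0))
        = cmod ((r' i - (if i = Suc k then c else 0)) - w * coeff r i)" by (simp add: cq algebra_simps)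
      also have "\<dots> \<le> cmod (r' i - (if i = Suc k then c else 0)) + cmod w * cmod (coeff r i)"
        by (metis norm_mult norm_triangle_ineq4)
      also have "\<dots> \<le> cmod c * \<eta> + \<delta> * (cmod c * (1 + \<eta>))"
        by (intro add_mono mult_mono r'near size w\<delta>) (use \<delta> in auto)
      also have "\<dots> = cmod c * (\<eta> + \<delta> * (1 + \<eta>))" by (simp add: algebra_simps)
      also have "\<dots> \<le> cmod c * ((3 ^ degree q - 1) * \<delta>)" by (intro mult_left_mono new) simp
      finally show ?thesis .
    qed
    then show ?thesis using c by blast
  next
    assume w\<delta>: "1 / \<delta> \<le> cmod w"
    then have w1: "1 \<le> \<delta> * cmod w" using \<delta> by (simp add: field_simps)
    then have w0: "w \<noteq> 0" by auto
    have "cmod (coeff q i - (if i = k then - w * c else 0)) \<le> cmod (- w * c) * ((3 ^ degree q - 1) * \<delta>)" for i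
    proof -
      have "cmod (coeff q i - (if i = k then - w * c else 0))
        = cmod (r' i - w * (coeff r i - (if i = k then c else 0)))" by (simp add: cq algebra_simps)
      also have "\<dots> \<le> cmod (r' i) + cmod w * cmod (coeff r i - (if i = k then c else 0))"
        by (metis norm_mult norm_triangle_ineq4)
      also have "\<dots> \<le> cmod c * (1 + \<eta>) + cmod w * (cmod c * \<eta>)"
        by (intro add_mono mult_left_mono r'size ck') auto
      also have "\<dots> \<le> (\<delta> * cmod w) * (cmod c * (1 + \<eta>)) + cmod w * (cmod c * \<eta>)"
        using mult_right_mono[OF w1, of "cmod c * (1 + \<eta>)"] \<eta>0 by simp
      also have "\<dots> = cmod (- w * c) * (\<eta> + \<delta> * (1 + \<eta>))" by (simp add: norm_mult algebra_simps)
      also have "\<dots> \<le> cmod (- w * c) * ((3 ^ degree q - 1) * \<delta>)" by (intro mult_left_mono new) simp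
      finally show ?thesis .
    qed
    then show ?thesis using c w0 by (intro exI[of _ "- w * c"] exI[of _ k]) simp
  qed
qed

text \<open>The quantitative form of the statement that a polynomial without a dominant term on a circle has a root nearby: rescale so
  that the circle has radius \<open>1\<close>.\<close>

lemma dominant_coeff_if_no_root:
  fixes q :: "complex poly"
  assumes q: "q \<noteq> 0" and R: "R > 0" and \<delta>: "0 < \<delta>" "3 ^ degree q * \<delta> \<le> 1 / 2"
    and roots: "\<And>w. poly q w = 0 \<Longrightarrow> cmod w \<le> R * \<delta> \<or> R / \<delta> \<le> cmod w"
  obtains k where "coeff q k \<noteq> 0"
    "\<And>i. i \<noteq> k \<Longrightarrow> cmod (coeff q i) * R ^ i \<le> 2 * 3 ^ degree q * \<delta> * (cmod (coeff q k) * R ^ k)"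
proof -
  define p where "p = q \<circ>\<^sub>p [:0, complex_of_real R:]"
  have cp: "coeff p i = complex_of_real R ^ i * coeff q i" for i
    by (simp add: p_def coeff_pcompose_linear)
  have deg: "degree p = degree q" unfolding p_def using R by (simp add: degree_pcompose)
  have p0: "p \<noteq> 0" using cp[of "degree q"] q R by auto
  have "1 * \<delta> \<le> 3 ^ degree q * \<delta>" by (intro mult_right_mono) (use \<delta> in auto)
  then have \<delta>1: "\<delta> \<le> 1" using \<delta>(2) by simp
  have pr: "cmod w \<le> \<delta> \<or> 1 / \<delta> \<le> cmod w" if "poly p w = 0" for w
  proof -
    have "poly q (w * complex_of_real R) = 0" using that by (simp add: p_def poly_pcompose)
    from roots[OF this] show ?thesis using R \<delta>(1) by (simp add: norm_mult field_simps)
  qed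
  from coeffs_near_monomial[OF p0 \<delta>(1) \<delta>1 pr] obtain c k where c: "c \<noteq> 0"
    and ck: "\<And>i. cmod (coeff p i - (if i = k then c else 0)) \<le> cmod c * ((3 ^ degree p - 1) * \<delta>)" by blast
  have b: "(3 ^ degree p - 1) * \<delta> \<le> 3 ^ degree q * \<delta>" using \<delta>(1) deg by simp
  have ck': "cmod (coeff p i - (if i = k then c else 0)) \<le> cmod c * (3 ^ degree q * \<delta>)" for i
    using ck[of i] mult_left_mono[OF b, of "cmod c"] by simp
  have half: "cmod c * (3 ^ degree q * \<delta>) \<le> cmod c * (1 / 2)" by (intro mult_left_mono \<delta>(2)) simp
  have "cmod c \<le> cmod (coeff p k) + cmod (coeff p k - c)"
    using norm_triangle_ineq4[of "coeff p k" "coeff p k - c"] by simp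
  then have big: "cmod c \<le> 2 * cmod (coeff p k)" using ck'[of k] half by simp
  have np: "cmod (coeff p i) = cmod (coeff q i) * R ^ i" for i
    using R by (simp add: cp norm_mult norm_power)
  show thesis
  proof
    show "coeff q k \<noteq> 0" using big c np[of k] by auto
    fix i assume "i \<noteq> k"
    then have "cmod (coeff p i) \<le> cmod c * (3 ^ degree q * \<delta>)" using ck'[of i] by simp
    also have "\<dots> \<le> (2 * cmod (coeff p k)) * (3 ^ degree q * \<delta>)"
      by (intro mult_right_mono big) (use \<delta> in simp)
    finally show "cmod (coeff q i) * R ^ i \<le> 2 * 3 ^ degree q * \<delta> * (cmod (coeff q k) * R ^ k)"
      by (simp add: np algebra_simps)
  qed
qed

text \<open>In a vanishing sum the largest term is at most \<open>degree q\<close> times the second largest one.\<close>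

lemma root_slope:
  fixes q :: "complex poly"
  assumes q: "q \<noteq> 0" and w: "poly q w = 0" "w \<noteq> 0"
  obtains i j where "i \<le> degree q" "j \<le> degree q" "i \<noteq> j" "coeff q i \<noteq> 0" "coeff q j \<noteq> 0"
    "\<bar>(ln (cmod (coeff q i)) + real i * ln (cmod w)) - (ln (cmod (coeff q j)) + real j * ln (cmod w))\<bar>
      \<le> ln (real (degree q) + 1)"
proof -
  define t where "t i = coeff q i * w ^ i" for i
  define I where "I = {..degree q}"
  have I: "finite I" "I \<noteq> {}" by (auto simp: I_def)
  define M where "M = Max ((\<lambda>i. cmod (t i)) ` I)"
  have "M \<in> (\<lambda>i. cmod (t i)) ` I" unfolding M_def by (rule Max_in) (use I in auto)
  then obtain j where j: "j \<in> I" "cmod (t j) = M" by auto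
  have le: "cmod (t i) \<le> M" if "i \<in> I" for i unfolding M_def using that I by (intro Max_ge) auto
  have "t (degree q) \<noteq> 0" using q w by (simp add: t_def)
  then have M0: "M > 0" using le[of "degree q"] by (smt (verit) I_def atMost_iff order_refl zero_less_norm_iff)
  have sum0: "(\<Sum>i\<in>I. t i) = 0" using w(1) by (simp add: poly_altdef t_def I_def)
  have "\<exists>i\<in>I - {j}. M / (real (degree q) + 1) \<le> cmod (t i)"
  proof (rule ccontr)
    assume neg: "\<not> ?thesis"
    have "t j = - (\<Sum>i\<in>I - {j}. t i)" using sum0 sum.remove[OF I(1) j(1), of t] by (simp add: eq_neg_iff_add_eq_0)
    then have "M \<le> (\<Sum>i\<in>I - {j}. cmod (t i))" using j(2) norm_sum[of t "I - {j}"] by simp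
    also have "\<dots> \<le> (\<Sum>i\<in>I - {j}. M / (real (degree q) + 1))"
    proof (rule sum_mono)
      fix i assume "i \<in> I - {j}"
      then have "\<not> M / (real (degree q) + 1) \<le> cmod (t i)" using neg by blast
      then show "cmod (t i) \<le> M / (real (degree q) + 1)" by simp
    qed
    also have "\<dots> = real (degree q) * (M / (real (degree q) + 1))"
      using j(1) I by (simp add: card_Diff_singleton I_def)
    also have "\<dots> < M" using M0 by (simp add: field_simps)
    finally show False by simp
  qed
  then obtain i where i: "i \<in> I" "i \<noteq> j" "M / (real (degree q) + 1) \<le> cmod (t i)" by blast
  have ti: "cmod (t i) > 0" using i(3) M0 by (smt (verit) divide_pos_pos of_nat_0_le_iff)
  have nz: "coeff q i \<noteq> 0" "coeff q j \<noteq> 0" using ti j(2) M0 by (auto simp: t_def)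
  have lnt: "ln (cmod (t k)) = ln (cmod (coeff q k)) + real k * ln (cmod w)" if "coeff q k \<noteq> 0" for k
    using that w(2) by (simp add: t_def norm_mult norm_power ln_mult ln_realpow)
  have "ln (cmod (t i)) \<le> ln (cmod (t j))" using le[OF i(1)] ti j(2) M0 by (subst ln_le_cancel_iff) auto
  moreover have "ln (cmod (t j)) - ln (real (degree q) + 1) \<le> ln (cmod (t i))"
  proof -
    have "ln (M / (real (degree q) + 1)) \<le> ln (cmod (t i))" using i(3) M0 ti by simp
    then show ?thesis using M0 j(2) by (simp add: ln_div)
  qed
  moreover have "0 \<le> ln (real (degree q) + 1)" by simp
  ultimately have "\<bar>ln (cmod (t i)) - ln (cmod (t j))\<bar> \<le> ln (real (degree q) + 1)" by linarith
  then show thesis using that[of i j] i j(1) nz lnt by (simp add: I_def)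
qed

section \<open>Approximation of absolute values: algebraic extensions\<close>

lemma slope_near:
  fixes q :: "complex poly"
  assumes q: "q \<noteq> 0" and x: "poly q x = 0" "x \<noteq> 0" and c: "c > 0"
    and \<beta>: "\<And>i. coeff q i \<noteq> 0 \<Longrightarrow> \<bar>c * ln (cmod (coeff q i)) - \<beta> i\<bar> \<le> \<eta>"
  shows "\<exists>i\<le>degree q. \<exists>j\<le>degree q. i \<noteq> j \<and> coeff q i \<noteq> 0 \<and> coeff q j \<noteq> 0 \<and>
    \<bar>c * ln (cmod x) - (\<beta> j - \<beta> i) / (real i - real j)\<bar> \<le> c * ln (real (degree q) + 1) + 2 * \<eta>"
proof -
  obtain i j where ij: "i \<le> degree q" "j \<le> degree q" "i \<noteq> j" "coeff q i \<noteq> 0" "coeff q j \<noteq> 0"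
    and le: "\<bar>(ln (cmod (coeff q i)) + real i * ln (cmod x)) - (ln (cmod (coeff q j)) + real j * ln (cmod x))\<bar>
      \<le> ln (real (degree q) + 1)"
    using root_slope[OF q x] by metis
  define L where "L = ln (cmod x)"
  define E where "E = ln (real (degree q) + 1)"
  define d where "d = real i - real j"
  have d1: "1 \<le> \<bar>d\<bar>" using ij(3) unfolding d_def by linarith
  have "\<bar>c * ((ln (cmod (coeff q i)) + real i * L) - (ln (cmod (coeff q j)) + real j * L))\<bar> \<le> c * E"
    using mult_left_mono[OF le, of c] c by (simp add: abs_mult L_def E_def)
  moreover have "c * ((ln (cmod (coeff q i)) + real i * L) - (ln (cmod (coeff q j)) + real j * L))
    = (c * ln (cmod (coeff q i)) - c * ln (cmod (coeff q j))) + d * (c * L)"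
    by (simp add: d_def algebra_simps)
  ultimately have "\<bar>(\<beta> i - \<beta> j) + d * (c * L)\<bar> \<le> c * E + 2 * \<eta>"
    using \<beta>[OF ij(4)] \<beta>[OF ij(5)] by linarith
  moreover have "(\<beta> i - \<beta> j) + d * (c * L) = d * (c * L - (\<beta> j - \<beta> i) / d)"
    using d1 by (simp add: field_simps)
  ultimately have "\<bar>d\<bar> * \<bar>c * L - (\<beta> j - \<beta> i) / d\<bar> \<le> c * E + 2 * \<eta>" by (simp add: abs_mult)
  moreover have "1 * \<bar>c * L - (\<beta> j - \<beta> i) / d\<bar> \<le> \<bar>d\<bar> * \<bar>c * L - (\<beta> j - \<beta> i) / d\<bar>"
    by (intro mult_right_mono d1) simp
  ultimately have "\<bar>c * L - (\<beta> j - \<beta> i) / d\<bar> \<le> c * E + 2 * \<eta>" by simp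
  then show ?thesis using ij unfolding L_def E_def d_def by blast
qed

text \<open>If there were no root of this size, one coefficient would dominate on the circle of radius
  \<open>exp (\<sigma> / c)\<close>; but two different terms have nearly maximal size there.\<close>

lemma newton_root:
  fixes q :: "complex poly"
  assumes q: "q \<noteq> 0" and c: "c > 0"
    and \<beta>: "\<And>i. coeff q i \<noteq> 0 \<Longrightarrow> \<bar>c * ln (cmod (coeff q i)) - \<beta> i\<bar> \<le> \<eta>"
    and ij: "i \<noteq> j" "coeff q i \<noteq> 0" "coeff q j \<noteq> 0"
    and mi: "\<And>k. coeff q k \<noteq> 0 \<Longrightarrow> \<beta> k + real k * \<sigma> \<le> \<beta> i + real i * \<sigma>"
    and mj: "\<And>k. coeff q k \<noteq> 0 \<Longrightarrow> \<beta> k + real k * \<sigma> \<le> \<beta> j + real j * \<sigma>"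
    and \<kappa>: "\<kappa> > 0" "4 * \<eta> \<le> \<kappa>" "c * ln (2 * 3 ^ degree q) < \<kappa> / 2"
  shows "\<exists>x. poly q x = 0 \<and> x \<noteq> 0 \<and> \<bar>c * ln (cmod x) - \<sigma>\<bar> < \<kappa>"
proof (rule ccontr)
  assume neg: "\<not> ?thesis"
  define R \<delta> where "R = exp (\<sigma> / c)" and "\<delta> = exp (- \<kappa> / c)"
  have R: "R > 0" and \<delta>0: "0 < \<delta>" by (simp_all add: R_def \<delta>_def)
  have "ln (2 * 3 ^ degree q) \<le> \<kappa> / c" using \<kappa> c by (simp add: field_simps)
  then have "exp (ln (2 * 3 ^ degree q)) \<le> exp (\<kappa> / c)" by (subst exp_le_cancel_iff)
  then have "2 * 3 ^ degree q \<le> exp (\<kappa> / c)" by simp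
  then have \<delta>1: "3 ^ degree q * \<delta> \<le> 1 / 2"
    unfolding \<delta>_def by (simp add: exp_minus field_simps)
  have "cmod w \<le> R * \<delta> \<or> R / \<delta> \<le> cmod w" if w: "poly q w = 0" for w
  proof (rule ccontr)
    assume "\<not> ?thesis"
    then have b: "R * \<delta> < cmod w" "cmod w < R / \<delta>" by simp_all
    have w0: "cmod w > 0" using b(1) R \<delta>0 by (smt (verit) mult_pos_pos)
    have "R * \<delta> = exp ((\<sigma> - \<kappa>) / c)" "R / \<delta> = exp ((\<sigma> + \<kappa>) / c)"
      by (simp_all add: R_def \<delta>_def exp_add[symmetric] exp_diff[symmetric] diff_divide_distrib add_divide_distrib)
    then have "exp ((\<sigma> - \<kappa>) / c) < exp (ln (cmod w))" "exp (ln (cmod w)) < exp ((\<sigma> + \<kappa>) / c)"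
      using b w0 by simp_all
    then have "(\<sigma> - \<kappa>) / c < ln (cmod w)" "ln (cmod w) < (\<sigma> + \<kappa>) / c" by simp_all
    then have "\<sigma> - \<kappa> < c * ln (cmod w)" "c * ln (cmod w) < \<sigma> + \<kappa>" using c by (simp_all add: field_simps)
    then have "\<bar>c * ln (cmod w) - \<sigma>\<bar> < \<kappa>" by linarith
    then show False using neg w w0 by auto
  qed
  from dominant_coeff_if_no_root[OF q R \<delta>0 \<delta>1 this] obtain k where k: "coeff q k \<noteq> 0"
    and dom: "\<And>i. i \<noteq> k \<Longrightarrow> cmod (coeff q i) * R ^ i \<le> 2 * 3 ^ degree q * \<delta> * (cmod (coeff q k) * R ^ k)"
    by blast
  define Q where "Q = c * ln (2 * 3 ^ degree q)"
  have "False" if m: "m \<noteq> k" "coeff q m \<noteq> 0" "\<beta> k + real k * \<sigma> \<le> \<beta> m + real m * \<sigma>" for m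
  proof -
    have lnR: "ln (cmod (coeff q i) * R ^ i) = ln (cmod (coeff q i)) + real i * (\<sigma> / c)"
      if "coeff q i \<noteq> 0" for i
      using that R by (simp add: ln_mult ln_realpow R_def)
    have "ln (cmod (coeff q m) * R ^ m) \<le> ln (2 * 3 ^ degree q * \<delta> * (cmod (coeff q k) * R ^ k))"
      using dom[OF m(1)] m(2) k R \<delta>0 by (subst ln_le_cancel_iff) auto
    also have "\<dots> = ln (2 * 3 ^ degree q) + (- \<kappa> / c) + ln (cmod (coeff q k) * R ^ k)"
      using k R by (simp add: ln_mult \<delta>_def)
    finally have "ln (cmod (coeff q m)) + real m * (\<sigma> / c)
      \<le> ln (2 * 3 ^ degree q) - \<kappa> / c + (ln (cmod (coeff q k)) + real k * (\<sigma> / c))"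
      unfolding lnR[OF m(2)] lnR[OF k] by simp
    from mult_left_mono[OF this, of c] c
    have "c * ln (cmod (coeff q m)) + real m * \<sigma> \<le> Q - \<kappa> + (c * ln (cmod (coeff q k)) + real k * \<sigma>)"
      by (simp add: Q_def algebra_simps)
    then show False using \<beta>[OF m(2)] \<beta>[OF k] m(3) \<kappa> unfolding Q_def[symmetric] by linarith
  qed
  then show False using ij mi[OF k] mj[OF k] by metis
qed

text \<open>The powers of a sufficiently general natural number serve as weights: each of the finitely many nonzero vectors \<open>s - v\<close>
  excludes the finitely many roots of a polynomial.\<close>

lemma separating_weights:
  fixes S :: "('a \<Rightarrow> real) set" and v :: "'a \<Rightarrow> real"
  assumes G: "finite G" and S: "finite S"
  obtains e :: "'a \<Rightarrow> nat" where "\<And>s. s \<in> S \<Longrightarrow> \<exists>g\<in>G. s g \<noteq> v g \<Longrightarrow> (\<Sum>g\<in>G. real (e g) * (s g - v g)) \<noteq> 0"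
proof -
  obtain idx :: "'a \<Rightarrow> nat" where idx: "inj_on idx G"
    using finite_imp_inj_to_nat_seg[OF G] by blast
  define P where "P s = (\<Sum>g\<in>G. monom (s g - v g) (idx g))" for s
  have cP: "coeff (P s) (idx g) = s g - v g" if g: "g \<in> G" for s g
  proof -
    have "coeff (P s) (idx g) = (\<Sum>h\<in>G. if idx h = idx g then s h - v h else 0)"
      by (simp add: P_def coeff_sum)
    also have "\<dots> = (\<Sum>h\<in>G. if h = g then s h - v h else 0)"
      by (rule sum.cong) (use idx g in \<open>auto simp: inj_on_def\<close>)
    also have "\<dots> = s g - v g" using G g by simp
    finally show ?thesis .
  qed
  define Xs where "Xs = (\<Union>s\<in>{s \<in> S. P s \<noteq> 0}. {x. poly (P s) x = 0})"
  have "finite Xs" unfolding Xs_def using S by (intro finite_UN_I poly_roots_finite) auto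
  then have "finite (real -` Xs)" by (intro finite_vimageI) (auto simp: inj_on_def)
  then obtain M :: nat where M: "M \<notin> real -` Xs" using infinite_UNIV_nat by (metis UNIV_I finite_subset subsetI)
  have "(\<Sum>g\<in>G. real (M ^ idx g) * (s g - v g)) \<noteq> 0" if s: "s \<in> S" and ne: "\<exists>g\<in>G. s g \<noteq> v g" for s
  proof -
    from ne obtain g where "g \<in> G" "s g \<noteq> v g" by blast
    then have "coeff (P s) (idx g) \<noteq> 0" using cP by simp
    then have "P s \<noteq> 0" by auto
    then have "poly (P s) (real M) \<noteq> 0" using M s unfolding Xs_def by auto
    then show ?thesis by (simp add: P_def poly_sum poly_monom mult.commute)
  qed
  then show thesis by (rule that[of "\<lambda>g. M ^ idx g"])
qed

text \<open>Every nonarchimedean absolute value on \<open>B\<close> which is trivial on \<open>K\<close> is, on finite sets, a limit of small powers of the usual absolute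
  value, pulled back along embeddings over \<open>K\<close>. The bound \<open>c\<^sub>0\<close> makes bounded factors
  negligible.\<close>

definition approximable :: "complex set \<Rightarrow> complex set \<Rightarrow> bool" where
  "approximable K B \<longleftrightarrow> (\<forall>\<nu> G \<epsilon> c\<^sub>0. abs_value K B \<nu> \<longrightarrow> finite G \<longrightarrow> G \<subseteq> B - {0} \<longrightarrow> 0 < \<epsilon> \<longrightarrow> 0 < c\<^sub>0 \<longrightarrow>
     (\<exists>c D. 0 < c \<and> c < c\<^sub>0 \<and> partial_hom {0} D \<and> fst ` D = B \<and> Id_on K \<subseteq> D \<and>
       (\<forall>g x. (g, x) \<in> D \<longrightarrow> g \<in> G \<longrightarrow> \<bar>c * ln (cmod x) - ln (\<nu> g)\<bar> < \<epsilon>)))"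

lemma approximableD:
  assumes "approximable K B" "abs_value K B \<nu>" "finite G" "G \<subseteq> B - {0}" "0 < \<epsilon>" "0 < c\<^sub>0"
  obtains c D where "0 < c" "c < c\<^sub>0" "partial_hom {0} D" "fst ` D = B" "Id_on K \<subseteq> D"
    "\<And>g x. (g, x) \<in> D \<Longrightarrow> g \<in> G \<Longrightarrow> \<bar>c * ln (cmod x) - ln (\<nu> g)\<bar> < \<epsilon>"
  using assms unfolding approximable_def by metis

lemma small_scale:
  fixes \<theta> :: real assumes "finite F" "0 < \<theta>"
  obtains c\<^sub>0 where "0 < c\<^sub>0" "\<And>c f. 0 < c \<Longrightarrow> c < c\<^sub>0 \<Longrightarrow> f \<in> F \<Longrightarrow> c * \<bar>h f\<bar> < \<theta>"
proof -
  define m where "m = 1 + (\<Sum>f\<in>F. \<bar>h f\<bar>)"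
  have m: "m > 0" "\<And>f. f \<in> F \<Longrightarrow> \<bar>h f\<bar> \<le> m"
  proof -
    have "0 \<le> (\<Sum>f\<in>F. \<bar>h f\<bar>)" by (rule sum_nonneg) simp
    then show "m > 0" unfolding m_def by linarith
    show "\<bar>h f\<bar> \<le> m" if "f \<in> F" for f
      using member_le_sum[OF that, of "\<lambda>f. \<bar>h f\<bar>"] assms(1) by (simp add: m_def)
  qed
  show thesis
  proof
    show "0 < \<theta> / m" using assms m by simp
    fix c f assume c: "0 < c" "c < \<theta> / m" "f \<in> F"
    have "c * \<bar>h f\<bar> \<le> c * m" using c m by (intro mult_left_mono) auto
    also have "\<dots> < \<theta>" using c m(1) by (simp add: field_simps)
    finally show "c * \<bar>h f\<bar> < \<theta>" .
  qed
qed

text \<open>An absolute value that is trivial on \<open>K\<close> is the limit of the powers with exponents tending to \<open>0\<close>, along the identity.\<close>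

lemma approximable_base: assumes K: "subring_set K" shows "approximable K K"
  unfolding approximable_def
proof (intro allI impI)
  fix \<nu> G and \<epsilon> c\<^sub>0 :: real
  assume \<nu>: "abs_value K K \<nu>" and G: "finite G" "G \<subseteq> K - {0}" and \<epsilon>: "0 < \<epsilon>" and c0: "0 < c\<^sub>0"
  obtain c1 where c1: "0 < c1" "\<And>c g. 0 < c \<Longrightarrow> c < c1 \<Longrightarrow> g \<in> G \<Longrightarrow> c * \<bar>ln (cmod g)\<bar> < \<epsilon>"
    using small_scale[OF G(1) \<epsilon>, of "\<lambda>g. ln (cmod g)"] by metis
  define c where "c = min c1 c\<^sub>0 / 2"
  have c: "0 < c" "c < c1" "c < c\<^sub>0" using c1(1) c0 by (auto simp: c_def)
  have "\<bar>c * ln (cmod g) - ln (\<nu> g)\<bar> < \<epsilon>" if "g \<in> G" for g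
  proof -
    have "\<nu> g = 1" using \<nu> G(2) that by (auto simp: abs_value_def)
    then show ?thesis using c1(2)[OF c(1,2) that] c(1) by (simp add: abs_mult)
  qed
  then show "\<exists>c D. 0 < c \<and> c < c\<^sub>0 \<and> partial_hom {0} D \<and> fst ` D = K \<and> Id_on K \<subseteq> D \<and>
       (\<forall>g x. (g, x) \<in> D \<longrightarrow> g \<in> G \<longrightarrow> \<bar>c * ln (cmod x) - ln (\<nu> g)\<bar> < \<epsilon>)"
    using c partial_hom_Id[OF K]
    by (intro exI[of _ c] exI[of _ "Id_on K"]) (auto simp: Id_on_def image_UN)
qed

lemma hom_graph_zero:
  assumes "subring_set A" "partial_hom {0} D" "fst ` D \<subseteq> A"
  shows "hom_graph A ({0} :: complex set) D"
  using assms prime_zero by (simp add: hom_graph_def)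

lemma (in hom_graph) pair_poly_support:
  assumes "Z = {0}" "pair_poly D p q"
  shows "coeff q i = 0 \<longleftrightarrow> coeff p i = 0" "degree q = degree p" "q = 0 \<longleftrightarrow> p = 0"
proof -
  show 1: "coeff q i = 0 \<longleftrightarrow> coeff p i = 0" for i
    using ker_D[OF pp_coeff[OF assms(2)]] assms(1) by simp
  show 2: "degree q = degree p"
    by (rule antisym; rule degree_le) (use 1 in \<open>simp add: coeff_eq_0\<close>, use 1 in \<open>metis coeff_eq_0\<close>)
  show "q = 0 \<longleftrightarrow> p = 0" using 1 by (simp add: poly_eq_iff)
qed

lemma abs_value_subset:
  assumes "abs_value K C \<nu>" "B \<subseteq> C" shows "abs_value K B \<nu>"
proof -
  have "mult_seminorm B \<nu>" using assms unfolding abs_value_def mult_seminorm_def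
    by (simp add: subset_iff)
  then show ?thesis using assms unfolding abs_value_def by (simp add: subset_iff)
qed

text \<open>The embedding found for \<open>B\<close> has several extensions to the ring generated by \<open>z\<close>, of which the right one has to be
  chosen simultaneously for all elements of \<open>G\<close>. This is reduced to a single element \<open>w\<close>, whose image
  can be chosen among the roots of the image of its minimal polynomial.\<close>

lemma approximable_algebraic:
  assumes B: "subring_set B" and cB: "countable B" and KB: "K \<subseteq> B" and z: "algebraic_over B z"
    and ap: "approximable K B"
  shows "approximable K (poly_ring B z)"
  unfolding approximable_def
proof (intro allI impI)
  fix \<nu> G and \<epsilon> c\<^sub>0 :: real
  let ?B' = "poly_ring B z"
  assume av: "abs_value K ?B' \<nu>" and G: "finite G" "G \<subseteq> ?B' - {0}" and \<epsilon>: "0 < \<epsilon>" and c0: "0 < c\<^sub>0"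
  have B': "subring_set ?B'" by (rule poly_ring_subring[OF B])
  have BB': "B \<subseteq> ?B'" using poly_ring_base[OF B] by blast
  interpret mult_seminormed ?B' \<nu> using B' av by unfold_locales (auto simp: abs_value_def)
  have pos: "0 < \<nu> b" if "b \<in> ?B'" "b \<noteq> 0" for b using av that by (simp add: abs_value_def)
  have GB: "g \<in> ?B'" "g \<noteq> 0" if "g \<in> G" for g using G that by auto
  define v where "v g = ln (\<nu> g)" for g
  \<comment> \<open>The image of \<open>g\<close> will be a root of the image of \<open>h g\<close>, so its logarithm, scaled by \<open>c\<close>, is close to
    a slope of the Newton polygon of \<open>h g\<close>: \<open>S\<close> contains all tuples of such slopes.\<close>
  have "\<forall>g\<in>G. \<exists>h. h \<noteq> 0 \<and> (\<forall>i. coeff h i \<in> B) \<and> poly h g = 0"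
    using algebraic_poly_ring[OF B cB z GB(1)] unfolding algebraic_over_def by blast
  then obtain h where h: "\<And>g. g \<in> G \<Longrightarrow> h g \<noteq> 0" "\<And>g i. g \<in> G \<Longrightarrow> coeff (h g) i \<in> B"
    "\<And>g. g \<in> G \<Longrightarrow> poly (h g) g = 0" by metis
  define slope where "slope g = (\<lambda>(i, j). (ln (\<nu> (coeff (h g) j)) - ln (\<nu> (coeff (h g) i))) / (real i - real j))" for g
  define S where "S = PiE G (\<lambda>g. slope g ` ({..degree (h g)} \<times> {..degree (h g)}))"
  have finS: "finite S" unfolding S_def by (intro finite_PiE G(1)) auto
  obtain e where e: "\<And>s. s \<in> S \<Longrightarrow> \<exists>g\<in>G. s g \<noteq> v g \<Longrightarrow> (\<Sum>g\<in>G. real (e g) * (s g - v g)) \<noteq> 0"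
    using separating_weights[OF G(1) finS, of v] by metis
  define gap where "gap = Min (insert 1 ((\<lambda>s. \<bar>\<Sum>g\<in>G. real (e g) * (s g - v g)\<bar>) ` {s \<in> S. \<exists>g\<in>G. s g \<noteq> v g}))"
  have gap0: "0 < gap" unfolding gap_def using finS e by (subst Min_gr_iff) auto
  have gap: "gap \<le> \<bar>\<Sum>g\<in>G. real (e g) * (s g - v g)\<bar>" if "s \<in> S" "\<exists>g\<in>G. s g \<noteq> v g" for s
    unfolding gap_def using finS that by (intro Min_le) auto
  \<comment> \<open>If the image of \<open>w\<close> has nearly the right size, then among the tuples in \<open>S\<close> only \<open>v\<close> itself can be
    close to the logarithms of the images of \<open>G\<close>, since \<open>w\<close> distinguishes \<open>v\<close> from the others by at least \<open>gap\<close>.\<close>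
  define w where "w = (\<Prod>g\<in>G. g ^ e g)"
  have wB: "w \<in> ?B'" unfolding w_def by (intro subring_set_prod[OF B'] subring_set_power[OF B'] GB)
  have w0: "w \<noteq> 0" unfolding w_def using G by auto
  define \<sigma> where "\<sigma> = (\<Sum>g\<in>G. real (e g) * v g)"
  have lnw: "ln (\<nu> w) = \<sigma>"
  proof -
    have "\<nu> w = (\<Prod>g\<in>G. \<nu> g ^ e g)"
      unfolding w_def by (subst \<nu>_prod) (auto intro: subring_set_power[OF B'] GB simp: \<nu>_power[OF GB(1)])
    also have "ln \<dots> = (\<Sum>g\<in>G. ln (\<nu> g ^ e g))" by (rule ln_prod) (use G(1) in simp, metis pos GB less_irrefl zero_less_power)
    also have "\<dots> = \<sigma>" unfolding \<sigma>_def v_def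
      by (intro sum.cong refl ln_realpow pos GB)
    finally show ?thesis .
  qed
  define P where "P p \<longleftrightarrow> p \<noteq> 0 \<and> (\<forall>i. coeff p i \<in> B) \<and> poly p w = 0" for p
  have "\<exists>p. P p" using algebraic_poly_ring[OF B cB z wB] unfolding algebraic_over_def P_def .
  then obtain p0 where "P p0" ..
  from ex_has_least_nat[of P, OF this, of degree]
  obtain m where mP: "P m" and least: "\<And>p. P p \<Longrightarrow> degree m \<le> degree p" by blast
  have m: "m \<noteq> 0" "\<And>i. coeff m i \<in> B" "poly m w = 0" using mP by (auto simp: P_def)
  define \<beta> where "\<beta> i = ln (\<nu> (coeff m i))" for i
  define I where "I = {i. i \<le> degree m \<and> coeff m i \<noteq> 0}"
  have finI: "finite I" unfolding I_def by simp
  have I0: "I \<noteq> {}" unfolding I_def using m(1) leading_coeff_0_iff by blast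
  have coI: "k \<in> I" if "coeff m k \<noteq> 0" for k unfolding I_def using that le_degree by simp
  define t where "t i = coeff m i * w ^ i" for i
  have tB: "t i \<in> ?B'" for i unfolding t_def using m(2) BB' by (intro sub(4) subring_set_power[OF B'] wB) auto
  have t\<nu>: "\<nu> (t i) > 0" "ln (\<nu> (t i)) = \<beta> i + real i * \<sigma>" if "i \<in> I" for i
  proof -
    have ci: "coeff m i \<in> ?B'" "coeff m i \<noteq> 0" using that m(2) BB' by (auto simp: I_def)
    have "\<nu> (t i) = \<nu> (coeff m i) * \<nu> w ^ i"
      unfolding t_def by (simp add: sn(4)[OF ci(1) subring_set_power[OF B' wB]] \<nu>_power[OF wB])
    then show "\<nu> (t i) > 0" "ln (\<nu> (t i)) = \<beta> i + real i * \<sigma>"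
      using pos[OF ci] pos[OF wB w0] lnw by (simp_all add: ln_mult ln_realpow \<beta>_def)
  qed
  have "Max ((\<lambda>i. \<nu> (t i)) ` I) \<in> (\<lambda>i. \<nu> (t i)) ` I" using finI I0 by (intro Max_in) auto
  then obtain i0 where i0: "i0 \<in> I" "Max ((\<lambda>i. \<nu> (t i)) ` I) = \<nu> (t i0)" by auto
  have mx: "\<nu> (t k) \<le> \<nu> (t i0)" if "k \<in> I" for k
    using Max_ge[of "(\<lambda>i. \<nu> (t i)) ` I" "\<nu> (t k)"] finI that unfolding i0(2) by auto
  have "(\<Sum>i\<in>I. t i) = (\<Sum>i\<le>degree m. t i)"
    by (rule sum.mono_neutral_left) (auto simp: I_def t_def)
  also have "\<dots> = 0" using m(3) by (simp add: poly_altdef t_def)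
  finally have sum0: "(\<Sum>i\<in>I. t i) = 0" .
  from max_attained_twice[OF finI tB sum0 i0(1) t\<nu>(1)[OF i0(1)]]
  obtain j0 where j0: "j0 \<in> I" "j0 \<noteq> i0" "\<nu> (t i0) \<le> \<nu> (t j0)" by blast
  have lnle: "\<beta> k + real k * \<sigma> \<le> \<beta> j + real j * \<sigma>" if "k \<in> I" "j \<in> I" "\<nu> (t k) \<le> \<nu> (t j)" for k j
  proof -
    have "ln (\<nu> (t k)) \<le> ln (\<nu> (t j))" using that t\<nu>(1)[OF that(1)] t\<nu>(1)[OF that(2)] by simp
    then show ?thesis using t\<nu>(2)[OF that(1)] t\<nu>(2)[OF that(2)] by simp
  qed
  \<comment> \<open>An error \<open>\<theta>\<close> in the logarithms of the elements of \<open>G\<close> is an error \<open>E * \<theta>\<close> in that of \<open>w\<close>; together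
    with the error \<open>\<kappa>\<close> of the root it has to stay below \<open>gap\<close>.\<close>
  define E where "E = (\<Sum>g\<in>G. real (e g))"
  have E0: "0 \<le> E" unfolding E_def by (rule sum_nonneg) simp
  define \<theta> where "\<theta> = min \<epsilon> (gap / (2 * (E + 1)))"
  have \<theta>0: "0 < \<theta>" unfolding \<theta>_def using \<epsilon> gap0 E0 by simp
  have "\<theta> \<le> gap / (2 * (E + 1))" by (simp add: \<theta>_def)
  then have "\<theta> * (2 * (E + 1)) \<le> gap" using E0 by (simp add: pos_le_divide_eq)
  then have E\<theta>: "E * \<theta> < gap / 2" using \<theta>0 by (simp add: algebra_simps)
  define \<kappa> where "\<kappa> = gap / 2"
  have \<kappa>0: "0 < \<kappa>" using gap0 by (simp add: \<kappa>_def)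
  define \<eta> where "\<eta> = min (\<theta> / 4) (\<kappa> / 4)"
  have \<eta>: "0 < \<eta>" "4 * \<eta> \<le> \<theta>" "4 * \<eta> \<le> \<kappa>" using \<theta>0 \<kappa>0 by (auto simp: \<eta>_def)
  obtain c1 where c1: "0 < c1" "\<And>c g. 0 < c \<Longrightarrow> c < c1 \<Longrightarrow> g \<in> G \<Longrightarrow> c * \<bar>ln (real (degree (h g)) + 1)\<bar> < \<theta> / 2"
    using small_scale[OF G(1), of "\<theta> / 2" "\<lambda>g. ln (real (degree (h g)) + 1)"] \<theta>0 by auto
  obtain c2 where c2: "0 < c2" "\<And>c. 0 < c \<Longrightarrow> c < c2 \<Longrightarrow> c * \<bar>ln (2 * 3 ^ degree m)\<bar> < \<kappa> / 2"
    using small_scale[of "{()}" "\<kappa> / 2" "\<lambda>_. ln (2 * 3 ^ degree m)"] \<kappa>0 by auto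
  define GE where "GE = ((\<Union>g\<in>G. coeff (h g) ` {..degree (h g)}) \<union> coeff m ` {..degree m}) - {0}"
  have GE: "finite GE" "GE \<subseteq> B - {0}" unfolding GE_def using G(1) h(2) m(2) by auto
  have cGE: "coeff (h g) i \<in> GE" if "g \<in> G" "coeff (h g) i \<noteq> 0" for g i
    unfolding GE_def using that le_degree by auto
  have cmGE: "coeff m i \<in> GE" if "coeff m i \<noteq> 0" for i
    unfolding GE_def using that le_degree[OF that] by (intro DiffI UnI2 image_eqI[OF refl]) auto
  have avB: "abs_value K B \<nu>" by (rule abs_value_subset[OF av BB'])
  have "0 < min c\<^sub>0 (min c1 c2)" using c0 c1(1) c2(1) by simp
  from approximableD[OF ap avB GE \<eta>(1) this] obtain c D where
    cc: "0 < c" "c < min c\<^sub>0 (min c1 c2)" and D: "partial_hom {0} D" "fst ` D = B" "Id_on K \<subseteq> D"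
    and close: "\<And>g x. (g, x) \<in> D \<Longrightarrow> g \<in> GE \<Longrightarrow> \<bar>c * ln (cmod x) - ln (\<nu> g)\<bar> < \<eta>" by blast
  interpret D: hom_graph ?B' "{0}" D by (rule hom_graph_zero[OF B' D(1)]) (use D(2) BB' in simp)
  \<comment> \<open>By \<open>max_attained_twice\<close> two terms of the equation \<open>poly m w = 0\<close> are maximal, so \<open>\<sigma>\<close> is a
    slope of the Newton polygon and some root of the image \<open>q\<close> has this size.\<close>
  obtain q where q: "pair_poly D m q" using D.pp_exists[of m] m(2) D(2) by auto
  note qm = D.pair_poly_support[OF refl q]
  have q0: "q \<noteq> 0" using qm(3) m(1) by simp
  have near: "\<bar>c * ln (cmod (coeff q i)) - \<beta> i\<bar> \<le> \<eta>" if "coeff q i \<noteq> 0" for i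
    using close[OF D.pp_coeff[OF q, of i] cmGE] qm(1)[of i] that unfolding \<beta>_def by force
  have "\<exists>x. poly q x = 0 \<and> x \<noteq> 0 \<and> \<bar>c * ln (cmod x) - \<sigma>\<bar> < \<kappa>"
  proof (rule newton_root[OF q0 cc(1) near])
    show "j0 \<noteq> i0" "coeff q j0 \<noteq> 0" "coeff q i0 \<noteq> 0" using i0 j0 qm(1) by (auto simp: I_def)
    show "\<beta> k + real k * \<sigma> \<le> \<beta> i0 + real i0 * \<sigma>" if "coeff q k \<noteq> 0" for k
      using that qm(1)[of k] by (intro lnle mx coI i0(1)) auto
    show "\<beta> k + real k * \<sigma> \<le> \<beta> j0 + real j0 * \<sigma>" if "coeff q k \<noteq> 0" for k
      using that qm(1)[of k] by (intro lnle order_trans[OF mx j0(3)] coI j0(1)) auto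
    have "c * ln (2 * 3 ^ degree m) \<le> c * \<bar>ln (2 * 3 ^ degree m)\<bar>"
      using cc(1) by (intro mult_left_mono) auto
    also have "\<dots> < \<kappa> / 2" using c2(2)[of c] cc by simp
    finally show "c * ln (2 * 3 ^ degree q) < \<kappa> / 2" by (simp add: qm(2))
  qed (use \<kappa>0 \<eta> in auto)
  then obtain w' where w': "poly q w' = 0" "w' \<noteq> 0" "\<bar>c * ln (cmod w') - \<sigma>\<bar> < \<kappa>" by blast
  have "partial_hom {0} (adjoin D w w')"
  proof (rule D.adjoin_algebraic[OF wB q q0 _ _ w'(1)])
    show "poly m w \<in> {0}" using m(3) by simp
    fix a b assume ab: "pair_poly D a b" "poly a w \<in> {0}" "b \<noteq> 0"
    note sup = D.pair_poly_support[OF refl ab(1)]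
    have "coeff a i \<in> B" for i
      using D.pp_coeff[OF ab(1), of i] D(2) by (metis fst_conv image_eqI)
    then have "P a" using ab sup(3) by (simp add: P_def)
    from least[OF this] show "degree q \<le> degree b" using qm(2) sup(2) by simp
  qed
  from extend_partial_hom[OF B' poly_ring_countable[OF cB] prime_zero this D.dom_adjoin[OF wB]]
  obtain D2 where D2: "adjoin D w w' \<subseteq> D2" "partial_hom {0} D2" "fst ` D2 = ?B'" .
  interpret D2: hom_graph ?B' "{0}" D2 by (rule hom_graph_zero[OF B' D2(2)]) (use D2(3) in simp)
  have DD2: "D \<subseteq> D2" using D.sub_adjoin D2(1) by (rule subset_trans)
  have ww: "(w, w') \<in> D2" using D.in_adjoin[of w w'] D2(1) by auto
  have "\<forall>g\<in>G. \<exists>x. (g, x) \<in> D2"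
  proof
    fix g assume "g \<in> G"
    then have "g \<in> fst ` D2" using GB(1) D2(3) by simp
    then show "\<exists>x. (g, x) \<in> D2" by auto
  qed
  then obtain \<phi> where \<phi>: "\<And>g. g \<in> G \<Longrightarrow> (g, \<phi> g) \<in> D2" by metis
  have \<phi>0: "\<phi> g \<noteq> 0" if "g \<in> G" for g using D2.ker_D[OF \<phi>[OF that]] GB(2)[OF that] by simp
  have "(w, \<Prod>g\<in>G. \<phi> g ^ e g) \<in> D2" unfolding w_def by (intro D2.prod_D D2.power_D \<phi>)
  then have w'eq: "w' = (\<Prod>g\<in>G. \<phi> g ^ e g)" using ww D2.fun_D by blast
  have lnw': "c * ln (cmod w') = (\<Sum>g\<in>G. real (e g) * (c * ln (cmod (\<phi> g))))"
  proof -
    have "cmod w' = (\<Prod>g\<in>G. cmod (\<phi> g) ^ e g)" unfolding w'eq by (simp add: prod_norm[symmetric] norm_power)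
    also have "ln \<dots> = (\<Sum>g\<in>G. ln (cmod (\<phi> g) ^ e g))" by (rule ln_prod) (use G(1) \<phi>0 in auto)
    also have "\<dots> = (\<Sum>g\<in>G. real (e g) * ln (cmod (\<phi> g)))"
      by (intro sum.cong refl ln_realpow)
    finally show ?thesis by (simp add: sum_distrib_left mult_ac)
  qed
  have "\<exists>s\<in>slope g ` ({..degree (h g)} \<times> {..degree (h g)}). \<bar>c * ln (cmod (\<phi> g)) - s\<bar> < \<theta>" if g: "g \<in> G" for g
  proof -
    obtain r where r: "pair_poly D (h g) r" using D.pp_exists[of "h g"] h(2)[OF g] D(2) by auto
    note rh = D.pair_poly_support[OF refl r]
    have r2: "pair_poly D2 (h g) r" using r DD2 unfolding pair_poly_def by blast
    have "(poly (h g) g, poly r (\<phi> g)) \<in> D2" by (rule D2.poly_D[OF r2 \<phi>[OF g]])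
    then have r0: "poly r (\<phi> g) = 0" using D2.ker_D h(3)[OF g] by simp
    have "r \<noteq> 0" using rh(3) h(1)[OF g] by simp
    from slope_near[OF this r0 \<phi>0[OF g] cc(1), of "\<lambda>i. ln (\<nu> (coeff (h g) i))" \<eta>]
    have "\<exists>i\<le>degree r. \<exists>j\<le>degree r. i \<noteq> j \<and> coeff r i \<noteq> 0 \<and> coeff r j \<noteq> 0 \<and>
      \<bar>c * ln (cmod (\<phi> g)) - slope g (i, j)\<bar> \<le> c * ln (real (degree r) + 1) + 2 * \<eta>"
      unfolding slope_def using close[OF D.pp_coeff[OF r] cGE[OF g]] rh(1) by (simp add: less_imp_le)
    then obtain i j where "i \<le> degree (h g)" "j \<le> degree (h g)"
      and le: "\<bar>c * ln (cmod (\<phi> g)) - slope g (i, j)\<bar> \<le> c * ln (real (degree (h g)) + 1) + 2 * \<eta>"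
      unfolding rh(2) by blast
    moreover have "c * ln (real (degree (h g)) + 1) < \<theta> / 2" using c1(2)[of c g] cc g by simp
    ultimately show ?thesis using \<eta>(2) by (intro bexI[of _ "slope g (i, j)"]) auto
  qed
  then obtain s0 where s0: "\<And>g. g \<in> G \<Longrightarrow> s0 g \<in> slope g ` ({..degree (h g)} \<times> {..degree (h g)})"
    "\<And>g. g \<in> G \<Longrightarrow> \<bar>c * ln (cmod (\<phi> g)) - s0 g\<bar> < \<theta>" by metis
  define s where "s = restrict s0 G"
  have sS: "s \<in> S" unfolding s_def S_def using s0(1) by auto
  have sv: "s g = v g" if "g \<in> G" for g
  proof (rule ccontr)
    assume "s g \<noteq> v g"
    then have "gap \<le> \<bar>\<Sum>g\<in>G. real (e g) * (s g - v g)\<bar>" using that by (intro gap sS) blast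
    also have "(\<Sum>g\<in>G. real (e g) * (s g - v g))
      = (c * ln (cmod w') - \<sigma>) - (\<Sum>g\<in>G. real (e g) * (c * ln (cmod (\<phi> g)) - s g))"
      unfolding lnw' \<sigma>_def by (simp add: sum_subtractf[symmetric] algebra_simps)
    also have "\<bar>\<dots>\<bar> \<le> \<bar>c * ln (cmod w') - \<sigma>\<bar> + \<bar>\<Sum>g\<in>G. real (e g) * (c * ln (cmod (\<phi> g)) - s g)\<bar>"
      by (rule abs_triangle_ineq4)
    also have "\<bar>\<Sum>g\<in>G. real (e g) * (c * ln (cmod (\<phi> g)) - s g)\<bar> \<le> (\<Sum>g\<in>G. real (e g) * \<theta>)"
    proof (rule sum_abs[THEN order_trans], rule sum_mono)
      fix g assume g: "g \<in> G"
      show "\<bar>real (e g) * (c * ln (cmod (\<phi> g)) - s g)\<bar> \<le> real (e g) * \<theta>"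
        using s0(2)[OF g] g by (simp add: abs_mult s_def mult_left_mono)
    qed
    also have "\<dots> = E * \<theta>" by (simp add: E_def sum_distrib_right)
    finally show False using w'(3) E\<theta> unfolding \<kappa>_def by linarith
  qed
  have fin: "\<bar>c * ln (cmod x) - ln (\<nu> g)\<bar> < \<epsilon>" if gx: "(g, x) \<in> D2" "g \<in> G" for g x
  proof -
    have x: "x = \<phi> g" using D2.fun_D[OF gx(1) \<phi>[OF gx(2)]] .
    have "s0 g = ln (\<nu> g)" using sv[OF gx(2)] gx(2) by (simp add: s_def v_def)
    then show ?thesis using s0(2)[OF gx(2)] unfolding x \<theta>_def by simp
  qed
  have "Id_on K \<subseteq> D2" using D(3) DD2 by (rule subset_trans)
  then show "\<exists>c D. 0 < c \<and> c < c\<^sub>0 \<and> partial_hom {0} D \<and> fst ` D = ?B' \<and> Id_on K \<subseteq> D \<and>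
       (\<forall>g x. (g, x) \<in> D \<longrightarrow> g \<in> G \<longrightarrow> \<bar>c * ln (cmod x) - ln (\<nu> g)\<bar> < \<epsilon>)"
    using cc D2(2,3) fin by (intro exI[of _ c] exI[of _ D2] conjI) auto
qed

section \<open>Approximation of absolute values: finitely generated rings\<close>

definition adjoin_list :: "complex list \<Rightarrow> complex set \<Rightarrow> complex set" where
  "adjoin_list as B = foldr (\<lambda>a C. poly_ring C a) as B"

lemma adjoin_list_simps: "adjoin_list [] B = B"
  "adjoin_list (a # as) B = poly_ring (adjoin_list as B) a"
  by (simp_all add: adjoin_list_def)

lemma adjoin_list_subring: "subring_set B \<Longrightarrow> subring_set (adjoin_list as B)"
  by (induction as) (simp_all add: adjoin_list_simps poly_ring_subring)

lemma adjoin_list_countable: "countable B \<Longrightarrow> countable (adjoin_list as B)"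
  by (induction as) (simp_all add: adjoin_list_simps poly_ring_countable)

lemma adjoin_list_base: assumes "subring_set B" shows "B \<subseteq> adjoin_list as B"
proof (induction as)
  case (Cons a as)
  then show ?case using poly_ring_base[OF adjoin_list_subring[OF assms]] by (auto simp: adjoin_list_simps)
qed (simp add: adjoin_list_simps)

lemma adjoin_list_gen: assumes "subring_set B" shows "set as \<subseteq> adjoin_list as B"
proof (induction as)
  case (Cons a as)
  then show ?case
    using poly_ring_base[OF adjoin_list_subring[OF assms]] poly_ring_gen[OF adjoin_list_subring[OF assms]]
    by (auto simp: adjoin_list_simps)
qed simp

lemma adjoin_list_mono: "B \<subseteq> C \<Longrightarrow> adjoin_list as B \<subseteq> adjoin_list as C"
proof (induction as)
  case (Cons a as)
  then have "adjoin_list as B \<subseteq> adjoin_list as C" by simp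
  then show ?case unfolding adjoin_list_simps poly_ring_def by blast
qed (simp add: adjoin_list_simps)

lemma algebraic_adjoin_list:
  assumes B: "subring_set B" "countable B"
  shows "(\<And>a. a \<in> set as \<Longrightarrow> algebraic_over B a) \<Longrightarrow> algebraic_over (adjoin_list as B) g \<Longrightarrow> algebraic_over B g"
proof (induction as)
  case (Cons a as)
  have "algebraic_over B a" using Cons.prems(1) by simp
  then have a: "algebraic_over (adjoin_list as B) a"
    by (rule algebraic_over_mono[OF _ adjoin_list_base[OF B(1)]])
  have "algebraic_over (adjoin_list as B) g"
    using Cons.prems(2) unfolding adjoin_list_simps
    by (rule algebraic_trans[OF adjoin_list_subring[OF B(1)] adjoin_list_countable[OF B(2)] a])
  then show ?case by (intro Cons.IH) (use Cons.prems(1) in auto)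
qed (simp add: adjoin_list_simps)

lemma approximable_adjoin_list:
  assumes B: "subring_set B" "countable B" "K \<subseteq> B" and ap: "approximable K B"
  shows "(\<And>a. a \<in> set as \<Longrightarrow> algebraic_over B a) \<Longrightarrow> approximable K (adjoin_list as B)"
proof (induction as)
  case Nil
  then show ?case using ap by (simp add: adjoin_list_simps)
next
  case (Cons a as)
  have "algebraic_over B a" using Cons.prems by simp
  then have a: "algebraic_over (adjoin_list as B) a"
    by (rule algebraic_over_mono[OF _ adjoin_list_base[OF B(1)]])
  have "K \<subseteq> adjoin_list as B" using B(3) adjoin_list_base[OF B(1)] by (rule subset_trans)
  moreover have "approximable K (adjoin_list as B)" by (rule Cons.IH) (use Cons.prems in simp)
  ultimately show ?case unfolding adjoin_list_simps
    by (intro approximable_algebraic adjoin_list_subring adjoin_list_countable B a)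
qed

lemma abs_value_adjoin_list:
  assumes B: "subring_set B" "countable B" "K \<subseteq> B" and av: "abs_value K B \<nu>"
  shows "(\<And>a. a \<in> set as \<Longrightarrow> algebraic_over B a) \<Longrightarrow>
    \<exists>\<mu>. abs_value K (adjoin_list as B) \<mu> \<and> (\<forall>b\<in>B. \<mu> b = \<nu> b)"
proof (induction as)
  case Nil
  then show ?case using av by (auto simp: adjoin_list_simps)
next
  case (Cons a as)
  have "\<exists>\<mu>. abs_value K (adjoin_list as B) \<mu> \<and> (\<forall>b\<in>B. \<mu> b = \<nu> b)"
    by (rule Cons.IH) (use Cons.prems in simp)
  then obtain \<mu> where \<mu>: "abs_value K (adjoin_list as B) \<mu>" "\<forall>b\<in>B. \<mu> b = \<nu> b" by blast
  have "algebraic_over B a" using Cons.prems by simp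
  then have a: "algebraic_over (adjoin_list as B) a"
    by (rule algebraic_over_mono[OF _ adjoin_list_base[OF B(1)]])
  have K: "K \<subseteq> adjoin_list as B" using B(3) adjoin_list_base[OF B(1)] by (rule subset_trans)
  obtain \<mu>' where "abs_value K (poly_ring (adjoin_list as B) a) \<mu>'"
    and "\<And>b. b \<in> adjoin_list as B \<Longrightarrow> \<mu>' b = \<mu> b"
    using abs_value_extend[OF adjoin_list_subring[OF B(1)] adjoin_list_countable[OF B(2)] K \<mu>(1) a] by blast
  then show ?case using \<mu>(2) adjoin_list_base[OF B(1), of as] unfolding adjoin_list_simps
    by (intro exI[of _ \<mu>']) auto
qed

text \<open>By the pigeonhole principle, as at most one \<open>k\<close> has distance less than \<open>1/2\<close> to \<open>- z\<close>.\<close>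

lemma away_from_finite:
  fixes Z :: "complex set"
  assumes Z: "finite Z"
  obtains k :: nat where "1 \<le> k" "k \<le> card Z + 1"
    "\<And>z t. z \<in> Z \<Longrightarrow> real k \<le> t \<Longrightarrow> t \<le> real k + 1 / 4 \<Longrightarrow> 1 / 4 \<le> cmod (of_real t + z)"
proof -
  have "\<exists>k\<in>{1..card Z + 1}. \<forall>z\<in>Z. 1 / 2 \<le> cmod (of_nat k + z)"
  proof (rule ccontr)
    assume neg: "\<not> ?thesis"
    have "\<forall>k\<in>{1..card Z + 1}. \<exists>z\<in>Z. cmod (of_nat k + z) < 1 / 2"
    proof
      fix k assume k: "k \<in> {1..card Z + 1}"
      then have "\<not> (\<forall>z\<in>Z. 1 / 2 \<le> cmod (of_nat k + z))" using neg by blast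
      then show "\<exists>z\<in>Z. cmod (of_nat k + z) < 1 / 2" by (simp add: not_le)
    qed
    then obtain g where g: "\<And>k. k \<in> {1..card Z + 1} \<Longrightarrow> g k \<in> Z \<and> cmod (of_nat k + g k) < 1 / 2" by metis
    have "inj_on g {1..card Z + 1}"
    proof (rule inj_onI)
      fix k l assume kl: "k \<in> {1..card Z + 1}" "l \<in> {1..card Z + 1}" "g k = g l"
      have "cmod (of_nat k - of_nat l) = cmod ((of_nat k + g k) - (of_nat l + g l))" using kl(3) by simp
      also have "\<dots> \<le> cmod (of_nat k + g k) + cmod (of_nat l + g l)" by (rule norm_triangle_ineq4)
      also have "\<dots> < 1" using g[OF kl(1)] g[OF kl(2)] by linarith
      finally have "cmod (of_real (real k - real l)) < 1" by simp
      then have "\<bar>real k - real l\<bar> < 1" by (simp only: norm_of_real)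
      then show "k = l" by linarith
    qed
    then have "card {1..card Z + 1} \<le> card Z" using g by (intro card_inj_on_le[OF _ _ Z]) auto
    then show False by simp
  qed
  then obtain k where k: "k \<in> {1..card Z + 1}" "\<And>z. z \<in> Z \<Longrightarrow> 1 / 2 \<le> cmod (of_nat k + z)" by blast
  show thesis
  proof (rule that[of k])
    fix z t assume z: "z \<in> Z" and t: "real k \<le> t" "t \<le> real k + 1 / 4"
    have "of_nat k + z = (of_real t + z) - of_real (t - real k)" by simp
    then have "cmod (of_nat k + z) \<le> cmod (of_real t + z) + cmod (of_real (t - real k))"
      by (metis norm_triangle_ineq4)
    also have "cmod (of_real (t - real k)) \<le> 1 / 4" using t by (simp only: norm_of_real)
    finally show "1 / 4 \<le> cmod (of_real t + z)" using k(2)[OF z] by linarith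
  qed (use k(1) in auto)
qed

lemma ln_shifted_close:
  fixes z :: complex
  assumes T: "1 \<le> t" "t \<le> T" and far: "1 / 4 \<le> cmod (of_real t + z)"
  shows "\<bar>ln (cmod (of_real t + z)) - ln (max 1 (cmod z))\<bar> \<le> ln (8 * T)"
proof -
  define Xs Y where "Xs = cmod (of_real t + z)" and "Y = max 1 (cmod z)"
  have Xs: "Xs > 0" using far unfolding Xs_def by linarith
  have Y: "Y \<ge> 1" by (simp add: Y_def)
  have "Xs \<le> t + cmod z" unfolding Xs_def using norm_triangle_ineq[of "of_real t" z] T by simp
  also have "\<dots> \<le> T * Y + T * Y"
  proof (intro add_mono)
    have "t \<le> T * 1" using T by simp
    also have "\<dots> \<le> T * Y" using T Y by (intro mult_left_mono) auto
    finally show "t \<le> T * Y" .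
    have "cmod z \<le> 1 * Y" by (simp add: Y_def)
    also have "\<dots> \<le> T * Y" using T Y by (intro mult_right_mono) auto
    finally show "cmod z \<le> T * Y" .
  qed
  also have "\<dots> \<le> 8 * T * Y" using T Y by simp
  finally have XY: "Xs \<le> 8 * T * Y" .
  have YX: "Y \<le> 8 * T * Xs"
  proof (cases "cmod z \<le> 2 * T")
    case True
    have "Y \<le> 2 * T" using True T by (auto simp: Y_def)
    also have "\<dots> = 8 * T * (1 / 4)" by simp
    also have "\<dots> \<le> 8 * T * Xs" using far T unfolding Xs_def by (intro mult_left_mono) auto
    finally show ?thesis .
  next
    case False
    have "cmod z \<le> Xs + t"
      unfolding Xs_def using norm_triangle_ineq4[of "of_real t + z" "of_real t"] T by simp
    then have "cmod z \<le> 2 * Xs" using False T by linarith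
    moreover have "Y = cmod z" using False T by (simp add: Y_def)
    moreover have "2 * Xs \<le> 8 * T * Xs" using T Xs by (intro mult_right_mono) auto
    ultimately show ?thesis by linarith
  qed
  have "ln Xs \<le> ln (8 * T * Y)" using XY Xs T Y by (subst ln_le_cancel_iff) auto
  moreover have "ln Y \<le> ln (8 * T * Xs)" using YX Xs T Y by (subst ln_le_cancel_iff) auto
  ultimately show ?thesis using Xs Y T unfolding Xs_def[symmetric] Y_def[symmetric]
    by (simp add: ln_mult abs_le_iff)
qed

text \<open>An absolute value on the ring generated by a transcendental \<open>y\<close> behaves on finitely many polynomials like a
  disc: it is determined by its centre \<open>a1\<close>, its radius \<open>r\<close> and the absolute value on the roots. The image of \<open>y\<close>
  is a complex number at the corresponding distance from the image of the centre.\<close>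

lemma approximable_transcendental:
  assumes B: "subring_set B" and cB: "countable B" and KB: "K \<subseteq> B" and y: "\<not> algebraic_over B y"
    and ap: "approximable K B"
  shows "approximable K (poly_ring B y)"
  unfolding approximable_def
proof (intro allI impI)
  fix \<nu> G and \<epsilon> c\<^sub>0 :: real
  let ?By = "poly_ring B y"
  assume av: "abs_value K ?By \<nu>" and G: "finite G" "G \<subseteq> ?By - {0}" and \<epsilon>: "0 < \<epsilon>" and c0: "0 < c\<^sub>0"
  have By: "subring_set ?By" by (rule poly_ring_subring[OF B])
  have BBy: "B \<subseteq> ?By" using poly_ring_base[OF B] by blast
  have "\<forall>g\<in>G. \<exists>p. (\<forall>i. coeff p i \<in> B) \<and> g = poly p y" using G(2) poly_ringD by blast
  then obtain p where p: "\<And>g i. g \<in> G \<Longrightarrow> coeff (p g) i \<in> B" "\<And>g. g \<in> G \<Longrightarrow> g = poly (p g) y" by metis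
  have p0: "p g \<noteq> 0" if "g \<in> G" for g using p(2)[OF that] G(2) that by auto
  \<comment> \<open>Over the roots the polynomials split, so that only the values of \<open>y - a\<close> matter. The centre \<open>0\<close>
    makes \<open>R\<close> nonempty.\<close>
  define R where "R = insert 0 (\<Union>g\<in>G. {a. poly (p g) a = 0})"
  have finR: "finite R" unfolding R_def using G(1) p0 by (intro finite.insertI finite_UN_I poly_roots_finite) auto
  have R0: "0 \<in> R" by (simp add: R_def)
  have algR: "algebraic_over B a" if "a \<in> R" for a
  proof (cases "a = 0")
    case True
    then show ?thesis using algebraic_over_mem[OF B subring_setD(2)[OF B]] by simp
  next
    case False
    then obtain g where "g \<in> G" "poly (p g) a = 0" using \<open>a \<in> R\<close> unfolding R_def by blast
    then show ?thesis unfolding algebraic_over_def using p(1) p0 by (intro exI[of _ "p g"]) simp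
  qed
  obtain rs where rs: "set rs = R" using finite_list[OF finR] by blast
  define E where "E = adjoin_list rs B"
  have algrs: "algebraic_over B a" if "a \<in> set rs" for a using that algR rs by simp
  have E: "subring_set E" "countable E" "B \<subseteq> E" "R \<subseteq> E"
    unfolding E_def using adjoin_list_subring[OF B] adjoin_list_countable[OF cB] adjoin_list_base[OF B]
      adjoin_list_gen[OF B, of rs] rs by auto
  have KE: "K \<subseteq> E" using KB E(3) by (rule subset_trans)
  have apE: "approximable K E" unfolding E_def by (rule approximable_adjoin_list[OF B cB KB ap algrs])
  have yE: "\<not> algebraic_over E y" using algebraic_adjoin_list[OF B cB algrs, of rs y] y unfolding E_def by blast
  define C where "C = adjoin_list rs ?By"
  have C: "subring_set C" "?By \<subseteq> C" "E \<subseteq> C" "y \<in> C"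
    unfolding C_def E_def using adjoin_list_subring[OF By] adjoin_list_base[OF By] adjoin_list_mono[OF BBy]
      poly_ring_gen[OF B, of y] by auto
  have KBy: "K \<subseteq> ?By" using KB BBy by (rule subset_trans)
  have "algebraic_over ?By a" if "a \<in> set rs" for a by (rule algebraic_over_mono[OF algrs[OF that] BBy])
  from abs_value_adjoin_list[OF By poly_ring_countable[OF cB] KBy av this]
  obtain \<mu> where \<mu>: "abs_value K C \<mu>" and \<mu>\<nu>: "\<And>b. b \<in> ?By \<Longrightarrow> \<mu> b = \<nu> b" unfolding C_def by blast
  interpret mult_seminormed C \<mu> using C(1) \<mu> by unfold_locales (auto simp: abs_value_def)
  have pos: "0 < \<mu> b" if "b \<in> C" "b \<noteq> 0" for b using \<mu> that by (simp add: abs_value_def)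
  have RC: "a \<in> C" if "a \<in> R" for a using that E(4) C(3) by blast
  have yR: "y - a \<noteq> 0" if "a \<in> R" for a using algR[OF that] y by auto
  have yaC: "y - a \<in> C" if "a \<in> R" for a by (rule sub(3)[OF C(4) RC[OF that]])
  have ya: "0 < \<mu> (y - a)" if "a \<in> R" for a by (rule pos[OF yaC[OF that] yR[OF that]])
  \<comment> \<open>With respect to a nearest centre \<open>a1\<close> the ultrametric inequality turns into the equation \<open>ball\<close>.\<close>
  have "Min ((\<lambda>a. \<mu> (y - a)) ` R) \<in> (\<lambda>a. \<mu> (y - a)) ` R" using finR R0 by (intro Min_in) auto
  then obtain a1 where a1: "a1 \<in> R" "Min ((\<lambda>a. \<mu> (y - a)) ` R) = \<mu> (y - a1)" by auto
  define r where "r = \<mu> (y - a1)"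
  have r0: "0 < r" unfolding r_def by (rule ya[OF a1(1)])
  have rmin: "r \<le> \<mu> (y - a)" if "a \<in> R" for a
    using Min_le[of "(\<lambda>a. \<mu> (y - a)) ` R" "\<mu> (y - a)"] finR that unfolding r_def a1(2)[symmetric] by auto
  have ball: "\<mu> (y - a) = max r (\<mu> (a1 - a))" if a: "a \<in> R" for a
  proof -
    have da: "a1 - a \<in> C" by (rule sub(3)[OF RC[OF a1(1)] RC[OF a]])
    have e: "y - a = (y - a1) + (a1 - a)" by simp
    have le: "\<mu> (y - a) \<le> max r (\<mu> (a1 - a))"
      unfolding r_def e by (rule \<nu>_add[OF yaC[OF a1(1)] da])
    show ?thesis
    proof (cases "\<mu> (a1 - a) \<le> r")
      case True
      then show ?thesis using le rmin[OF a] by simp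
    next
      case False
      then have "\<mu> (y - a) = \<mu> (a1 - a)"
        unfolding e by (intro \<nu>_add_eq[OF yaC[OF a1(1)] da]) (simp add: r_def)
      then show ?thesis using False by simp
    qed
  qed
  \<comment> \<open>\<open>N\<close> bounds the number of factors, leading coefficient included, of each of the polynomials.\<close>
  define N where "N = 1 + (\<Sum>g\<in>G. \<Sum>a\<in>R. real (order a (p g)))"
  have N: "1 \<le> N" "(\<Sum>a\<in>{a. poly (p g) a = 0}. real (order a (p g))) + 1 \<le> N" if "g \<in> G" for g
  proof -
    have "(\<Sum>a\<in>{a. poly (p g) a = 0}. real (order a (p g))) \<le> (\<Sum>a\<in>R. real (order a (p g)))"
      by (rule sum_mono2[OF finR]) (use that in \<open>auto simp: R_def\<close>)
    also have "\<dots> \<le> (\<Sum>g\<in>G. \<Sum>a\<in>R. real (order a (p g)))"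
      by (rule member_le_sum[OF that _ G(1)]) (auto intro: sum_nonneg)
    finally show "(\<Sum>a\<in>{a. poly (p g) a = 0}. real (order a (p g))) + 1 \<le> N" by (simp add: N_def)
    then show "1 \<le> N" using sum_nonneg[of "{a. poly (p g) a = 0}" "\<lambda>a. real (order a (p g))"] by simp
  qed
  have N0: "1 \<le> N" unfolding N_def by (simp add: sum_nonneg)
  define \<theta> where "\<theta> = \<epsilon> / N"
  have \<theta>0: "0 < \<theta>" unfolding \<theta>_def using \<epsilon> N0 by simp
  define T where "T = real (card R) + 2"
  obtain c1 where c1: "0 < c1" "\<And>c. 0 < c \<Longrightarrow> c < c1 \<Longrightarrow> c * \<bar>ln (8 * T)\<bar> < \<theta> / 2"
    using small_scale[of "{()}" "\<theta> / 2" "\<lambda>_. ln (8 * T)"] \<theta>0 by auto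
  define GE where "GE = ((\<lambda>g. lead_coeff (p g)) ` G \<union> (\<lambda>a. a1 - a) ` R) - {0}"
  have dE: "a1 - a \<in> E" if "a \<in> R" for a
    using that a1(1) E(4) by (intro subring_setD(3)[OF E(1)]) auto
  have GE: "finite GE" "GE \<subseteq> E - {0}"
    unfolding GE_def using G(1) finR p(1) E(3) dE by auto
  have \<theta>2: "0 < \<theta> / 2" using \<theta>0 by simp
  have "0 < min c\<^sub>0 c1" using c0 c1(1) by simp
  from approximableD[OF apE abs_value_subset[OF \<mu> C(3)] GE \<theta>2 this] obtain c D where
    cc: "0 < c" "c < min c\<^sub>0 c1" and D: "partial_hom {0} D" "fst ` D = E" "Id_on K \<subseteq> D"
    and close: "\<And>g x. (g, x) \<in> D \<Longrightarrow> g \<in> GE \<Longrightarrow> \<bar>c * ln (cmod x) - ln (\<mu> g)\<bar> < \<theta> / 2" by blast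
  let ?A = "poly_ring E y"
  have A: "subring_set ?A" by (rule poly_ring_subring[OF E(1)])
  have EA: "E \<subseteq> ?A" using poly_ring_base[OF E(1)] by blast
  have yA: "y \<in> ?A" by (rule poly_ring_gen[OF E(1)])
  interpret D: hom_graph ?A "{0}" D by (rule hom_graph_zero[OF A D(1)]) (use D(2) EA in simp)
  have "\<forall>a\<in>R. \<exists>x. (a, x) \<in> D"
  proof
    fix a assume "a \<in> R"
    then have "a \<in> fst ` D" using D(2) E(4) by blast
    then show "\<exists>x. (a, x) \<in> D" by auto
  qed
  then obtain \<phi> where \<phi>: "\<And>a. a \<in> R \<Longrightarrow> (a, \<phi> a) \<in> D" by metis
  \<comment> \<open>The image \<open>f t\<close> of \<open>y\<close> has distance about \<open>\<rho>\<close> to the image of \<open>a1\<close>. The interval for \<open>t\<close> keeps it away from the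
    images of the other centres; being uncountable it contains a \<open>t\<close> for which \<open>f t\<close> is
    transcendental over the image of \<open>E\<close>.\<close>
  define \<rho> where "\<rho> = exp (ln r / c)"
  have \<rho>0: "0 < \<rho>" by (simp add: \<rho>_def)
  have ln\<rho>: "c * ln \<rho> = ln r" using cc by (simp add: \<rho>_def)
  define d where "d a = (\<phi> a1 - \<phi> a) / of_real \<rho>" for a
  obtain k where k: "1 \<le> k" "k \<le> card (d ` R) + 1"
    and far: "\<And>z t. z \<in> d ` R \<Longrightarrow> real k \<le> t \<Longrightarrow> t \<le> real k + 1 / 4 \<Longrightarrow> 1 / 4 \<le> cmod (of_real t + z)"
    using away_from_finite[of "d ` R"] finR by blast
  have cran: "countable (snd ` D)" by (rule D.countable_ran[OF poly_ring_countable[OF E(2)]])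
  define f where "f t = \<phi> a1 + of_real (t * \<rho>)" for t :: real
  have injf: "inj f" using \<rho>0 by (auto simp: inj_on_def f_def)
  have "uncountable (f ` {real k..real k + 1 / 4})"
  proof
    assume "countable (f ` {real k..real k + 1 / 4})"
    then have "countable {real k..real k + 1 / 4}"
      by (rule countable_image_inj_on) (use injf in \<open>auto simp: inj_on_def\<close>)
    then show False using uncountable_closed_interval[of "real k" "real k + 1 / 4"] by simp
  qed
  then have "\<not> f ` {real k..real k + 1 / 4} \<subseteq> {x. algebraic_over (snd ` D) x}"
    using countable_algebraic[OF cran] countable_subset by blast
  then obtain u where u: "u \<in> f ` {real k..real k + 1 / 4}" "u \<notin> {x. algebraic_over (snd ` D) x}" by blast
  then obtain t where t: "real k \<le> t" "t \<le> real k + 1 / 4" and ft: "\<not> algebraic_over (snd ` D) (f t)"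
    by force
  define y' where "y' = f t"
  have tT: "1 \<le> t" "t \<le> T"
  proof -
    show "1 \<le> t" using t k(1) by linarith
    have "card (d ` R) \<le> card R" by (rule card_image_le[OF finR])
    then show "t \<le> T" using t k(2) unfolding T_def by linarith
  qed
  have y'a: "\<bar>c * ln (cmod (y' - \<phi> a)) - ln (\<mu> (y - a))\<bar> \<le> \<theta>" and y'0: "y' - \<phi> a \<noteq> 0" if a: "a \<in> R" for a
  proof -
    have e: "y' - \<phi> a = of_real \<rho> * (of_real t + d a)"
      using \<rho>0 by (simp add: y'_def f_def d_def field_simps)
    have far': "1 / 4 \<le> cmod (of_real t + d a)" using far[OF _ t] a by simp
    then have nz: "of_real t + d a \<noteq> 0" by auto
    then show "y' - \<phi> a \<noteq> 0" unfolding e using \<rho>0 by simp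
    have 1: "c * ln (cmod (y' - \<phi> a)) = ln r + c * ln (cmod (of_real t + d a))"
      unfolding e norm_mult norm_of_real using nz \<rho>0 by (simp add: ln_mult distrib_left ln\<rho>)
    have "\<bar>c * (ln (cmod (of_real t + d a)) - ln (max 1 (cmod (d a))))\<bar> \<le> c * ln (8 * T)"
      using mult_left_mono[OF ln_shifted_close[OF tT far'], of c] cc by (simp add: abs_mult)
    also have "\<dots> \<le> c * \<bar>ln (8 * T)\<bar>" using cc by (intro mult_left_mono) auto
    also have "\<dots> < \<theta> / 2" using c1(2) cc by simp
    finally have 2: "\<bar>c * ln (cmod (of_real t + d a)) - c * ln (max 1 (cmod (d a)))\<bar> < \<theta> / 2"
      by (simp add: algebra_simps)
    have 3: "\<bar>(ln r + c * ln (max 1 (cmod (d a)))) - ln (\<mu> (y - a))\<bar> \<le> \<theta> / 2"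
    proof (cases "a = a1")
      case True
      then show ?thesis using \<theta>0 by (simp add: d_def r_def)
    next
      case False
      have aD: "(a1 - a, \<phi> a1 - \<phi> a) \<in> D" by (intro D.diff_D \<phi> a a1(1))
      have nz: "\<phi> a1 - \<phi> a \<noteq> 0" using D.ker_D[OF aD] False by simp
      have aC: "a1 - a \<in> C" by (rule sub(3)[OF RC[OF a1(1)] RC[OF a]])
      have "a1 - a \<in> GE" unfolding GE_def using a False by auto
      from close[OF aD this] have cl: "\<bar>c * ln (cmod (\<phi> a1 - \<phi> a)) - ln (\<mu> (a1 - a))\<bar> < \<theta> / 2" .
      have "ln (max 1 (cmod (d a))) = max 0 (ln (cmod (d a)))"
        using nz \<rho>0 by (auto simp: max_def d_def)
      moreover have "ln (cmod (d a)) = ln (cmod (\<phi> a1 - \<phi> a)) - ln \<rho>"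
        using nz \<rho>0 by (simp add: d_def norm_divide ln_div)
      ultimately have "ln r + c * ln (max 1 (cmod (d a))) = ln r + c * max 0 (ln (cmod (\<phi> a1 - \<phi> a)) - ln \<rho>)"
        by simp
      also have "\<dots> = max (ln r) (c * ln (cmod (\<phi> a1 - \<phi> a)))"
        using cc by (simp add: max_mult_distrib_left max_add_distrib_right right_diff_distrib ln\<rho>)
      finally have A: "ln r + c * ln (max 1 (cmod (d a))) = max (ln r) (c * ln (cmod (\<phi> a1 - \<phi> a)))" .
      have B: "ln (\<mu> (y - a)) = max (ln r) (ln (\<mu> (a1 - a)))"
        unfolding ball[OF a] using r0 pos[OF aC] False by (auto simp: max_def)
      show ?thesis unfolding A B using cl \<theta>0 by (auto simp: max_def)
    qed
    show "\<bar>c * ln (cmod (y' - \<phi> a)) - ln (\<mu> (y - a))\<bar> \<le> \<theta>" using 1 2 3 by linarith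
  qed
  have "partial_hom {0} (adjoin D y y')"
  proof (rule D.adjoin_transcendental[OF yA])
    fix a b assume ab: "pair_poly D a b"
    note sup = D.pair_poly_support[OF refl ab]
    show "b = 0" if "poly a y \<in> {0}"
    proof (rule ccontr)
      assume "b \<noteq> 0"
      have "coeff a i \<in> E" for i
        using D.pp_coeff[OF ab, of i] D(2) by (metis fst_conv image_eqI)
      then show False using yE \<open>b \<noteq> 0\<close> sup(3) that unfolding algebraic_over_def by auto
    qed
    show "poly b y' \<noteq> 0" if "b \<noteq> 0"
    proof
      assume "poly b y' = 0"
      have "coeff b i \<in> snd ` D" for i
        using D.pp_coeff[OF ab, of i] by (metis snd_conv image_eqI)
      then show False using ft that \<open>poly b y' = 0\<close> unfolding algebraic_over_def y'_def by blast
    qed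
  qed
  then have D2: "partial_hom {0} (adjoin D y y')" .
  define D3 where "D3 = {x \<in> adjoin D y y'. fst x \<in> ?By}"
  have ph3: "partial_hom {0} D3" unfolding D3_def by (rule partial_hom_restrict[OF D2 By])
  interpret D2: hom_graph ?A "{0}" "adjoin D y y'"
    by (rule hom_graph_zero[OF A D2 D.dom_adjoin[OF yA]])
  have dom2: "fst ` adjoin D y y' = ?A" unfolding D.adjoin_dom D(2) poly_ring_def ..
  have "?By \<subseteq> ?A" unfolding poly_ring_def using E(3) by blast
  then have dom3: "fst ` D3 = ?By" unfolding D3_def using dom2 by (auto simp: image_iff)
  have K3: "Id_on K \<subseteq> D3" unfolding D3_def using D(3) D.sub_adjoin[of y y'] KBy by (auto simp: Id_on_def)
  have "\<bar>c * ln (cmod x) - ln (\<nu> g)\<bar> < \<epsilon>" if gx: "(g, x) \<in> D3" "g \<in> G" for g x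
  proof -
    define F where "F = {a. poly (p g) a = 0}"
    have FR: "F \<subseteq> R" unfolding F_def R_def using gx(2) by blast
    have finF: "finite F" using FR finR by (rule finite_subset)
    define l where "l = lead_coeff (p g)"
    have lE: "l \<in> E" "l \<noteq> 0" using p(1) p0 gx(2) E(3) by (auto simp: l_def)
    have "l \<in> fst ` D" using lE(1) D(2) by simp
    then obtain l' where l': "(l, l') \<in> D" by auto
    have l'0: "l' \<noteq> 0" using D.ker_D[OF l'] lE(2) by simp
    have lGE: "l \<in> GE" unfolding GE_def l_def using gx(2) p0[OF gx(2)] by auto
    have gval: "g = l * (\<Prod>a\<in>F. (y - a) ^ order a (p g))"
    proof -
      have "poly (p g) y = poly (smult l (\<Prod>a\<in>F. [:- a, 1:] ^ order a (p g))) y"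
        unfolding l_def F_def by (simp add: complex_poly_decompose)
      also have "\<dots> = l * (\<Prod>a\<in>F. (y - a) ^ order a (p g))" by (simp add: poly_prod)
      finally show ?thesis using p(2)[OF gx(2)] by simp
    qed
    have DD2: "D \<subseteq> adjoin D y y'" by (rule D.sub_adjoin)
    have "(l * (\<Prod>a\<in>F. (y - a) ^ order a (p g)), l' * (\<Prod>a\<in>F. (y' - \<phi> a) ^ order a (p g))) \<in> adjoin D y y'"
      by (intro D2.mult_D D2.prod_D D2.power_D D2.diff_D D.in_adjoin subsetD[OF DD2] l' \<phi> subsetD[OF FR])
    moreover have "(g, x) \<in> adjoin D y y'" using gx(1) by (simp add: D3_def)
    ultimately have xval: "x = l' * (\<Prod>a\<in>F. (y' - \<phi> a) ^ order a (p g))"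
      using D2.fun_D gval by metis
    have lnx: "ln (cmod x) = ln (cmod l') + (\<Sum>a\<in>F. real (order a (p g)) * ln (cmod (y' - \<phi> a)))"
    proof -
      have "cmod x = cmod l' * (\<Prod>a\<in>F. cmod (y' - \<phi> a) ^ order a (p g))"
        unfolding xval by (simp add: norm_mult prod_norm[symmetric] norm_power)
      also have "ln \<dots> = ln (cmod l') + ln (\<Prod>a\<in>F. cmod (y' - \<phi> a) ^ order a (p g))"
        using l'0 y'0 FR finF by (intro ln_mult_pos) (auto intro!: prod_pos zero_less_power)
      also have "ln (\<Prod>a\<in>F. cmod (y' - \<phi> a) ^ order a (p g)) = (\<Sum>a\<in>F. ln (cmod (y' - \<phi> a) ^ order a (p g)))"
        by (rule ln_prod) (use finF y'0 FR in auto)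
      finally show ?thesis by (simp add: ln_realpow)
    qed
    have ln\<nu>: "ln (\<nu> g) = ln (\<mu> l) + (\<Sum>a\<in>F. real (order a (p g)) * ln (\<mu> (y - a)))"
    proof -
      have FC: "(y - a) ^ n \<in> C" if "a \<in> F" for a n
        by (intro subring_set_power[OF C(1)] yaC) (use that FR in blast)
      have lC: "l \<in> C" using lE(1) C(3) by blast
      have "\<nu> g = \<mu> g" using \<mu>\<nu>[of g] G(2) gx(2) by auto
      also have "\<dots> = \<mu> l * \<mu> (\<Prod>a\<in>F. (y - a) ^ order a (p g))"
        by (subst gval) (intro sn(4) lC subring_set_prod[OF C(1)] FC)
      also have "\<mu> (\<Prod>a\<in>F. (y - a) ^ order a (p g)) = (\<Prod>a\<in>F. \<mu> ((y - a) ^ order a (p g)))"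
        by (rule \<nu>_prod[OF FC])
      also have "\<dots> = (\<Prod>a\<in>F. \<mu> (y - a) ^ order a (p g))"
        by (intro prod.cong refl \<nu>_power yaC) (use FR in blast)
      also have "ln (\<mu> l * \<dots>) = ln (\<mu> l) + ln (\<Prod>a\<in>F. \<mu> (y - a) ^ order a (p g))"
        using pos[OF lC lE(2)] ya FR by (intro ln_mult_pos) (auto intro!: prod_pos zero_less_power)
      also have "ln (\<Prod>a\<in>F. \<mu> (y - a) ^ order a (p g)) = (\<Sum>a\<in>F. ln (\<mu> (y - a) ^ order a (p g)))"
        by (rule ln_prod) (use finF in simp, use ya FR in \<open>metis less_irrefl subsetD zero_less_power\<close>)
      finally show ?thesis by (simp add: ln_realpow)
    qed
    have "c * ln (cmod x) - ln (\<nu> g) = (c * ln (cmod l') - ln (\<mu> l)) +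
      (\<Sum>a\<in>F. real (order a (p g)) * (c * ln (cmod (y' - \<phi> a)) - ln (\<mu> (y - a))))"
      unfolding lnx ln\<nu> by (simp add: distrib_left sum_distrib_left sum_subtractf right_diff_distrib mult_ac)
    also have "\<bar>\<dots>\<bar> \<le> \<bar>c * ln (cmod l') - ln (\<mu> l)\<bar> +
      \<bar>\<Sum>a\<in>F. real (order a (p g)) * (c * ln (cmod (y' - \<phi> a)) - ln (\<mu> (y - a)))\<bar>" by (rule abs_triangle_ineq)
    also have "\<bar>\<Sum>a\<in>F. real (order a (p g)) * (c * ln (cmod (y' - \<phi> a)) - ln (\<mu> (y - a)))\<bar>
      \<le> (\<Sum>a\<in>F. real (order a (p g)) * \<theta>)"
    proof (rule sum_abs[THEN order_trans], rule sum_mono)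
      fix a assume "a \<in> F"
      then have "a \<in> R" using FR by blast
      from y'a[OF this] show "\<bar>real (order a (p g)) * (c * ln (cmod (y' - \<phi> a)) - ln (\<mu> (y - a)))\<bar>
        \<le> real (order a (p g)) * \<theta>" by (simp add: abs_mult mult_left_mono)
    qed
    also have "\<dots> = (\<Sum>a\<in>F. real (order a (p g))) * \<theta>" by (simp add: sum_distrib_right)
    also have "\<bar>c * ln (cmod l') - ln (\<mu> l)\<bar> + (\<Sum>a\<in>F. real (order a (p g))) * \<theta>
      < \<theta> + (\<Sum>a\<in>F. real (order a (p g))) * \<theta>" using close[OF l' lGE] \<theta>0 by simp
    also have "\<dots> = ((\<Sum>a\<in>F. real (order a (p g))) + 1) * \<theta>" by (simp add: algebra_simps)
    also have "\<dots> \<le> N * \<theta>" using N(2)[OF gx(2)] \<theta>0 unfolding F_def by (intro mult_right_mono) auto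
    also have "\<dots> = \<epsilon>" using N0 by (simp add: \<theta>_def)
    finally show ?thesis by simp
  qed
  then show "\<exists>c D. 0 < c \<and> c < c\<^sub>0 \<and> partial_hom {0} D \<and> fst ` D = ?By \<and> Id_on K \<subseteq> D \<and>
       (\<forall>g x. (g, x) \<in> D \<longrightarrow> g \<in> G \<longrightarrow> \<bar>c * ln (cmod x) - ln (\<nu> g)\<bar> < \<epsilon>)"
    using cc ph3 dom3 K3 by (intro exI[of _ c] exI[of _ D3] conjI allI impI) simp_all
qed

theorem approximable_fg:
  assumes K: "subring_set K" "countable K"
  shows "approximable K (adjoin_list as K)"
proof (induction as)
  case Nil
  then show ?case using approximable_base[OF K(1)] by (simp add: adjoin_list_simps)
next
  case (Cons a as)
  note B = adjoin_list_subring[OF K(1), of as] adjoin_list_countable[OF K(2), of as] adjoin_list_base[OF K(1), of as]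
  show ?case unfolding adjoin_list_simps
    using approximable_algebraic[OF B _ Cons.IH] approximable_transcendental[OF B _ Cons.IH] by blast
qed

section \<open>Evaluation of polynomials and the ideal of relations\<close>

definition mon_eval :: "('m \<Rightarrow> complex) \<Rightarrow> ('m \<Rightarrow>\<^sub>0 complex) \<Rightarrow> complex" where
  "mon_eval \<mu> p = (\<Sum>m\<in>Poly_Mapping.keys p. Poly_Mapping.lookup p m * \<mu> m)"

lemma mon_eval_superset:
  assumes "finite S" "Poly_Mapping.keys p \<subseteq> S"
  shows "mon_eval \<mu> p = (\<Sum>m\<in>S. Poly_Mapping.lookup p m * \<mu> m)"
  unfolding mon_eval_def by (rule sum.mono_neutral_left) (use assms in \<open>auto simp: in_keys_iff\<close>)

lemma mon_eval_diff: "mon_eval \<mu> (p - q) = mon_eval \<mu> p - mon_eval \<mu> q"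
proof -
  let ?S = "Poly_Mapping.keys p \<union> Poly_Mapping.keys q"
  have "Poly_Mapping.keys (p - q) \<subseteq> ?S" by (auto simp: in_keys_iff lookup_minus)
  then show ?thesis
    by (simp add: mon_eval_superset[of ?S] lookup_minus left_diff_distrib sum_subtractf)
qed

lemma mon_eval_zero: "mon_eval \<mu> 0 = 0" by (simp add: mon_eval_def)

lemma mon_eval_add: "mon_eval \<mu> (p + q) = mon_eval \<mu> p + mon_eval \<mu> q"
proof -
  have "mon_eval \<mu> (p - (0 - q)) = mon_eval \<mu> p - (mon_eval \<mu> 0 - mon_eval \<mu> q)"
    by (simp only: mon_eval_diff)
  then show ?thesis by (simp add: mon_eval_zero)
qed

lemma mon_eval_sum: "mon_eval \<mu> (sum g I) = (\<Sum>i\<in>I. mon_eval \<mu> (g i))"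
  by (induction I rule: infinite_finite_induct) (simp_all add: mon_eval_zero mon_eval_add)

lemma mon_eval_single: "mon_eval \<mu> (Poly_Mapping.single k c) = c * \<mu> k"
  by (cases "c = 0") (simp_all add: mon_eval_def)

lemma poly_mapping_as_sum:
  "p = (\<Sum>k\<in>Poly_Mapping.keys p. Poly_Mapping.single k (Poly_Mapping.lookup p k))"
  by (rule poly_mapping_eqI) (auto simp: lookup_sum lookup_single when_def in_keys_iff sum.delta')

lemma mult_as_sum:
  fixes p q :: "('m::cancel_comm_monoid_add) \<Rightarrow>\<^sub>0 complex"
  shows "p * q = (\<Sum>k\<in>Poly_Mapping.keys p. \<Sum>l\<in>Poly_Mapping.keys q.
    Poly_Mapping.single (k + l) (Poly_Mapping.lookup p k * Poly_Mapping.lookup q l))"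
proof -
  have "p * q = (\<Sum>k\<in>Poly_Mapping.keys p. Poly_Mapping.single k (Poly_Mapping.lookup p k)) *
    (\<Sum>l\<in>Poly_Mapping.keys q. Poly_Mapping.single l (Poly_Mapping.lookup q l))"
    using poly_mapping_as_sum[of p] poly_mapping_as_sum[of q] by simp
  then show ?thesis by (simp add: sum_product mult_single)
qed

lemma mon_eval_mult:
  fixes p q :: "('m::cancel_comm_monoid_add) \<Rightarrow>\<^sub>0 complex"
  assumes "\<And>k l. \<mu> (k + l) = \<mu> k * \<mu> l"
  shows "mon_eval \<mu> (p * q) = mon_eval \<mu> p * mon_eval \<mu> q"
  unfolding mult_as_sum mon_eval_sum mon_eval_single assms
  by (simp add: mon_eval_def sum_product mult_ac)

lemma mon_eval_one:
  fixes \<mu> :: "'m::zero \<Rightarrow> complex" assumes "\<mu> 0 = 1" shows "mon_eval \<mu> 1 = 1"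
  using mon_eval_single[of \<mu> 0 1] assms by simp

lemma coeffs_in_iff: "p \<in> coeffs_in K \<longleftrightarrow> (\<forall>k. Poly_Mapping.lookup p k \<in> K)"
  unfolding coeffs_in_def by auto

lemma coeffs_in_subring:
  assumes K: "subring_set K"
  shows "subring_set (coeffs_in K :: (('m::cancel_comm_monoid_add) \<Rightarrow>\<^sub>0 complex) set)"
  unfolding subring_set_def
proof (intro conjI ballI)
  show "1 \<in> (coeffs_in K :: ('m \<Rightarrow>\<^sub>0 complex) set)"
    using subring_setD(1,2)[OF K] by (simp add: coeffs_in_iff lookup_one when_def)
  fix p q :: "'m \<Rightarrow>\<^sub>0 complex" assume pq: "p \<in> coeffs_in K" "q \<in> coeffs_in K"
  then show "p - q \<in> coeffs_in K" using subring_setD(3)[OF K] by (simp add: coeffs_in_iff lookup_minus)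
  have "Poly_Mapping.lookup (p * q) k \<in> K" for k
    unfolding mult_as_sum lookup_sum lookup_single when_def
    using pq subring_setD(2,4)[OF K]
    by (intro subring_set_sum[OF K]) (auto simp: coeffs_in_iff)
  then show "p * q \<in> coeffs_in K" by (simp add: coeffs_in_iff)
qed

lemma coeffs_in_single: assumes "subring_set K" "c \<in> K" shows "Poly_Mapping.single k c \<in> coeffs_in K"
  using assms(2) subring_setD(2)[OF assms(1)] by (simp add: coeffs_in_iff lookup_single when_def)

lemma countable_poly_mapping:
  assumes "countable C" "countable (UNIV :: 'm set)"
  shows "countable {p :: 'm \<Rightarrow>\<^sub>0 'b::zero. \<forall>k. Poly_Mapping.lookup p k \<in> C}" (is "countable ?P")
proof -
  define gr where "gr p = (\<lambda>m. (m, Poly_Mapping.lookup p m)) ` Poly_Mapping.keys p" for p :: "'m \<Rightarrow>\<^sub>0 'b"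
  have "inj gr"
  proof (rule injI, rule poly_mapping_eqI)
    fix p q :: "'m \<Rightarrow>\<^sub>0 'b" and k assume e: "gr p = gr q"
    have g: "(k, c) \<in> gr r \<longleftrightarrow> Poly_Mapping.lookup r k = c" if "c \<noteq> 0" for r and c :: 'b
      unfolding gr_def using that by (auto simp: in_keys_iff)
    show "Poly_Mapping.lookup p k = Poly_Mapping.lookup q k"
      using g[of "Poly_Mapping.lookup p k" q] g[of "Poly_Mapping.lookup p k" p]
        g[of "Poly_Mapping.lookup q k" p] g[of "Poly_Mapping.lookup q k" q] e
      by (cases "Poly_Mapping.lookup p k = 0"; cases "Poly_Mapping.lookup q k = 0") auto
  qed
  moreover have "gr ` ?P \<subseteq> {Xs. finite Xs \<and> Xs \<subseteq> UNIV \<times> C}"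
    unfolding gr_def by auto
  moreover have "countable {Xs. finite Xs \<and> Xs \<subseteq> (UNIV :: 'm set) \<times> C}"
    using assms by (intro countable_Collect_finite_subset) simp
  ultimately have "countable (gr ` ?P)" by (intro countable_subset[of "gr ` ?P"])
  then show ?thesis by (rule countable_image_inj_on) (rule inj_on_subset[OF \<open>inj gr\<close> subset_UNIV])
qed

lemma poly_eval_mon_eval: "poly_eval p x = mon_eval (\<lambda>m. \<Prod>i\<in>UNIV. (x $ i) ^ Poly_Mapping.lookup m i) p"
  by (simp add: poly_eval_def mon_eval_def)

lemma poly_eval_mult: "poly_eval (p * q) x = poly_eval p x * poly_eval q x"
  unfolding poly_eval_mon_eval by (rule mon_eval_mult) (simp add: lookup_add power_add prod.distrib)

lemma poly_eval_add: "poly_eval (p + q) x = poly_eval p x + poly_eval q x"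
  unfolding poly_eval_mon_eval by (rule mon_eval_add)

lemma poly_eval_const: "poly_eval (Poly_Mapping.single 0 c) x = c"
  by (simp add: poly_eval_mon_eval mon_eval_single)

lemma poly_eval_coord: "poly_eval (Poly_Mapping.single (Poly_Mapping.single i 1) 1) x = x $ i"
proof -
  have "(\<Prod>j\<in>UNIV. (x $ j) ^ Poly_Mapping.lookup (Poly_Mapping.single i (1::nat)) j)
    = (\<Prod>j\<in>UNIV. if j = i then x $ j else 1)"
    by (rule prod.cong) (auto simp: lookup_single when_def)
  then show ?thesis by (simp add: poly_eval_mon_eval mon_eval_single)
qed

definition laurent_mono :: "('j \<Rightarrow> complex) \<Rightarrow> ('j \<Rightarrow>\<^sub>0 int) \<Rightarrow> complex" where
  "laurent_mono u \<omega> = (\<Prod>j\<in>Poly_Mapping.keys \<omega>. u j powi Poly_Mapping.lookup \<omega> j)"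

lemma laurent_mono_superset:
  assumes "finite S" "Poly_Mapping.keys \<omega> \<subseteq> S"
  shows "laurent_mono u \<omega> = (\<Prod>j\<in>S. u j powi Poly_Mapping.lookup \<omega> j)"
  unfolding laurent_mono_def by (rule prod.mono_neutral_left) (use assms in \<open>auto simp: in_keys_iff\<close>)

lemma laurent_mono_add:
  assumes "\<And>j. u j \<noteq> 0" shows "laurent_mono u (\<omega> + \<tau>) = laurent_mono u \<omega> * laurent_mono u \<tau>"
proof -
  let ?S = "Poly_Mapping.keys \<omega> \<union> Poly_Mapping.keys \<tau>"
  have "Poly_Mapping.keys (\<omega> + \<tau>) \<subseteq> ?S" by (rule keys_add)
  then show ?thesis
    by (simp add: laurent_mono_superset[of ?S] lookup_add power_int_add assms prod.distrib)
qed

lemma laurent_mono_0: "laurent_mono u 0 = 1" by (simp add: laurent_mono_def)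

lemma laurent_mono_single: "laurent_mono u (Poly_Mapping.single j k) = u j powi k"
  by (cases "k = 0") (simp_all add: laurent_mono_def)

definition laurent_val :: "('j \<Rightarrow> complex) \<Rightarrow> (('j \<Rightarrow>\<^sub>0 int) \<Rightarrow>\<^sub>0 complex) \<Rightarrow> complex" where
  "laurent_val u = mon_eval (laurent_mono u)"

lemma laurent_val_diff: "laurent_val u (p - q) = laurent_val u p - laurent_val u q"
  by (simp add: laurent_val_def mon_eval_diff)
lemma laurent_val_mult: "(\<And>j. u j \<noteq> 0) \<Longrightarrow> laurent_val u (p * q) = laurent_val u p * laurent_val u q"
  unfolding laurent_val_def by (rule mon_eval_mult) (rule laurent_mono_add)
lemma laurent_val_one: "laurent_val u 1 = 1"
  by (simp add: laurent_val_def mon_eval_one laurent_mono_0)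
lemma laurent_val_const: "laurent_val u (Poly_Mapping.single 0 c) = c"
  by (simp add: laurent_val_def mon_eval_single laurent_mono_0)
lemma laurent_val_var: "laurent_val u (Poly_Mapping.single (Poly_Mapping.single j 1) 1) = u j"
  by (simp add: laurent_val_def mon_eval_single laurent_mono_single)

locale family =
  fixes K :: "complex set" and V :: "(complex ^ 'n::finite) set" and f :: "'j \<Rightarrow> complex ^ 'n \<Rightarrow> complex"
  assumes K: "subring_set K" and f: "range f \<subseteq> carrier (coordinate_ring K V)"
begin

abbreviation "R \<equiv> coordinate_ring K V"
abbreviation "S \<equiv> mult_set K V f"
abbreviation "L \<equiv> localized_ring K V f"

lemma R_simps: "g \<otimes>\<^bsub>R\<^esub> h = (\<lambda>x\<in>V. g x * h x)" "\<one>\<^bsub>R\<^esub> = (\<lambda>x\<in>V. 1)" "\<zero>\<^bsub>R\<^esub> = (\<lambda>x\<in>V. 0)"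
  "g \<oplus>\<^bsub>R\<^esub> h = (\<lambda>x\<in>V. g x + h x)"
  by (simp_all add: coordinate_ring_def)

lemma R_carrier: "carrier R = (\<lambda>p. restrict (poly_eval p) V) ` coeffs_in K"
  by (simp add: coordinate_ring_def)

lemmas cK = subring_setD[OF coeffs_in_subring[OF K]]

lemma R_mult_closed: assumes "g \<in> carrier R" "h \<in> carrier R" shows "(\<lambda>x\<in>V. g x * h x) \<in> carrier R"
proof -
  obtain p where p: "p \<in> coeffs_in K" "g = restrict (poly_eval p) V"
    using assms(1) unfolding R_carrier by (rule imageE)
  obtain q where q: "q \<in> coeffs_in K" "h = restrict (poly_eval q) V"
    using assms(2) unfolding R_carrier by (rule imageE)
  show ?thesis unfolding R_carrier
  proof (rule image_eqI[OF _ cK(4)[OF p(1) q(1)]])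
    show "(\<lambda>x\<in>V. g x * h x) = restrict (poly_eval (p * q)) V"
      unfolding p(2) q(2) by (rule restrict_ext) (simp add: poly_eval_mult)
  qed
qed

lemma R_add_closed: assumes "g \<in> carrier R" "h \<in> carrier R" shows "(\<lambda>x\<in>V. g x + h x) \<in> carrier R"
proof -
  obtain p where p: "p \<in> coeffs_in K" "g = restrict (poly_eval p) V"
    using assms(1) unfolding R_carrier by (rule imageE)
  obtain q where q: "q \<in> coeffs_in K" "h = restrict (poly_eval q) V"
    using assms(2) unfolding R_carrier by (rule imageE)
  show ?thesis unfolding R_carrier
  proof (rule image_eqI[OF _ cK(6)[OF p(1) q(1)]])
    show "(\<lambda>x\<in>V. g x + h x) = restrict (poly_eval (p + q)) V"
      unfolding p(2) q(2) by (rule restrict_ext) (simp add: poly_eval_add)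
  qed
qed

lemma R_const: assumes "c \<in> K" shows "(\<lambda>x\<in>V. c) \<in> carrier R"
proof -
  show ?thesis unfolding R_carrier
  proof (rule image_eqI[OF _ coeffs_in_single[OF K assms]])
    show "(\<lambda>x\<in>V. c) = restrict (poly_eval (Poly_Mapping.single 0 c)) V"
      by (rule restrict_ext) (simp add: poly_eval_const)
  qed
qed

lemma R_one: "(\<lambda>x\<in>V. 1) \<in> carrier R" by (rule R_const[OF subring_setD(1)[OF K]])

lemma R_ext: assumes "g \<in> carrier R" "h \<in> carrier R" "\<And>x. x \<in> V \<Longrightarrow> g x = h x" shows "g = h"
proof -
  have "g \<in> extensional V" "h \<in> extensional V" using assms(1,2) unfolding R_carrier by auto
  then show ?thesis using assms(3) by (rule extensionalityI)
qed

lemma R_uminus: assumes g: "g \<in> carrier R" shows "\<ominus>\<^bsub>R\<^esub> g = (\<lambda>x\<in>V. - g x)"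
proof -
  have "(\<lambda>x\<in>V. (\<lambda>x\<in>V. - 1) x * g x) \<in> carrier R"
    by (intro R_mult_closed R_const g subring_setD(5)[OF K] subring_setD(1)[OF K])
  moreover have "(\<lambda>x\<in>V. (\<lambda>x\<in>V. - 1) x * g x) = (\<lambda>x\<in>V. - g x)" by (rule restrict_ext) simp
  ultimately have m: "(\<lambda>x\<in>V. - g x) \<in> carrier R" by simp
  show ?thesis unfolding a_inv_def m_inv_def
  proof (rule the_equality)
    show "(\<lambda>x\<in>V. - g x) \<in> carrier (add_monoid R) \<and> g \<otimes>\<^bsub>add_monoid R\<^esub> (\<lambda>x\<in>V. - g x) = \<one>\<^bsub>add_monoid R\<^esub> \<and>
      (\<lambda>x\<in>V. - g x) \<otimes>\<^bsub>add_monoid R\<^esub> g = \<one>\<^bsub>add_monoid R\<^esub>"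
      using m by (auto simp: R_simps intro!: restrict_ext)
    fix y assume "y \<in> carrier (add_monoid R) \<and> g \<otimes>\<^bsub>add_monoid R\<^esub> y = \<one>\<^bsub>add_monoid R\<^esub> \<and> y \<otimes>\<^bsub>add_monoid R\<^esub> g = \<one>\<^bsub>add_monoid R\<^esub>"
    then have y: "y \<in> carrier R" and e: "(\<lambda>x\<in>V. g x + y x) = (\<lambda>x\<in>V. 0)" by (simp_all add: R_simps)
    show "y = (\<lambda>x\<in>V. - g x)"
    proof (rule R_ext[OF y m])
      fix x assume x: "x \<in> V"
      have "g x + y x = 0" using fun_cong[OF e, of x] x by simp
      then show "y x = (\<lambda>x\<in>V. - g x) x" using x by (simp add: eq_neg_iff_add_eq_0 add.commute)
    qed
  qed
qed

lemma R_f: "f j \<in> carrier R" using f by blast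

lemma S_sub: "S \<subseteq> carrier R"
proof -
  have "submonoid (carrier R) R"
    by unfold_locales (use R_mult_closed R_one in \<open>simp_all add: R_simps\<close>)
  then show ?thesis unfolding mult_set_def by (intro hull_minimal f)
qed

lemma S_one: "(\<lambda>x\<in>V. 1) \<in> S"
  unfolding mult_set_def hull_def
proof (rule InterI)
  fix H assume "H \<in> {H. submonoid H R \<and> range f \<subseteq> H}"
  then have "submonoid H R" by simp
  from submonoid.one_closed[OF this] show "(\<lambda>x\<in>V. 1) \<in> H" unfolding R_simps .
qed

lemma S_mult: assumes "s \<in> S" "t \<in> S" shows "(\<lambda>x\<in>V. s x * t x) \<in> S"
  unfolding mult_set_def hull_def
proof (rule InterI)
  fix H assume "H \<in> {H. submonoid H R \<and> range f \<subseteq> H}"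
  then have H: "submonoid H R" "range f \<subseteq> H" by auto
  have "S \<subseteq> H" unfolding mult_set_def using hull_minimal[of "range f" H "\<lambda>S. submonoid S R"] H by simp
  then have "s \<otimes>\<^bsub>R\<^esub> t \<in> H" using assms by (intro submonoid.m_closed[OF H(1)]) auto
  then show "(\<lambda>x\<in>V. s x * t x) \<in> H" by (simp add: R_simps)
qed

lemma S_f: "f j \<in> S" unfolding mult_set_def by (intro hull_inc) simp

lemma S_pow: "(\<lambda>x\<in>V. f j x ^ n) \<in> S"
proof (induction n)
  case (Suc n)
  have e: "(\<lambda>x\<in>V. (\<lambda>x\<in>V. f j x ^ n) x * f j x) = (\<lambda>x\<in>V. f j x ^ Suc n)"
    by (rule restrict_ext) (simp add: mult.commute)
  show ?case using S_mult[OF Suc S_f[of j]] unfolding e .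
next
  case 0
  have "(\<lambda>x\<in>V. f j x ^ 0) = (\<lambda>x\<in>V. 1)" by (rule restrict_ext) simp
  then show ?case using S_one by (simp only:)
qed

lemma S_prod: "finite J \<Longrightarrow> (\<lambda>x\<in>V. \<Prod>j\<in>J. f j x) \<in> S"
proof (induction J rule: finite_induct)
  case (insert j J)
  have e: "(\<lambda>x\<in>V. f j x * (\<lambda>x\<in>V. \<Prod>j\<in>J. f j x) x) = (\<lambda>x\<in>V. \<Prod>j\<in>insert j J. f j x)"
    by (rule restrict_ext) (simp add: insert.hyps)
  show ?case using S_mult[OF S_f[of j] insert.IH] unfolding e .
next
  case empty
  have "(\<lambda>x\<in>V. \<Prod>j\<in>{}. f j x) = (\<lambda>x\<in>V. 1)" by (rule restrict_ext) simp
  then show ?case using S_one by (simp only:)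
qed

lemma S_support: assumes "s \<in> S" shows "\<exists>J. finite J \<and> (\<forall>x\<in>V. (\<forall>j\<in>J. f j x \<noteq> 0) \<longrightarrow> s x \<noteq> 0)"
proof -
  define H where "H = {s \<in> carrier R. \<exists>J. finite J \<and> (\<forall>x\<in>V. (\<forall>j\<in>J. f j x \<noteq> 0) \<longrightarrow> s x \<noteq> 0)}"
  have "submonoid H R"
  proof
    show "H \<subseteq> carrier R" by (auto simp: H_def)
    show "\<one>\<^bsub>R\<^esub> \<in> H" unfolding H_def R_simps using R_one by (auto intro!: exI[of _ "{}"])
    fix s t assume s: "s \<in> H" and t: "t \<in> H"
    obtain I where I: "finite I" "\<forall>x\<in>V. (\<forall>j\<in>I. f j x \<noteq> 0) \<longrightarrow> s x \<noteq> 0" using s unfolding H_def by blast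
    obtain J where J: "finite J" "\<forall>x\<in>V. (\<forall>j\<in>J. f j x \<noteq> 0) \<longrightarrow> t x \<noteq> 0" using t unfolding H_def by blast
    have "\<forall>x\<in>V. (\<forall>j\<in>I \<union> J. f j x \<noteq> 0) \<longrightarrow> (\<lambda>x\<in>V. s x * t x) x \<noteq> 0" using I(2) J(2) by simp
    moreover have "(\<lambda>x\<in>V. s x * t x) \<in> carrier R" using s t by (intro R_mult_closed) (simp_all add: H_def)
    ultimately show "s \<otimes>\<^bsub>R\<^esub> t \<in> H" unfolding H_def R_simps using I(1) J(1) by blast
  qed
  moreover have "range f \<subseteq> H"
  proof
    fix g assume "g \<in> range f"
    then obtain j where "g = f j" by blast
    then show "g \<in> H" unfolding H_def using R_f by (auto intro!: exI[of _ "{j}"])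
  qed
  ultimately have "S \<subseteq> H" unfolding mult_set_def by (intro hull_minimal)
  then show ?thesis using assms by (auto simp: H_def)
qed

definition eqv :: "(complex ^ 'n \<Rightarrow> complex) \<times> (complex ^ 'n \<Rightarrow> complex) \<Rightarrow>
  (complex ^ 'n \<Rightarrow> complex) \<times> (complex ^ 'n \<Rightarrow> complex) \<Rightarrow> bool" where
  "eqv a b \<longleftrightarrow> (\<exists>u\<in>S. \<forall>x\<in>V. u x \<noteq> 0 \<longrightarrow> fst a x * snd b x = fst b x * snd a x)"

lemma fraction_rel_iff:
  assumes "a \<in> carrier R" "s \<in> S" "b \<in> carrier R" "t \<in> S"
  shows "((a, s), (b, t)) \<in> fraction_rel R S \<longleftrightarrow> eqv (a, s) (b, t)"
proof -
  have at: "(\<lambda>x\<in>V. a x * t x) \<in> carrier R" and bs: "(\<lambda>x\<in>V. b x * s x) \<in> carrier R"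
    using assms S_sub by (auto intro!: R_mult_closed)
  have e: "u \<otimes>\<^bsub>R\<^esub> (a \<otimes>\<^bsub>R\<^esub> t \<ominus>\<^bsub>R\<^esub> b \<otimes>\<^bsub>R\<^esub> s) = \<zero>\<^bsub>R\<^esub> \<longleftrightarrow>
    (\<forall>x\<in>V. u x \<noteq> 0 \<longrightarrow> a x * t x = b x * s x)" for u
  proof -
    have "u \<otimes>\<^bsub>R\<^esub> (a \<otimes>\<^bsub>R\<^esub> t \<ominus>\<^bsub>R\<^esub> b \<otimes>\<^bsub>R\<^esub> s) = (\<lambda>x\<in>V. u x * (a x * t x - b x * s x))"
      unfolding a_minus_def R_simps R_uminus[OF bs] by (rule restrict_ext) simp
    moreover have "(\<lambda>x\<in>V. u x * (a x * t x - b x * s x)) = (\<lambda>x\<in>V. 0) \<longleftrightarrow>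
      (\<forall>x\<in>V. u x * (a x * t x - b x * s x) = 0)" by (auto simp: restrict_def fun_eq_iff)
    ultimately show ?thesis by (auto simp: R_simps)
  qed
  show ?thesis unfolding fraction_rel_def eqv_def using assms by (simp add: e)
qed

lemma eqv_refl: "eqv a a" unfolding eqv_def using S_one by auto
lemma eqv_sym: assumes "eqv a b" shows "eqv b a"
proof -
  obtain u where "u \<in> S" "\<forall>x\<in>V. u x \<noteq> 0 \<longrightarrow> fst a x * snd b x = fst b x * snd a x"
    using assms unfolding eqv_def ..
  then show ?thesis unfolding eqv_def by (intro bexI[of _ u]) simp_all
qed
lemma eqv_trans:
  assumes b: "snd b \<in> S" and ab: "eqv a b" and bc: "eqv b c" shows "eqv a c"
proof -
  obtain u where u: "u \<in> S" "\<forall>x\<in>V. u x \<noteq> 0 \<longrightarrow> fst a x * snd b x = fst b x * snd a x" using ab unfolding eqv_def ..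
  obtain w where w: "w \<in> S" "\<forall>x\<in>V. w x \<noteq> 0 \<longrightarrow> fst b x * snd c x = fst c x * snd b x" using bc unfolding eqv_def ..
  define r where "r = (\<lambda>x\<in>V. (\<lambda>x\<in>V. u x * w x) x * snd b x)"
  have "r \<in> S" unfolding r_def by (intro S_mult u w b)
  moreover have "fst a x * snd c x = fst c x * snd a x" if x: "x \<in> V" "r x \<noteq> 0" for x
  proof -
    have nz: "u x \<noteq> 0" "w x \<noteq> 0" "snd b x \<noteq> 0" using x by (auto simp: r_def)
    have "(fst a x * snd c x) * snd b x = (fst a x * snd b x) * snd c x" by simp
    also have "\<dots> = (fst b x * snd c x) * snd a x" using u(2) nz x(1) by simp
    also have "\<dots> = (fst c x * snd a x) * snd b x" using w(2) nz x(1) by simp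
    finally show ?thesis using nz by simp
  qed
  ultimately show ?thesis unfolding eqv_def by blast
qed

abbreviation "fr a s \<equiv> fraction R S a s"

lemma fraction_eq: assumes "a \<in> carrier R" "s \<in> S"
  shows "fr a s = {(b, t). b \<in> carrier R \<and> t \<in> S \<and> eqv (a, s) (b, t)}"
proof -
  have "((a, s), (b, t)) \<in> fraction_rel R S \<longleftrightarrow> b \<in> carrier R \<and> t \<in> S \<and> eqv (a, s) (b, t)" for b t
  proof
    assume l: "((a, s), (b, t)) \<in> fraction_rel R S"
    then have "b \<in> carrier R" "t \<in> S" unfolding fraction_rel_def by auto
    then show "b \<in> carrier R \<and> t \<in> S \<and> eqv (a, s) (b, t)" using l fraction_rel_iff[OF assms] by blast
  qed (use fraction_rel_iff[OF assms] in blast)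
  then show ?thesis unfolding fraction_def by auto
qed

lemma fr_eq_iff:
  assumes "a \<in> carrier R" "s \<in> S" "b \<in> carrier R" "t \<in> S"
  shows "fr a s = fr b t \<longleftrightarrow> eqv (a, s) (b, t)"
proof
  assume "fr a s = fr b t"
  moreover have "(b, t) \<in> fr b t" using assms eqv_refl by (simp add: fraction_eq)
  ultimately have "(b, t) \<in> fr a s" by simp
  then show "eqv (a, s) (b, t)" using assms by (simp add: fraction_eq)
next
  assume e: "eqv (a, s) (b, t)"
  have "eqv (a, s) (c, r) \<longleftrightarrow> eqv (b, t) (c, r)" for c r
    using eqv_trans[of "(b, t)" "(a, s)" "(c, r)"] eqv_trans[of "(a, s)" "(b, t)" "(c, r)"] e eqv_sym[OF e] assms
    by auto
  then show "fr a s = fr b t" using assms by (simp add: fraction_eq)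
qed

lemma L_carrier: "carrier L = {fr a s |a s. a \<in> carrier R \<and> s \<in> S}"
  unfolding localized_ring_def localization_def quotient_def fraction_def by auto

lemma L_carrierI: "a \<in> carrier R \<Longrightarrow> s \<in> S \<Longrightarrow> fr a s \<in> carrier L" unfolding L_carrier by blast

lemma L_one: "\<one>\<^bsub>L\<^esub> = fr (\<lambda>x\<in>V. 1) (\<lambda>x\<in>V. 1)" and L_zero: "\<zero>\<^bsub>L\<^esub> = fr (\<lambda>x\<in>V. 0) (\<lambda>x\<in>V. 1)"
  by (simp_all add: localized_ring_def localization_def R_simps)

lemma UN_fractions:
  assumes "a \<in> carrier R" "s \<in> S" "b \<in> carrier R" "t \<in> S"
    and "\<And>a' s' b' t'. a' \<in> carrier R \<Longrightarrow> s' \<in> S \<Longrightarrow> b' \<in> carrier R \<Longrightarrow> t' \<in> S \<Longrightarrow>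
      eqv (a, s) (a', s') \<Longrightarrow> eqv (b, t) (b', t') \<Longrightarrow> F a' s' b' t' = Xs"
  shows "(\<Union>(a, s)\<in>fr a s. \<Union>(b, t)\<in>fr b t. F a s b t) = Xs"
proof -
  have 1: "(a, s) \<in> fr a s" "(b, t) \<in> fr b t" using assms(1-4) eqv_refl by (simp_all add: fraction_eq)
  have 2: "F a' s' b' t' = Xs" if "(a', s') \<in> fr a s" "(b', t') \<in> fr b t" for a' s' b' t'
    using that assms(1-4) by (intro assms(5)) (simp_all add: fraction_eq)
  show ?thesis
  proof (rule equalityI)
    show "(\<Union>(a, s)\<in>fr a s. \<Union>(b, t)\<in>fr b t. F a s b t) \<subseteq> Xs"
    proof (rule UN_least)
      fix x assume x: "x \<in> fr a s"
      have "(\<Union>(b, t)\<in>fr b t. F (fst x) (snd x) b t) \<subseteq> Xs"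
      proof (rule UN_least)
        fix y assume y: "y \<in> fr b t"
        have "F (fst x) (snd x) (fst y) (snd y) = Xs" using 2[of "fst x" "snd x" "fst y" "snd y"] x y by simp
        then show "(case y of (b, t) \<Rightarrow> F (fst x) (snd x) b t) \<subseteq> Xs" by (simp add: case_prod_beta)
      qed
      then show "(case x of (a, s) \<Rightarrow> \<Union>(b, t)\<in>fr b t. F a s b t) \<subseteq> Xs" by (simp add: case_prod_beta)
    qed
    have "Xs \<subseteq> (\<Union>(b, t)\<in>fr b t. F a s b t)" using 1(2) 2[OF 1] by blast
    then show "Xs \<subseteq> (\<Union>(a, s)\<in>fr a s. \<Union>(b, t)\<in>fr b t. F a s b t)" using 1(1) by blast
  qed
qed

lemma L_mult:
  assumes A: "a \<in> carrier R" "s \<in> S" "b \<in> carrier R" "t \<in> S"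
  shows "fr a s \<otimes>\<^bsub>L\<^esub> fr b t = fr (\<lambda>x\<in>V. a x * b x) (\<lambda>x\<in>V. s x * t x)"
proof -
  have "fr a s \<otimes>\<^bsub>L\<^esub> fr b t = (\<Union>(a, s)\<in>fr a s. \<Union>(b, t)\<in>fr b t. fr (\<lambda>x\<in>V. a x * b x) (\<lambda>x\<in>V. s x * t x))"
    by (simp add: localized_ring_def localization_def R_simps)
  also have "\<dots> = fr (\<lambda>x\<in>V. a x * b x) (\<lambda>x\<in>V. s x * t x)"
  proof (rule UN_fractions[OF A])
    fix a' s' b' t' assume A': "a' \<in> carrier R" "s' \<in> S" "b' \<in> carrier R" "t' \<in> S"
      and e1: "eqv (a, s) (a', s')" and e2: "eqv (b, t) (b', t')"
    obtain u where u: "u \<in> S" "\<forall>x\<in>V. u x \<noteq> 0 \<longrightarrow> a x * s' x = a' x * s x" using e1 unfolding eqv_def by auto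
    obtain w where w: "w \<in> S" "\<forall>x\<in>V. w x \<noteq> 0 \<longrightarrow> b x * t' x = b' x * t x" using e2 unfolding eqv_def by auto
    show "fr (\<lambda>x\<in>V. a' x * b' x) (\<lambda>x\<in>V. s' x * t' x) = fr (\<lambda>x\<in>V. a x * b x) (\<lambda>x\<in>V. s x * t x)"
    proof (subst fr_eq_iff)
      have "\<forall>x\<in>V. (\<lambda>x\<in>V. u x * w x) x \<noteq> 0 \<longrightarrow> (a' x * b' x) * (s x * t x) = (a x * b x) * (s' x * t' x)"
      proof (intro ballI impI)
        fix x assume x: "x \<in> V" "(\<lambda>x\<in>V. u x * w x) x \<noteq> 0"
        then have "a x * s' x = a' x * s x" "b x * t' x = b' x * t x" using u(2) w(2) by auto
        then have "(a x * s' x) * (b x * t' x) = (a' x * s x) * (b' x * t x)" by simp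
        then show "(a' x * b' x) * (s x * t x) = (a x * b x) * (s' x * t' x)" by (simp add: mult_ac)
      qed
      then show "eqv (\<lambda>x\<in>V. a' x * b' x, \<lambda>x\<in>V. s' x * t' x) (\<lambda>x\<in>V. a x * b x, \<lambda>x\<in>V. s x * t x)"
        unfolding eqv_def using S_mult[OF u(1) w(1)] by (intro bexI) auto
    qed (use A A' in \<open>auto intro!: R_mult_closed S_mult\<close>)
  qed
  finally show ?thesis .
qed

lemma L_add:
  assumes A: "a \<in> carrier R" "s \<in> S" "b \<in> carrier R" "t \<in> S"
  shows "fr a s \<oplus>\<^bsub>L\<^esub> fr b t = fr (\<lambda>x\<in>V. a x * t x + b x * s x) (\<lambda>x\<in>V. s x * t x)"
proof -
  have cl: "(\<lambda>x\<in>V. a x * t x + b x * s x) \<in> carrier R" if "a \<in> carrier R" "s \<in> S" "b \<in> carrier R" "t \<in> S" for a s b t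
  proof -
    have "(\<lambda>x\<in>V. (\<lambda>x\<in>V. a x * t x) x + (\<lambda>x\<in>V. b x * s x) x) \<in> carrier R"
      using that S_sub by (intro R_add_closed R_mult_closed) auto
    moreover have "(\<lambda>x\<in>V. (\<lambda>x\<in>V. a x * t x) x + (\<lambda>x\<in>V. b x * s x) x) = (\<lambda>x\<in>V. a x * t x + b x * s x)"
      by (rule restrict_ext) simp
    ultimately show ?thesis by simp
  qed
  have e: "(\<lambda>x\<in>V. (\<lambda>x\<in>V. a x * t x) x + (\<lambda>x\<in>V. b x * s x) x) = (\<lambda>x\<in>V. a x * t x + b x * s x)" for a s b t
    by (rule restrict_ext) simp
  have "fr a s \<oplus>\<^bsub>L\<^esub> fr b t =
    (\<Union>(a, s)\<in>fr a s. \<Union>(b, t)\<in>fr b t. fr (a \<otimes>\<^bsub>R\<^esub> t \<oplus>\<^bsub>R\<^esub> b \<otimes>\<^bsub>R\<^esub> s) (s \<otimes>\<^bsub>R\<^esub> t))"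
    by (simp add: localized_ring_def localization_def)
  also have "\<dots> = (\<Union>(a, s)\<in>fr a s. \<Union>(b, t)\<in>fr b t. fr (\<lambda>x\<in>V. a x * t x + b x * s x) (\<lambda>x\<in>V. s x * t x))"
    unfolding R_simps e ..
  also have "\<dots> = fr (\<lambda>x\<in>V. a x * t x + b x * s x) (\<lambda>x\<in>V. s x * t x)"
  proof (rule UN_fractions[OF A])
    fix a' s' b' t' assume A': "a' \<in> carrier R" "s' \<in> S" "b' \<in> carrier R" "t' \<in> S"
      and e1: "eqv (a, s) (a', s')" and e2: "eqv (b, t) (b', t')"
    obtain u where u: "u \<in> S" "\<forall>x\<in>V. u x \<noteq> 0 \<longrightarrow> a x * s' x = a' x * s x" using e1 unfolding eqv_def by auto
    obtain w where w: "w \<in> S" "\<forall>x\<in>V. w x \<noteq> 0 \<longrightarrow> b x * t' x = b' x * t x" using e2 unfolding eqv_def by auto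
    show "fr (\<lambda>x\<in>V. a' x * t' x + b' x * s' x) (\<lambda>x\<in>V. s' x * t' x) =
      fr (\<lambda>x\<in>V. a x * t x + b x * s x) (\<lambda>x\<in>V. s x * t x)"
    proof (subst fr_eq_iff)
      have "\<forall>x\<in>V. (\<lambda>x\<in>V. u x * w x) x \<noteq> 0 \<longrightarrow>
        (a' x * t' x + b' x * s' x) * (s x * t x) = (a x * t x + b x * s x) * (s' x * t' x)"
      proof (intro ballI impI)
        fix x assume x: "x \<in> V" "(\<lambda>x\<in>V. u x * w x) x \<noteq> 0"
        then have e: "a x * s' x = a' x * s x" "b x * t' x = b' x * t x" using u(2) w(2) by auto
        have "(a x * t x + b x * s x) * (s' x * t' x)
          = (a x * s' x) * (t x * t' x) + (b x * t' x) * (s x * s' x)" by (simp add: algebra_simps)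
        also have "\<dots> = (a' x * t' x + b' x * s' x) * (s x * t x)" unfolding e by (simp add: algebra_simps)
        finally show "(a' x * t' x + b' x * s' x) * (s x * t x) = (a x * t x + b x * s x) * (s' x * t' x)" by simp
      qed
      then show "eqv (\<lambda>x\<in>V. a' x * t' x + b' x * s' x, \<lambda>x\<in>V. s' x * t' x)
        (\<lambda>x\<in>V. a x * t x + b x * s x, \<lambda>x\<in>V. s x * t x)"
        unfolding eqv_def using S_mult[OF u(1) w(1)] by (intro bexI) auto
    qed (use A A' in \<open>auto intro!: cl S_mult\<close>)
  qed
  finally show ?thesis .
qed

text \<open>Elements of the localization are classes of fractions. Sums, products and equality are easier
  to follow on the functions which such fractions define away from the zeros of their denominators.\<close>

definition rep :: "((complex ^ 'n \<Rightarrow> complex) \<times> (complex ^ 'n \<Rightarrow> complex)) set \<Rightarrow>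
  (complex ^ 'n \<Rightarrow> complex) \<Rightarrow> bool" where
  "rep l F \<longleftrightarrow> (\<exists>a s. a \<in> carrier R \<and> s \<in> S \<and> l = fr a s \<and> (\<forall>x\<in>V. s x \<noteq> 0 \<longrightarrow> F x * s x = a x))"

lemma repI: "a \<in> carrier R \<Longrightarrow> s \<in> S \<Longrightarrow> (\<And>x. x \<in> V \<Longrightarrow> s x \<noteq> 0 \<Longrightarrow> F x * s x = a x) \<Longrightarrow> rep (fr a s) F"
  unfolding rep_def by blast

lemma rep_carrier: "rep l F \<Longrightarrow> l \<in> carrier L" unfolding rep_def using L_carrierI by blast

lemma rep_ex: assumes "l \<in> carrier L" shows "\<exists>F. rep l F"
proof -
  obtain a s where as: "a \<in> carrier R" "s \<in> S" "l = fr a s" using assms unfolding L_carrier by blast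
  have "rep (fr a s) (\<lambda>x. a x / s x)" by (rule repI[OF as(1,2)]) simp
  then show ?thesis using as(3) by blast
qed

lemma rep_mult: assumes "rep l F" "rep m G" shows "rep (l \<otimes>\<^bsub>L\<^esub> m) (\<lambda>x. F x * G x)"
proof -
  obtain a s where a: "a \<in> carrier R" "s \<in> S" "l = fr a s" "\<forall>x\<in>V. s x \<noteq> 0 \<longrightarrow> F x * s x = a x"
    using assms(1) unfolding rep_def by blast
  obtain b t where b: "b \<in> carrier R" "t \<in> S" "m = fr b t" "\<forall>x\<in>V. t x \<noteq> 0 \<longrightarrow> G x * t x = b x"
    using assms(2) unfolding rep_def by blast
  show ?thesis unfolding a(3) b(3) L_mult[OF a(1,2) b(1,2)]
  proof (rule repI[OF R_mult_closed[OF a(1) b(1)] S_mult[OF a(2) b(2)]])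
    fix x assume x: "x \<in> V" "(\<lambda>x\<in>V. s x * t x) x \<noteq> 0"
    then have e: "a x = F x * s x" "b x = G x * t x" using a(4) b(4) by auto
    show "F x * G x * (\<lambda>x\<in>V. s x * t x) x = (\<lambda>x\<in>V. a x * b x) x"
      using x(1) by (simp add: e mult_ac)
  qed
qed

lemma rep_add: assumes "rep l F" "rep m G" shows "rep (l \<oplus>\<^bsub>L\<^esub> m) (\<lambda>x. F x + G x)"
proof -
  obtain a s where a: "a \<in> carrier R" "s \<in> S" "l = fr a s" "\<forall>x\<in>V. s x \<noteq> 0 \<longrightarrow> F x * s x = a x"
    using assms(1) unfolding rep_def by blast
  obtain b t where b: "b \<in> carrier R" "t \<in> S" "m = fr b t" "\<forall>x\<in>V. t x \<noteq> 0 \<longrightarrow> G x * t x = b x"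
    using assms(2) unfolding rep_def by blast
  have "(\<lambda>x\<in>V. (\<lambda>x\<in>V. a x * t x) x + (\<lambda>x\<in>V. b x * s x) x) \<in> carrier R"
    using a b S_sub by (intro R_add_closed R_mult_closed) auto
  moreover have "(\<lambda>x\<in>V. (\<lambda>x\<in>V. a x * t x) x + (\<lambda>x\<in>V. b x * s x) x) = (\<lambda>x\<in>V. a x * t x + b x * s x)"
    by (rule restrict_ext) simp
  ultimately have c: "(\<lambda>x\<in>V. a x * t x + b x * s x) \<in> carrier R" by simp
  show ?thesis unfolding a(3) b(3) L_add[OF a(1,2) b(1,2)]
  proof (rule repI[OF c S_mult[OF a(2) b(2)]])
    fix x assume x: "x \<in> V" "(\<lambda>x\<in>V. s x * t x) x \<noteq> 0"
    then have e: "a x = F x * s x" "b x = G x * t x" using a(4) b(4) by auto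
    show "(F x + G x) * (\<lambda>x\<in>V. s x * t x) x = (\<lambda>x\<in>V. a x * t x + b x * s x) x"
      using x(1) by (simp add: e algebra_simps)
  qed
qed

lemma rep_unique_eq:
  assumes "rep l F" "rep m G" "\<exists>u\<in>S. \<forall>x\<in>V. u x \<noteq> 0 \<longrightarrow> F x = G x" shows "l = m"
proof -
  obtain a s where a: "a \<in> carrier R" "s \<in> S" "l = fr a s" "\<forall>x\<in>V. s x \<noteq> 0 \<longrightarrow> F x * s x = a x"
    using assms(1) unfolding rep_def by blast
  obtain b t where b: "b \<in> carrier R" "t \<in> S" "m = fr b t" "\<forall>x\<in>V. t x \<noteq> 0 \<longrightarrow> G x * t x = b x"
    using assms(2) unfolding rep_def by blast
  obtain u where u: "u \<in> S" "\<forall>x\<in>V. u x \<noteq> 0 \<longrightarrow> F x = G x" using assms(3) by blast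
  define r where "r = (\<lambda>x\<in>V. (\<lambda>x\<in>V. s x * t x) x * u x)"
  have r: "r \<in> S" unfolding r_def by (intro S_mult a b u)
  have "a x * t x = b x * s x" if x: "x \<in> V" "r x \<noteq> 0" for x
  proof -
    have "s x \<noteq> 0" "t x \<noteq> 0" "u x \<noteq> 0" using x by (auto simp: r_def)
    then have e: "a x = F x * s x" "b x = G x * t x" "F x = G x" using a(4) b(4) u(2) x(1) by auto
    show ?thesis by (simp add: e)
  qed
  then have "eqv (a, s) (b, t)" unfolding eqv_def using r by (intro bexI[of _ r]) auto
  then show ?thesis unfolding a(3) b(3) using fr_eq_iff[OF a(1,2) b(1,2)] by simp
qed

lemma rep_eq: "rep l F \<Longrightarrow> rep m F \<Longrightarrow> l = m"
  using rep_unique_eq S_one by blast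

lemma rep_one: "rep \<one>\<^bsub>L\<^esub> (\<lambda>x. 1)" unfolding L_one by (rule repI) (use R_one S_one in auto)
lemma rep_zero: "rep \<zero>\<^bsub>L\<^esub> (\<lambda>x. 0)" unfolding L_zero
  by (rule repI) (use R_const[OF subring_setD(2)[OF K]] S_one in auto)

lemma L_comm_monoid: "comm_monoid L"
proof (rule comm_monoidI)
  fix x y z assume x: "x \<in> carrier L" and y: "y \<in> carrier L" and z: "z \<in> carrier L"
  from rep_ex[OF x] rep_ex[OF y] rep_ex[OF z] obtain F G H where r: "rep x F" "rep y G" "rep z H" by blast
  show "x \<otimes>\<^bsub>L\<^esub> y \<otimes>\<^bsub>L\<^esub> z = x \<otimes>\<^bsub>L\<^esub> (y \<otimes>\<^bsub>L\<^esub> z)"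
    using rep_mult[OF rep_mult[OF r(1,2)] r(3)] rep_mult[OF r(1) rep_mult[OF r(2,3)]]
    by (simp add: mult.assoc rep_eq)
next
  fix x y assume x: "x \<in> carrier L" and y: "y \<in> carrier L"
  from rep_ex[OF x] rep_ex[OF y] obtain F G where r: "rep x F" "rep y G" by blast
  show "x \<otimes>\<^bsub>L\<^esub> y \<in> carrier L" by (rule rep_carrier[OF rep_mult[OF r]])
  show "x \<otimes>\<^bsub>L\<^esub> y = y \<otimes>\<^bsub>L\<^esub> x"
    using rep_mult[OF r] rep_mult[OF r(2,1)] by (simp add: mult.commute rep_eq)
next
  fix x assume x: "x \<in> carrier L"
  from rep_ex[OF x] obtain F where r: "rep x F" by blast
  show "\<one>\<^bsub>L\<^esub> \<otimes>\<^bsub>L\<^esub> x = x" using rep_mult[OF rep_one r] r by (simp add: rep_eq)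
qed (rule rep_carrier[OF rep_one])

lemma L_abelian_monoid: "abelian_monoid L"
proof (rule abelian_monoidI)
  fix x y z assume x: "x \<in> carrier L" and y: "y \<in> carrier L" and z: "z \<in> carrier L"
  from rep_ex[OF x] rep_ex[OF y] rep_ex[OF z] obtain F G H where r: "rep x F" "rep y G" "rep z H" by blast
  show "x \<oplus>\<^bsub>L\<^esub> y \<oplus>\<^bsub>L\<^esub> z = x \<oplus>\<^bsub>L\<^esub> (y \<oplus>\<^bsub>L\<^esub> z)"
    using rep_add[OF rep_add[OF r(1,2)] r(3)] rep_add[OF r(1) rep_add[OF r(2,3)]]
    by (simp add: add.assoc rep_eq)
next
  fix x y assume x: "x \<in> carrier L" and y: "y \<in> carrier L"
  from rep_ex[OF x] rep_ex[OF y] obtain F G where r: "rep x F" "rep y G" by blast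
  show "x \<oplus>\<^bsub>L\<^esub> y \<in> carrier L" by (rule rep_carrier[OF rep_add[OF r]])
  show "x \<oplus>\<^bsub>L\<^esub> y = y \<oplus>\<^bsub>L\<^esub> x"
    using rep_add[OF r] rep_add[OF r(2,1)] by (simp add: add.commute rep_eq)
next
  fix x assume x: "x \<in> carrier L"
  from rep_ex[OF x] obtain F where r: "rep x F" by blast
  show "\<zero>\<^bsub>L\<^esub> \<oplus>\<^bsub>L\<^esub> x = x" using rep_add[OF rep_zero r] r by (simp add: rep_eq)
qed (rule rep_carrier[OF rep_zero])

lemma rep_finsum:
  assumes "finite I" "\<And>i. i \<in> I \<Longrightarrow> rep (l i) (F i)"
  shows "rep (finsum L l I) (\<lambda>x. \<Sum>i\<in>I. F i x)"
  using assms
proof (induction I rule: finite_induct)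
  case empty
  then show ?case using rep_zero abelian_monoid.finsum_empty[OF L_abelian_monoid, of l] by simp
next
  case (insert i I)
  have "l i \<in> carrier L" "l \<in> I \<rightarrow> carrier L" using insert.prems rep_carrier by auto
  then have "finsum L l (insert i I) = l i \<oplus>\<^bsub>L\<^esub> finsum L l I"
    by (intro abelian_monoid.finsum_insert[OF L_abelian_monoid] insert.hyps)
  then show ?case using rep_add[of "l i" "F i" "finsum L l I"] insert by simp
qed

lemma rep_finprod:
  assumes "finite I" "\<And>i. i \<in> I \<Longrightarrow> rep (l i) (F i)"
  shows "rep (finprod L l I) (\<lambda>x. \<Prod>i\<in>I. F i x)"
  using assms
proof (induction I rule: finite_induct)
  case empty
  then show ?case using rep_one comm_monoid.finprod_empty[OF L_comm_monoid, of l] by simp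
next
  case (insert i I)
  have "l i \<in> carrier L" "l \<in> I \<rightarrow> carrier L" using insert.prems rep_carrier by auto
  then have "finprod L l (insert i I) = l i \<otimes>\<^bsub>L\<^esub> finprod L l I"
    by (intro comm_monoid.finprod_insert[OF L_comm_monoid] insert.hyps)
  then show ?case using rep_mult[of "l i" "F i" "finprod L l I"] insert by simp
qed

lemma rep_localized: "g \<in> carrier R \<Longrightarrow> rep (localized K V f g) g"
  unfolding localized_def R_simps by (rule repI) (use S_one in auto)

lemma rep_nat_pow: assumes "rep l F" shows "rep (l [^]\<^bsub>L\<^esub> (n::nat)) (\<lambda>x. F x ^ n)"
proof (induction n)
  case (Suc n)
  show ?case using rep_mult[OF Suc assms] comm_monoid.axioms(1)[OF L_comm_monoid]
    by (simp add: monoid.nat_pow_Suc mult.commute)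
qed (use rep_one comm_monoid.axioms(1)[OF L_comm_monoid] in \<open>simp add: monoid.nat_pow_0\<close>)

lemma rep_int_pow: "rep (localized K V f (f j) [^]\<^bsub>L\<^esub> (k::int)) (\<lambda>x. f j x powi k)"
proof (cases "k \<ge> 0")
  case True
  then have "localized K V f (f j) [^]\<^bsub>L\<^esub> k = localized K V f (f j) [^]\<^bsub>L\<^esub> nat k"
    by (simp add: int_pow_def nat_pow_def)
  then show ?thesis using rep_nat_pow[OF rep_localized[OF R_f], of j "nat k"] True by (simp add: power_int_def)
next
  case False
  define n where "n = nat (- k)"
  let ?y = "localized K V f (f j) [^]\<^bsub>L\<^esub> n"
  have e: "localized K V f (f j) [^]\<^bsub>L\<^esub> k = inv\<^bsub>L\<^esub> ?y"
    using False by (simp add: int_pow_def nat_pow_def n_def)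
  have y: "rep ?y (\<lambda>x. f j x ^ n)" by (rule rep_nat_pow[OF rep_localized[OF R_f]])
  let ?z = "fr (\<lambda>x\<in>V. 1) (\<lambda>x\<in>V. f j x ^ n)"
  have z: "rep ?z (\<lambda>x. inverse (f j x ^ n))" by (rule repI[OF R_one S_pow]) auto
  have "?y \<otimes>\<^bsub>L\<^esub> ?z = \<one>\<^bsub>L\<^esub>"
    by (rule rep_unique_eq[OF rep_mult[OF y z] rep_one]) (rule bexI[OF _ S_pow[of j n]], simp)
  then have "inv\<^bsub>L\<^esub> ?y = ?z"
    by (intro comm_monoid.comm_inv_char[OF L_comm_monoid] rep_carrier[OF y] rep_carrier[OF z])
  moreover have "inverse (f j x ^ n) = f j x powi k" for x
    using False by (simp add: power_int_def n_def power_inverse)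
  ultimately show ?thesis using z unfolding e by simp
qed

lemma rep_laurent_eval:
  assumes "p \<in> coeffs_in K" shows "rep (laurent_eval K V f p) (\<lambda>x. laurent_val (\<lambda>j. f j x) p)"
proof -
  let ?m = "\<lambda>\<omega>. \<Otimes>\<^bsub>L\<^esub> j \<in> Poly_Mapping.keys \<omega>. localized K V f (f j) [^]\<^bsub>L\<^esub> Poly_Mapping.lookup \<omega> j"
  have m: "rep (?m \<omega>) (\<lambda>x. \<Prod>j\<in>Poly_Mapping.keys \<omega>. f j x powi Poly_Mapping.lookup \<omega> j)" for \<omega>
    by (intro rep_finprod rep_int_pow) simp
  have "rep (localized K V f (\<lambda>x\<in>V. Poly_Mapping.lookup p \<omega>) \<otimes>\<^bsub>L\<^esub> ?m \<omega>)
    (\<lambda>x. (\<lambda>x\<in>V. Poly_Mapping.lookup p \<omega>) x * (\<Prod>j\<in>Poly_Mapping.keys \<omega>. f j x powi Poly_Mapping.lookup \<omega> j))" for \<omega>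
    using assms by (intro rep_mult rep_localized R_const m) (simp add: coeffs_in_iff)
  then have "rep (laurent_eval K V f p) (\<lambda>x. \<Sum>\<omega>\<in>Poly_Mapping.keys p. (\<lambda>x\<in>V. Poly_Mapping.lookup p \<omega>) x *
    (\<Prod>j\<in>Poly_Mapping.keys \<omega>. f j x powi Poly_Mapping.lookup \<omega> j))"
    unfolding laurent_eval_def Let_def by (intro rep_finsum) simp_all
  then obtain a s where as: "a \<in> carrier R" "s \<in> S" "laurent_eval K V f p = fr a s"
    and v: "\<forall>x\<in>V. s x \<noteq> 0 \<longrightarrow> (\<Sum>\<omega>\<in>Poly_Mapping.keys p. (\<lambda>x\<in>V. Poly_Mapping.lookup p \<omega>) x *
    (\<Prod>j\<in>Poly_Mapping.keys \<omega>. f j x powi Poly_Mapping.lookup \<omega> j)) * s x = a x" unfolding rep_def by blast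
  show ?thesis unfolding as(3)
    by (rule repI[OF as(1,2)]) (use v in \<open>simp add: laurent_val_def mon_eval_def laurent_mono_def\<close>)
qed

text \<open>A fraction is zero in the localization iff an element of the multiplicative set, that is, a
  finite product of members of the family, annihilates its numerator. Therefore finitely many of the
  conditions \<open>f j x \<noteq> 0\<close> suffice to make a relation hold at \<open>x\<close>.\<close>

lemma relation_ideal_iff:
  "p \<in> relation_ideal K V f \<longleftrightarrow> p \<in> coeffs_in K \<and>
    (\<exists>J. finite J \<and> (\<forall>x\<in>V. (\<forall>j\<in>J. f j x \<noteq> 0) \<longrightarrow> laurent_val (\<lambda>j. f j x) p = 0))"
proof -
  have "p \<in> relation_ideal K V f \<longleftrightarrow> p \<in> coeffs_in K \<and> laurent_eval K V f p = \<zero>\<^bsub>L\<^esub>"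
    unfolding relation_ideal_def a_kernel_def' laurent_ring_def by simp
  moreover have "laurent_eval K V f p = \<zero>\<^bsub>L\<^esub> \<longleftrightarrow>
    (\<exists>J. finite J \<and> (\<forall>x\<in>V. (\<forall>j\<in>J. f j x \<noteq> 0) \<longrightarrow> laurent_val (\<lambda>j. f j x) p = 0))"
    if p: "p \<in> coeffs_in K"
  proof
    note r = rep_laurent_eval[OF p]
    assume "laurent_eval K V f p = \<zero>\<^bsub>L\<^esub>"
    moreover obtain a s where as: "a \<in> carrier R" "s \<in> S" "laurent_eval K V f p = fr a s"
      "\<forall>x\<in>V. s x \<noteq> 0 \<longrightarrow> laurent_val (\<lambda>j. f j x) p * s x = a x" using r unfolding rep_def by blast
    ultimately have "eqv (a, s) (\<lambda>x\<in>V. 0, \<lambda>x\<in>V. 1)"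
      using fr_eq_iff[OF as(1,2) R_const[OF subring_setD(2)[OF K]] S_one] by (simp add: L_zero)
    then obtain u where u: "u \<in> S" "\<forall>x\<in>V. u x \<noteq> 0 \<longrightarrow> a x = 0" unfolding eqv_def by auto
    from S_support[OF S_mult[OF as(2) u(1)]] obtain J where
      J: "finite J" "\<forall>x\<in>V. (\<forall>j\<in>J. f j x \<noteq> 0) \<longrightarrow> (\<lambda>x\<in>V. s x * u x) x \<noteq> 0" by blast
    have "laurent_val (\<lambda>j. f j x) p = 0" if x: "x \<in> V" "\<forall>j\<in>J. f j x \<noteq> 0" for x
    proof -
      have "s x \<noteq> 0" "u x \<noteq> 0" using J(2) x by auto
      then show ?thesis using as(4) u(2) x(1) by auto
    qed
    then show "\<exists>J. finite J \<and> (\<forall>x\<in>V. (\<forall>j\<in>J. f j x \<noteq> 0) \<longrightarrow> laurent_val (\<lambda>j. f j x) p = 0)"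
      using J(1) by blast
  next
    assume "\<exists>J. finite J \<and> (\<forall>x\<in>V. (\<forall>j\<in>J. f j x \<noteq> 0) \<longrightarrow> laurent_val (\<lambda>j. f j x) p = 0)"
    then obtain J where J: "finite J" "\<forall>x\<in>V. (\<forall>j\<in>J. f j x \<noteq> 0) \<longrightarrow> laurent_val (\<lambda>j. f j x) p = 0" by blast
    show "laurent_eval K V f p = \<zero>\<^bsub>L\<^esub>"
    proof (rule rep_unique_eq[OF rep_laurent_eval[OF p] rep_zero])
      show "\<exists>u\<in>S. \<forall>x\<in>V. u x \<noteq> 0 \<longrightarrow> laurent_val (\<lambda>j. f j x) p = 0"
        using S_prod[OF J(1)] J by (intro bexI[of _ "\<lambda>x\<in>V. \<Prod>j\<in>J. f j x"]) auto
    qed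
  qed
  ultimately show ?thesis by blast
qed

end

section \<open>Ideal points lie in the tropical variety\<close>

lemma tropical_zeros_iff:
  "x \<in> tropical_zeros p \<longleftrightarrow>
    \<not> (\<exists>w\<in>Poly_Mapping.keys p. \<forall>\<omega>\<in>Poly_Mapping.keys p - {w}. pairing x \<omega> < pairing x w)"
proof -
  have "ereal (pairing x w) \<le> (SUP \<omega> \<in> Poly_Mapping.keys p - {w}. ereal (pairing x \<omega>)) \<longleftrightarrow>
    \<not> (\<forall>\<omega>\<in>Poly_Mapping.keys p - {w}. pairing x \<omega> < pairing x w)" for w
  proof (cases "Poly_Mapping.keys p - {w} = {}")
    case True
    show ?thesis unfolding True by (simp add: bot_ereal_def)
  next
    case False
    have "(SUP \<omega> \<in> Poly_Mapping.keys p - {w}. ereal (pairing x \<omega>))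
      = Max ((\<lambda>\<omega>. ereal (pairing x \<omega>)) ` (Poly_Mapping.keys p - {w}))"
      by (rule cSup_eq_Max) (use False in auto)
    then show ?thesis using False by (subst \<open>_ = Max _\<close>, subst Max_ge_iff) (auto simp: not_less)
  qed
  then show ?thesis unfolding tropical_zeros_def by blast
qed

lemma norm_laurent_mono:
  assumes "\<And>j. u j \<noteq> 0"
  shows "cmod (laurent_mono u \<omega>) = exp (pairing (\<lambda>j. ln (cmod (u j))) \<omega>)"
proof -
  have "cmod (u j powi k) = exp (ln (cmod (u j)) * real_of_int k)" for j k
  proof -
    have "cmod (u j powi k) = cmod (u j) powi k" by (rule norm_power_int)
    also have "\<dots> = cmod (u j) powr real_of_int k" using assms[of j] by (simp add: powr_real_of_int')
    also have "\<dots> = exp (ln (cmod (u j)) * real_of_int k)" using assms[of j] by (simp add: powr_def mult.commute)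
    finally show ?thesis .
  qed
  then show ?thesis by (simp add: laurent_mono_def pairing_def exp_sum prod_norm[symmetric])
qed

text \<open>This isolates the term \<open>w\<close> in the vanishing sum and divides by its monomial.\<close>

lemma dominated_by_others:
  assumes u: "\<And>j. u j \<noteq> 0" and p: "laurent_val u p = 0" and w: "w \<in> Poly_Mapping.keys p"
  defines "x \<equiv> \<lambda>j. ln (cmod (u j))"
  shows "cmod (Poly_Mapping.lookup p w) \<le>
    (\<Sum>\<omega>\<in>Poly_Mapping.keys p - {w}. cmod (Poly_Mapping.lookup p \<omega>) * exp (pairing x \<omega> - pairing x w))"
proof -
  let ?t = "\<lambda>\<omega>. Poly_Mapping.lookup p \<omega> * laurent_mono u \<omega>"
  have nt: "cmod (?t \<omega>) = cmod (Poly_Mapping.lookup p \<omega>) * exp (pairing x \<omega>)" for \<omega>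
    unfolding x_def by (simp add: norm_mult norm_laurent_mono[OF u])
  have "?t w + (\<Sum>\<omega>\<in>Poly_Mapping.keys p - {w}. ?t \<omega>) = 0"
    using p sum.remove[OF finite_keys w, of ?t] by (simp add: laurent_val_def mon_eval_def)
  then have "?t w = - (\<Sum>\<omega>\<in>Poly_Mapping.keys p - {w}. ?t \<omega>)" by (simp add: eq_neg_iff_add_eq_0)
  then have "cmod (?t w) = cmod (\<Sum>\<omega>\<in>Poly_Mapping.keys p - {w}. ?t \<omega>)" by (metis norm_minus_cancel)
  also have "\<dots> \<le> (\<Sum>\<omega>\<in>Poly_Mapping.keys p - {w}. cmod (?t \<omega>))" by (rule norm_sum)
  finally have "cmod (Poly_Mapping.lookup p w) * exp (pairing x w) \<le>
    (\<Sum>\<omega>\<in>Poly_Mapping.keys p - {w}. cmod (Poly_Mapping.lookup p \<omega>) * exp (pairing x \<omega>))" by (simp only: nt)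
  from mult_right_mono[OF this, of "exp (- pairing x w)"]
  show ?thesis by (simp add: sum_distrib_right mult.assoc exp_add[symmetric])
qed

lemma pairing_zero_left: "pairing (\<lambda>_. 0) \<omega> = 0" by (simp add: pairing_def)

lemma ray_self: "v \<in> ray v" unfolding ray_def by (auto intro!: exI[of _ 1])

lemma ray_scale: assumes "c > 0" shows "ray (\<lambda>j. c * v j) = ray v"
proof (intro equalityI subsetI)
  fix w assume "w \<in> ray (\<lambda>j. c * v j)"
  then obtain d where "d > 0" "w = (\<lambda>j. d * (c * v j))" unfolding ray_def by blast
  then show "w \<in> ray v" unfolding ray_def using assms
    by (intro CollectI exI[of _ "d * c"]) (simp add: mult.assoc)
next
  fix w assume "w \<in> ray v"
  then obtain d where "d > 0" "w = (\<lambda>j. d * v j)" unfolding ray_def by blast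
  then show "w \<in> ray (\<lambda>j. c * v j)" unfolding ray_def using assms
    by (intro CollectI exI[of _ "d / c"]) simp
qed

text \<open>For \<open>v j0 \<noteq> 0\<close> the ratio \<open>x j / abs (x j0)\<close> does not depend on the choice of \<open>x\<close> on its ray and is
  continuous near \<open>v\<close>, so preimages of open intervals are neighbourhoods of the ray of \<open>v\<close>.\<close>

lemma ray_limit_ratio:
  fixes L :: "nat \<Rightarrow> 'j \<Rightarrow> real"
  assumes lim: "limitin ray_space (\<lambda>n. ray (L n)) (ray v) sequentially" and j0: "v j0 \<noteq> 0"
  shows "\<forall>\<^sub>F n in sequentially. L n j0 \<noteq> 0"
    and "(\<lambda>n. L n j / \<bar>L n j0\<bar>) \<longlonglongrightarrow> v j / \<bar>v j0\<bar>"
proof -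
  have ev: "\<forall>\<^sub>F n in sequentially. L n j0 \<noteq> 0 \<and> \<bar>L n j / \<bar>L n j0\<bar> - v j / \<bar>v j0\<bar>\<bar> < e" if e: "e > 0" for e j
  proof -
    define U :: "('j \<Rightarrow> real) set" where
      "U = {u. 0 < u j0 * v j0 \<and> \<bar>u j * \<bar>v j0\<bar> - v j * \<bar>u j0\<bar>\<bar> < e * \<bar>u j0\<bar> * \<bar>v j0\<bar>}"
    have cont: "continuous_on UNIV (\<lambda>u::'j \<Rightarrow> real. u i)" for i by (rule continuous_on_product_coordinates)
    have "open {u :: 'j \<Rightarrow> real. 0 < u j0 * v j0}" by (intro open_Collect_less continuous_intros cont)
    moreover have "open {u :: 'j \<Rightarrow> real. \<bar>u j * \<bar>v j0\<bar> - v j * \<bar>u j0\<bar>\<bar> < e * \<bar>u j0\<bar> * \<bar>v j0\<bar>}"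
      by (intro open_Collect_less continuous_intros cont)
    ultimately have "open U" unfolding U_def Collect_conj_eq by (rule open_Int)
    have U0: "U \<subseteq> - {\<lambda>_. 0}"
    proof
      fix u assume "u \<in> U"
      then have "u j0 \<noteq> 0" unfolding U_def by auto
      then show "u \<in> - {\<lambda>_. 0}" by auto
    qed
    have scale: "(\<lambda>i. c * u i) \<in> U" if "u \<in> U" "c > 0" for u c
    proof -
      have 1: "0 < u j0 * v j0" "\<bar>u j * \<bar>v j0\<bar> - v j * \<bar>u j0\<bar>\<bar> < e * \<bar>u j0\<bar> * \<bar>v j0\<bar>"
        using that(1) by (simp_all add: U_def)
      have "\<bar>(c * u j) * \<bar>v j0\<bar> - v j * \<bar>c * u j0\<bar>\<bar> = c * \<bar>u j * \<bar>v j0\<bar> - v j * \<bar>u j0\<bar>\<bar>"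
      proof -
        have "(c * u j) * \<bar>v j0\<bar> - v j * \<bar>c * u j0\<bar> = c * (u j * \<bar>v j0\<bar> - v j * \<bar>u j0\<bar>)"
          using that(2) by (simp add: abs_mult algebra_simps)
        then show ?thesis using that(2) by (simp add: abs_mult)
      qed
      also have "\<dots> < c * (e * \<bar>u j0\<bar> * \<bar>v j0\<bar>)" using 1(2) that(2) by simp
      also have "\<dots> = e * \<bar>c * u j0\<bar> * \<bar>v j0\<bar>" using that(2) by (simp add: abs_mult)
      finally have a: "\<bar>(c * u j) * \<bar>v j0\<bar> - v j * \<bar>c * u j0\<bar>\<bar> < e * \<bar>c * u j0\<bar> * \<bar>v j0\<bar>" .
      have "0 < c * u j0 * v j0" using 1(1) that(2) by (simp add: mult.assoc)
      then show ?thesis using a unfolding U_def by simp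
    qed
    have sat: "u \<in> U" if "ray u \<in> ray ` U" for u
    proof -
      from that obtain w where w: "w \<in> U" "ray u = ray w" by blast
      then have "u \<in> ray w" using ray_self[of u] by simp
      then obtain c where "c > 0" "u = (\<lambda>i. c * w i)" unfolding ray_def by blast
      then show ?thesis using scale[OF w(1)] by simp
    qed
    have eq: "{u \<in> - {\<lambda>_. 0}. ray u \<in> ray ` U} = (- {\<lambda>_. 0}) \<inter> U"
    proof (intro equalityI subsetI)
      fix u assume "u \<in> {u \<in> - {\<lambda>_. 0}. ray u \<in> ray ` U}"
      then show "u \<in> (- {\<lambda>_. 0}) \<inter> U" using sat[of u] by simp
    next
      fix u assume "u \<in> (- {\<lambda>_. 0}) \<inter> U"
      then show "u \<in> {u \<in> - {\<lambda>_. 0}. ray u \<in> ray ` U}" by simp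
    qed
    have "openin (top_of_set (- {\<lambda>_. 0})) ((- {\<lambda>_. 0}) \<inter> U)" by (rule openin_open_Int[OF \<open>open U\<close>])
    then have "openin ray_space (ray ` U)"
      unfolding openin_ray_space eq using U0 by (intro conjI image_mono)
    moreover have vv: "0 < v j0 * v j0" using j0 not_real_square_gt_zero by blast
    have "0 < e * \<bar>v j0\<bar> * \<bar>v j0\<bar>" using e j0 by simp
    then have "v \<in> U" unfolding U_def using vv by simp
    then have "ray v \<in> ray ` U" by (rule imageI)
    ultimately have "\<forall>\<^sub>F n in sequentially. ray (L n) \<in> ray ` U" using lim unfolding limitin_def by blast
    then show ?thesis
    proof eventually_elim
      case (elim n)
      then have "L n \<in> U" by (rule sat)
      then have 1: "0 < L n j0 * v j0" "\<bar>L n j * \<bar>v j0\<bar> - v j * \<bar>L n j0\<bar>\<bar> < e * \<bar>L n j0\<bar> * \<bar>v j0\<bar>"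
        by (simp_all add: U_def)
      then have n0: "L n j0 \<noteq> 0" by auto
      define d where "d = \<bar>L n j0\<bar> * \<bar>v j0\<bar>"
      have d: "d > 0" using n0 j0 by (simp add: d_def)
      have "L n j / \<bar>L n j0\<bar> - v j / \<bar>v j0\<bar> = (L n j * \<bar>v j0\<bar> - v j * \<bar>L n j0\<bar>) / d"
        unfolding d_def using n0 j0 by (simp add: diff_frac_eq)
      then have "\<bar>L n j / \<bar>L n j0\<bar> - v j / \<bar>v j0\<bar>\<bar> = \<bar>L n j * \<bar>v j0\<bar> - v j * \<bar>L n j0\<bar>\<bar> / d"
        using d by simp
      also have "\<dots> < e" using 1(2) d by (simp add: pos_divide_less_eq d_def mult.assoc)
      finally show ?case using n0 by simp
    qed
  qed
  show "\<forall>\<^sub>F n in sequentially. L n j0 \<noteq> 0" using ev[of 1 j0] by (auto elim: eventually_mono)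
  show "(\<lambda>n. L n j / \<bar>L n j0\<bar>) \<longlonglongrightarrow> v j / \<bar>v j0\<bar>"
  proof (rule tendstoI)
    fix e :: real assume "e > 0"
    from ev[OF this, of j] show "\<forall>\<^sub>F n in sequentially. dist (L n j / \<bar>L n j0\<bar>) (v j / \<bar>v j0\<bar>) < e"
      by (auto elim: eventually_mono simp: dist_real_def)
  qed
qed

lemma poly_eval_continuous: "continuous_on A (poly_eval p)"
  unfolding poly_eval_def by (intro continuous_intros)

lemma affine_variety_closed:
  fixes V :: "(complex ^ 'n::finite) set"
  assumes "affine_variety_over K V" shows "closed V"
proof -
  obtain P where "V = {x. \<forall>p\<in>P. poly_eval p x = 0}" using assms unfolding affine_variety_over_def by blast
  then have "V = (\<Inter>p\<in>P. {x. poly_eval p x = 0})" by blast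
  moreover have "closed {x. poly_eval p x = 0}" for p :: "('n \<Rightarrow>\<^sub>0 nat) \<Rightarrow>\<^sub>0 complex"
    by (intro closed_Collect_eq poly_eval_continuous continuous_on_const)
  ultimately show ?thesis by auto
qed

context family
begin

lemma relation_vanishes:
  assumes "p \<in> relation_ideal K V f" "x \<in> nonvanishing V f" shows "laurent_val (\<lambda>j. f j x) p = 0"
  using assms unfolding relation_ideal_iff nonvanishing_def by blast

lemma f_continuous: "continuous_on V (f j)"
proof -
  obtain p where p: "f j = restrict (poly_eval p) V" using R_f[of j] unfolding R_carrier by (rule imageE)
  have "continuous_on V (poly_eval p)" by (rule poly_eval_continuous)
  then show ?thesis by (rule continuous_on_eq) (simp add: p)
qed

lemma bounded_along:
  assumes gen: "generate_ring R ((\<lambda>c. \<lambda>x\<in>V. c) ` K \<union> range f) = carrier R"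
    and y: "\<And>n. y n \<in> V" and bdd: "\<And>j. \<exists>C. \<forall>\<^sub>F n in sequentially. cmod (f j (y n)) \<le> C"
    and h: "h \<in> carrier R"
  shows "\<exists>C. \<forall>\<^sub>F n in sequentially. cmod (h (y n)) \<le> C"
proof -
  have "h \<in> generate_ring R ((\<lambda>c. \<lambda>x\<in>V. c) ` K \<union> range f)" using h gen by simp
  then show ?thesis
  proof (induction rule: generate_ring.induct)
    case one
    show ?case using y by (auto simp: R_simps intro!: exI[of _ 1])
  next
    case (incl h)
    then consider c where "h = (\<lambda>x\<in>V. c)" | j where "h = f j" by blast
    then show ?case
    proof cases
      case 1
      then show ?thesis using y by (auto intro!: exI[of _ "cmod c"])
    next
      case 2
      then show ?thesis using bdd by simp
    qed
  next
    case (a_inv h)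
    have "h \<in> carrier R" using a_inv.hyps gen by simp
    then show ?case using a_inv.IH y by (simp add: R_uminus)
  next
    case (eng_add g h)
    from eng_add.IH obtain C D where
      "\<forall>\<^sub>F n in sequentially. cmod (g (y n)) \<le> C" "\<forall>\<^sub>F n in sequentially. cmod (h (y n)) \<le> D" by blast
    then have "\<forall>\<^sub>F n in sequentially. cmod ((g \<oplus>\<^bsub>R\<^esub> h) (y n)) \<le> C + D"
    proof eventually_elim
      case (elim n)
      then show ?case using y[of n] norm_triangle_ineq[of "g (y n)" "h (y n)"] by (simp add: R_simps)
    qed
    then show ?case ..
  next
    case (eng_mult g h)
    from eng_mult.IH obtain C D where
      "\<forall>\<^sub>F n in sequentially. cmod (g (y n)) \<le> C" "\<forall>\<^sub>F n in sequentially. cmod (h (y n)) \<le> D" by blast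
    then have "\<forall>\<^sub>F n in sequentially. cmod ((g \<otimes>\<^bsub>R\<^esub> h) (y n)) \<le> C * D"
    proof eventually_elim
      case (elim n)
      have "0 \<le> C" using elim(1) norm_ge_zero order_trans by blast
      then show ?case using y[of n] elim by (simp add: R_simps norm_mult mult_mono)
    qed
    then show ?case ..
  qed
qed

lemma coord_in_R: "(\<lambda>x\<in>V. x $ i) \<in> carrier R"
proof -
  have "(\<lambda>x\<in>V. x $ i) = restrict (poly_eval (Poly_Mapping.single (Poly_Mapping.single i 1) 1)) V"
    by (rule restrict_ext) (simp only: poly_eval_coord)
  then show ?thesis unfolding R_carrier
    by (rule image_eqI) (rule coeffs_in_single[OF K subring_setD(1)[OF K]])
qed

text \<open>The other coordinates of \<open>Log\<close> are at most proportional to the coordinate \<open>j0\<close>. So on a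
  subsequence along which it stays bounded all \<open>f j\<close> are bounded above and away from zero. As they
  generate the coordinate ring, the points are bounded as well and accumulate at a point of the
  nonvanishing locus; a convergent subsequence together with its limit is compact.\<close>

lemma Log_unbounded:
  assumes closed: "closed V"
    and gen: "generate_ring R ((\<lambda>c. \<lambda>x\<in>V. c) ` K \<union> range f) = carrier R"
    and x: "\<And>n. x n \<in> nonvanishing V f"
    and leave: "\<And>C. compact C \<Longrightarrow> C \<subseteq> nonvanishing V f \<Longrightarrow> \<forall>\<^sub>F n in sequentially. x n \<notin> C"
    and ratio: "\<And>j. (\<lambda>n. Log_map f (x n) j / \<bar>Log_map f (x n) j0\<bar>) \<longlonglongrightarrow> r j"
    and nz: "\<forall>\<^sub>F n in sequentially. Log_map f (x n) j0 \<noteq> 0"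
  shows "filterlim (\<lambda>n. \<bar>Log_map f (x n) j0\<bar>) at_top sequentially"
  unfolding filterlim_at_top
proof (intro allI, rule ccontr)
  fix M
  define a where "a n = \<bar>Log_map f (x n) j0\<bar>" for n
  assume "\<not> (\<forall>\<^sub>F n in sequentially. M \<le> \<bar>Log_map f (x n) j0\<bar>)"
  then have "\<exists>\<^sub>F n in sequentially. a n < M" unfolding frequently_def a_def by (simp add: not_less)
  then have "infinite {n. a n < M}"
    unfolding frequently_sequentially infinite_nat_iff_unbounded_le by auto
  then obtain s :: "nat \<Rightarrow> nat" where s: "strict_mono s" "\<And>n. s n \<in> {n. a n < M}"
    using infinite_enumerate[of "{n. a n < M}"] by blast
  define y where "y n = x (s n)" for n
  have yV: "y n \<in> V" and yf: "f j (y n) \<noteq> 0" for n j using x unfolding y_def nonvanishing_def by auto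
  have sub: "\<forall>\<^sub>F n in sequentially. P (s n)" if "\<forall>\<^sub>F n in sequentially. P n" for P
    using filterlim_subseq[OF s(1)] that unfolding filterlim_iff by blast
  have bnd: "\<exists>C. \<forall>\<^sub>F n in sequentially. \<bar>Log_map f (y n) j\<bar> \<le> C" for j
  proof -
    have "\<forall>\<^sub>F n in sequentially. \<bar>Log_map f (x n) j / a n - r j\<bar> < 1"
      using tendstoD[OF ratio[of j], of 1] by (simp add: dist_real_def a_def)
    from sub[OF this] sub[OF nz] have "\<forall>\<^sub>F n in sequentially. \<bar>Log_map f (y n) j\<bar> \<le> M * (\<bar>r j\<bar> + 1)"
    proof eventually_elim
      case (elim n)
      have a0: "a (s n) > 0" using elim(2) by (simp add: a_def)
      have "\<bar>Log_map f (y n) j\<bar> = a (s n) * \<bar>Log_map f (x (s n)) j / a (s n)\<bar>"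
        using a0 by (simp add: y_def abs_divide)
      also have "\<dots> \<le> M * (\<bar>r j\<bar> + 1)"
        using s(2)[of n] a0 elim(1) by (intro mult_mono) auto
      finally show ?case .
    qed
    then show ?thesis ..
  qed
  have ebd: "\<exists>C. \<forall>\<^sub>F n in sequentially. exp (- C) \<le> cmod (f j (y n)) \<and> cmod (f j (y n)) \<le> exp C" for j
  proof -
    from bnd[of j] obtain C where "\<forall>\<^sub>F n in sequentially. \<bar>Log_map f (y n) j\<bar> \<le> C" ..
    then have "\<forall>\<^sub>F n in sequentially. exp (- C) \<le> cmod (f j (y n)) \<and> cmod (f j (y n)) \<le> exp C"
    proof eventually_elim
      case (elim n)
      then have "exp (- C) \<le> exp (ln (cmod (f j (y n))))" "exp (ln (cmod (f j (y n)))) \<le> exp C"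
        by (simp_all add: Log_map_def abs_le_iff)
      then show ?case using yf[of j n] by simp
    qed
    then show ?thesis ..
  qed
  have fb: "\<exists>C. \<forall>\<^sub>F n in sequentially. cmod (f j (y n)) \<le> C" for j
  proof -
    from ebd[of j] obtain C where
      "\<forall>\<^sub>F n in sequentially. exp (- C) \<le> cmod (f j (y n)) \<and> cmod (f j (y n)) \<le> exp C" ..
    then have "\<forall>\<^sub>F n in sequentially. cmod (f j (y n)) \<le> exp C" by (rule eventually_mono) simp
    then show ?thesis ..
  qed
  have "\<exists>C. \<forall>\<^sub>F n in sequentially. cmod (y n $ i) \<le> C" for i
    using bounded_along[OF gen yV fb coord_in_R[of i]] yV by simp
  then obtain C where C: "\<And>i. \<forall>\<^sub>F n in sequentially. cmod (y n $ i) \<le> C i" by metis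
  have "\<forall>\<^sub>F n in sequentially. \<forall>i\<in>UNIV. cmod (y n $ i) \<le> C i"
    by (intro eventually_ball_finite ballI C) simp
  then have "\<forall>\<^sub>F n in sequentially. norm (y n) \<le> (\<Sum>i\<in>UNIV. C i)"
  proof eventually_elim
    case (elim n)
    have "norm (y n) \<le> (\<Sum>i\<in>UNIV. cmod (y n $ i))" unfolding norm_vec_def by (rule L2_set_le_sum) simp
    also have "\<dots> \<le> (\<Sum>i\<in>UNIV. C i)" by (rule sum_mono) (use elim in simp)
    finally show ?case .
  qed
  then obtain N where N: "\<And>n. n \<ge> N \<Longrightarrow> norm (y n) \<le> (\<Sum>i\<in>UNIV. C i)" unfolding eventually_sequentially by blast
  have "seq_compact (cball 0 (\<Sum>i\<in>UNIV. C i) :: (complex ^ 'n) set)"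
    using compact_cball compact_eq_seq_compact_metric by blast
  moreover have "\<forall>n. y (n + N) \<in> cball 0 (\<Sum>i\<in>UNIV. C i)" using N by simp
  ultimately obtain l t where t: "strict_mono (t :: nat \<Rightarrow> nat)" and l: "((\<lambda>n. y (n + N)) \<circ> t) \<longlonglongrightarrow> l"
    by (rule seq_compactE) auto
  define z where "z n = y (t n + N)" for n
  have "z = (\<lambda>n. y (n + N)) \<circ> t" by (rule ext) (simp add: z_def)
  then have zl: "z \<longlonglongrightarrow> l" using l by simp
  have zV: "z n \<in> V" for n by (simp add: z_def yV)
  have lV: "l \<in> V" by (rule closed_sequentially[OF closed _ zl]) (simp add: zV)
  have tN: "filterlim (\<lambda>n. t n + N) sequentially sequentially"
    by (rule filterlim_at_top_mono[OF filterlim_subseq[OF t]]) simp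
  have "f j l \<noteq> 0" for j
  proof -
    from ebd[of j] obtain D where
      "\<forall>\<^sub>F n in sequentially. exp (- D) \<le> cmod (f j (y n)) \<and> cmod (f j (y n)) \<le> exp D" ..
    then have "\<forall>\<^sub>F n in sequentially. exp (- D) \<le> cmod (f j (y n))" by (rule eventually_mono) simp
    then have "\<forall>\<^sub>F n in sequentially. exp (- D) \<le> cmod (f j (z n))"
      using tN unfolding filterlim_iff z_def by blast
    moreover have "(\<lambda>n. f j (z n)) \<longlonglongrightarrow> f j l"
      using f_continuous[of j] zV lV zl unfolding continuous_on_sequentially by (auto simp: o_def)
    then have "(\<lambda>n. cmod (f j (z n))) \<longlonglongrightarrow> cmod (f j l)" by (rule tendsto_norm)
    ultimately have "exp (- D) \<le> cmod (f j l)" by (intro tendsto_lowerbound) auto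
    then show ?thesis by (metis exp_gt_zero norm_zero not_less)
  qed
  then have "l \<in> nonvanishing V f" using lV by (simp add: nonvanishing_def)
  then have "insert l (range z) \<subseteq> nonvanishing V f"
    using zV yf by (auto simp: nonvanishing_def z_def)
  from leave[OF compact_sequence_with_limit[OF zl] this]
  have "\<forall>\<^sub>F n in sequentially. x n \<notin> insert l (range z)" .
  then have "\<forall>\<^sub>F n in sequentially. y n \<notin> insert l (range z)" unfolding y_def by (rule sub)
  then have "\<forall>\<^sub>F n in sequentially. y (t n + N) \<notin> insert l (range z)" using tN unfolding filterlim_iff by blast
  then have "\<forall>\<^sub>F n in sequentially. False" by (rule eventually_mono) (simp add: z_def)
  then show False by simp
qed

text \<open>If the exponent \<open>w\<close> were the only maximum at \<open>v\<close>, the right hand side of \<open>dominated_by_others\<close> would tend to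
  zero along the sequence, as the differences of the pairings tend to minus infinity.\<close>

lemma cone_subset_tropical:
  assumes closed: "closed V"
    and gen: "generate_ring R ((\<lambda>c. \<lambda>x\<in>V. c) ` K \<union> range f) = carrier R"
  shows "cone_ideal_points V f \<subseteq> tropical_variety (relation_ideal K V f)"
proof
  fix v assume v: "v \<in> cone_ideal_points V f"
  show "v \<in> tropical_variety (relation_ideal K V f)"
    unfolding tropical_variety_def
  proof (rule INT_I, unfold tropical_zeros_iff, rule notI)
    fix p assume p: "p \<in> relation_ideal K V f"
    assume "\<exists>w\<in>Poly_Mapping.keys p. \<forall>\<omega>\<in>Poly_Mapping.keys p - {w}. pairing v \<omega> < pairing v w"
    then obtain w where w: "w \<in> Poly_Mapping.keys p"
      and dom: "\<And>\<omega>. \<omega> \<in> Poly_Mapping.keys p - {w} \<Longrightarrow> pairing v \<omega> < pairing v w" by blast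
    have pw: "0 < cmod (Poly_Mapping.lookup p w)" using w by (simp add: in_keys_iff)
    have le: "cmod (Poly_Mapping.lookup p w) \<le> (\<Sum>\<omega>\<in>Poly_Mapping.keys p - {w}.
        cmod (Poly_Mapping.lookup p \<omega>) * exp (pairing (Log_map f y) \<omega> - pairing (Log_map f y) w))"
      if y: "y \<in> nonvanishing V f" for y
      unfolding Log_map_def
      by (rule dominated_by_others[OF _ relation_vanishes[OF p y] w]) (use y in \<open>simp add: nonvanishing_def\<close>)
    have ne: "nonvanishing V f \<noteq> {}" using v unfolding cone_ideal_points_def by (auto split: if_splits)
    show False
    proof (cases "v = (\<lambda>_. 0)")
      case True
      have e: "Poly_Mapping.keys p - {w} = {}"
        using dom unfolding True pairing_zero_left by blast
      obtain y where y: "y \<in> nonvanishing V f" using ne by blast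
      show False using le[OF y] pw unfolding e by simp
    next
      case False
      then obtain j0 where j0: "v j0 \<noteq> 0" by blast
      have "ray v \<in> ideal_points V f" using v ne False unfolding cone_ideal_points_def by (simp split: if_splits)
      then obtain x :: "nat \<Rightarrow> complex ^ 'n" where x: "\<And>n. x n \<in> nonvanishing V f"
        and leave: "\<And>C. compact C \<Longrightarrow> C \<subseteq> nonvanishing V f \<Longrightarrow> \<forall>\<^sub>F n in sequentially. x n \<notin> C"
        and lim: "limitin ray_space (\<lambda>n. ray (Log_map f (x n))) (ray v) sequentially"
        unfolding ideal_points_def by blast
      define a where "a n = \<bar>Log_map f (x n) j0\<bar>" for n
      note ratio = ray_limit_ratio[where v = v, OF lim j0]
      have a: "filterlim a at_top sequentially" unfolding a_def
        by (rule Log_unbounded[OF closed gen x leave ratio(2) ratio(1)])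
      have term0: "(\<lambda>n. exp (pairing (Log_map f (x n)) \<omega> - pairing (Log_map f (x n)) w)) \<longlonglongrightarrow> 0"
        if \<omega>: "\<omega> \<in> Poly_Mapping.keys p - {w}" for \<omega>
      proof -
        have pl: "(\<lambda>n. pairing (Log_map f (x n)) \<tau> / a n) \<longlonglongrightarrow> pairing v \<tau> / \<bar>v j0\<bar>" for \<tau>
        proof -
          have "(\<lambda>n. \<Sum>j\<in>Poly_Mapping.keys \<tau>. Log_map f (x n) j / a n * real_of_int (Poly_Mapping.lookup \<tau> j))
            \<longlonglongrightarrow> (\<Sum>j\<in>Poly_Mapping.keys \<tau>. v j / \<bar>v j0\<bar> * real_of_int (Poly_Mapping.lookup \<tau> j))"
            unfolding a_def by (intro tendsto_intros ratio(2))
          then show ?thesis by (simp add: pairing_def sum_divide_distrib)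
        qed
        have "(\<lambda>n. pairing (Log_map f (x n)) \<omega> / a n - pairing (Log_map f (x n)) w / a n)
          \<longlonglongrightarrow> pairing v \<omega> / \<bar>v j0\<bar> - pairing v w / \<bar>v j0\<bar>" by (intro tendsto_diff pl)
        moreover have "pairing v \<omega> / \<bar>v j0\<bar> - pairing v w / \<bar>v j0\<bar> < 0"
          using dom[OF \<omega>] j0 by (simp add: divide_strict_right_mono)
        ultimately have "LIM n sequentially. (pairing (Log_map f (x n)) \<omega> / a n - pairing (Log_map f (x n)) w / a n) * a n :> at_bot"
          by (rule filterlim_tendsto_neg_mult_at_bot) (rule a)
        moreover have "\<forall>\<^sub>F n in sequentially. (pairing (Log_map f (x n)) \<omega> / a n - pairing (Log_map f (x n)) w / a n) * a n
          = pairing (Log_map f (x n)) \<omega> - pairing (Log_map f (x n)) w"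
          using ratio(1) by eventually_elim (simp add: a_def left_diff_distrib)
        ultimately have "LIM n sequentially. pairing (Log_map f (x n)) \<omega> - pairing (Log_map f (x n)) w :> at_bot"
          by (rule filterlim_cong[THEN iffD1, OF refl refl, rotated])
        then show ?thesis by (rule filterlim_compose[OF exp_at_bot])
      qed
      have "(\<lambda>n. \<Sum>\<omega>\<in>Poly_Mapping.keys p - {w}. cmod (Poly_Mapping.lookup p \<omega>) *
          exp (pairing (Log_map f (x n)) \<omega> - pairing (Log_map f (x n)) w))
        \<longlonglongrightarrow> (\<Sum>\<omega>\<in>Poly_Mapping.keys p - {w}. cmod (Poly_Mapping.lookup p \<omega>) * 0)"
        by (intro tendsto_sum tendsto_mult tendsto_const term0)
      from LIMSEQ_le_const[OF this, of "cmod (Poly_Mapping.lookup p w)"] le[OF x]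
      have "cmod (Poly_Mapping.lookup p w) \<le> 0" by simp
      then show False using pw by simp
    qed
  qed
qed

end

section \<open>Tropical points are limits\<close>

lemma univ_ring_uminus: "\<ominus>\<^bsub>univ_ring\<^esub> x = - (x :: 'a::comm_ring_1)"
  unfolding a_inv_def m_inv_def univ_ring_def
  by (rule the_equality) (auto simp: eq_neg_iff_add_eq_0 add.commute)

lemma subfield_set:
  assumes "subfield K (univ_ring :: complex ring)"
  shows "subring_set K" and "\<forall>c\<in>K. c \<noteq> 0 \<longrightarrow> inverse c \<in> K"
proof -
  have sr: "subring K (univ_ring :: complex ring)"
    using assms unfolding subfield_def subdomain_def subcring_def by blast
  have u: "x \<otimes>\<^bsub>univ_ring\<^esub> y = x * y" "x \<oplus>\<^bsub>univ_ring\<^esub> y = x + y" "\<one>\<^bsub>univ_ring\<^esub> = (1 :: complex)"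
    "\<zero>\<^bsub>univ_ring\<^esub> = (0 :: complex)" for x y :: complex
    by (simp_all add: univ_ring_def)
  show "subring_set K"
    unfolding subring_set_def
  proof (intro conjI ballI)
    show "1 \<in> K" using subringE(3)[OF sr] by (simp add: u)
    fix a b assume ab: "a \<in> K" "b \<in> K"
    have "- b \<in> K" using subringE(5)[OF sr ab(2)] by (simp add: univ_ring_uminus)
    then show "a - b \<in> K" using subringE(7)[OF sr ab(1), of "- b"] by (simp add: u)
    show "a * b \<in> K" using subringE(6)[OF sr ab] by (simp add: u)
  qed
  show "\<forall>c\<in>K. c \<noteq> 0 \<longrightarrow> inverse c \<in> K"
  proof (intro ballI impI)
    fix c assume c: "c \<in> K" "c \<noteq> 0"
    have "Units (univ_ring \<lparr>carrier := K\<rparr>) = K - {0 :: complex}"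
      using subfield.subfield_Units[OF assms] by (simp add: u)
    then have "c \<in> Units (univ_ring \<lparr>carrier := K\<rparr>)" using c by blast
    then obtain d where "d \<in> K" "d * c = 1" unfolding Units_def by (auto simp: u)
    moreover from this(2) have "d = inverse c" using c(2) by (simp add: field_simps)
    ultimately show "inverse c \<in> K" by simp
  qed
qed

definition laurent_const :: "complex \<Rightarrow> ('j \<Rightarrow>\<^sub>0 int) \<Rightarrow>\<^sub>0 complex" where
  "laurent_const c = Poly_Mapping.single 0 c"

definition laurent_var :: "'j \<Rightarrow> int \<Rightarrow> ('j \<Rightarrow>\<^sub>0 int) \<Rightarrow>\<^sub>0 complex" where
  "laurent_var j k = Poly_Mapping.single (Poly_Mapping.single j k) 1"

lemma var_inverse: "laurent_var j 1 * laurent_var j (- 1) = 1"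
  by (simp add: laurent_var_def mult_single single_add[symmetric])

lemma const_arith: "laurent_const (a - b) = laurent_const a - laurent_const b" "laurent_const (a * b) = laurent_const a * laurent_const b"
  "laurent_const 1 = 1" "laurent_const 0 = 0"
  by (simp_all add: laurent_const_def single_diff mult_single)

text \<open>Replacing zeros by \<open>1\<close> makes the evaluation of Laurent polynomials a ring homomorphism at every point of \<open>V\<close>.\<close>

definition nz :: "('j \<Rightarrow> complex) \<Rightarrow> 'j \<Rightarrow> complex" where "nz u j = (if u j = 0 then 1 else u j)"

lemma laurent_val_cong:
  assumes "\<And>j. j \<in> (\<Union>\<omega>\<in>Poly_Mapping.keys p. Poly_Mapping.keys \<omega>) \<Longrightarrow> u j = w j"
  shows "laurent_val u p = laurent_val w p"
  unfolding laurent_val_def mon_eval_def laurent_mono_def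
  by (intro sum.cong prod.cong refl arg_cong2[where f = "(*)"] arg_cong2[where f = "(powi)"]) (use assms in blast)

context family
begin

definition nzv :: "complex ^ 'n \<Rightarrow> (('j \<Rightarrow>\<^sub>0 int) \<Rightarrow>\<^sub>0 complex) \<Rightarrow> complex" where
  "nzv x = laurent_val (nz (\<lambda>j. f j x))"

lemma nzv_simps: "nzv x (p - q) = nzv x p - nzv x q" "nzv x (p * q) = nzv x p * nzv x q"
  "nzv x 1 = 1" "nzv x (laurent_const c) = c" "nzv x (laurent_var j 1) = nz (\<lambda>j. f j x) j"
proof -
  show "nzv x (p * q) = nzv x p * nzv x q" unfolding nzv_def by (rule laurent_val_mult) (simp add: nz_def)
qed (simp_all add: nzv_def laurent_val_diff laurent_val_one laurent_const_def laurent_val_const laurent_var_def laurent_val_var)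

text \<open>This is equality in the localization, in terms of functions: a finite product of the \<open>f j\<close> may be inverted.\<close>

definition near_eq :: "(('j \<Rightarrow>\<^sub>0 int) \<Rightarrow>\<^sub>0 complex) \<Rightarrow> (complex ^ 'n \<Rightarrow> complex) \<Rightarrow> bool" where
  "near_eq p g \<longleftrightarrow> (\<exists>J. finite J \<and> (\<forall>x\<in>V. (\<forall>j\<in>J. f j x \<noteq> 0) \<longrightarrow> nzv x p = g x))"

lemma near_eqI: "finite J \<Longrightarrow> (\<And>x. x \<in> V \<Longrightarrow> \<forall>j\<in>J. f j x \<noteq> 0 \<Longrightarrow> nzv x p = g x) \<Longrightarrow> near_eq p g"
  unfolding near_eq_def by blast

lemma relation_ideal_near_eq:
  "p \<in> relation_ideal K V f \<longleftrightarrow> p \<in> coeffs_in K \<and> near_eq p (\<lambda>x. 0)"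
proof -
  define W where "W = (\<Union>\<omega>\<in>Poly_Mapping.keys p. Poly_Mapping.keys \<omega>)"
  have W: "finite W" unfolding W_def by auto
  have eq: "nzv x p = laurent_val (\<lambda>j. f j x) p" if "\<forall>j\<in>W. f j x \<noteq> 0" for x
    unfolding nzv_def by (rule laurent_val_cong) (use that in \<open>auto simp: nz_def W_def\<close>)
  have "near_eq p (\<lambda>x. 0) \<longleftrightarrow> (\<exists>J. finite J \<and> (\<forall>x\<in>V. (\<forall>j\<in>J. f j x \<noteq> 0) \<longrightarrow> laurent_val (\<lambda>j. f j x) p = 0))"
  proof
    assume "near_eq p (\<lambda>x. 0)"
    then obtain J where J: "finite J" "\<forall>x\<in>V. (\<forall>j\<in>J. f j x \<noteq> 0) \<longrightarrow> nzv x p = 0" unfolding near_eq_def by blast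
    show "\<exists>J. finite J \<and> (\<forall>x\<in>V. (\<forall>j\<in>J. f j x \<noteq> 0) \<longrightarrow> laurent_val (\<lambda>j. f j x) p = 0)"
      using J W eq by (intro exI[of _ "J \<union> W"]) auto
  next
    assume "\<exists>J. finite J \<and> (\<forall>x\<in>V. (\<forall>j\<in>J. f j x \<noteq> 0) \<longrightarrow> laurent_val (\<lambda>j. f j x) p = 0)"
    then obtain J where J: "finite J" "\<forall>x\<in>V. (\<forall>j\<in>J. f j x \<noteq> 0) \<longrightarrow> laurent_val (\<lambda>j. f j x) p = 0" by blast
    show "near_eq p (\<lambda>x. 0)"
      using J W eq by (intro near_eqI[of "J \<union> W"]) auto
  qed
  then show ?thesis unfolding relation_ideal_iff by blast
qed

lemma near_eq_diff: assumes "near_eq p g" "near_eq q h" shows "near_eq (p - q) (\<lambda>x. g x - h x)"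
proof -
  obtain I J where "finite I" "\<forall>x\<in>V. (\<forall>j\<in>I. f j x \<noteq> 0) \<longrightarrow> nzv x p = g x"
    and "finite J" "\<forall>x\<in>V. (\<forall>j\<in>J. f j x \<noteq> 0) \<longrightarrow> nzv x q = h x" using assms unfolding near_eq_def by blast
  then show ?thesis by (intro near_eqI[of "I \<union> J"]) (auto simp: nzv_simps)
qed

lemma near_eq_mult: assumes "near_eq p g" "near_eq q h" shows "near_eq (p * q) (\<lambda>x. g x * h x)"
proof -
  obtain I J where "finite I" "\<forall>x\<in>V. (\<forall>j\<in>I. f j x \<noteq> 0) \<longrightarrow> nzv x p = g x"
    and "finite J" "\<forall>x\<in>V. (\<forall>j\<in>J. f j x \<noteq> 0) \<longrightarrow> nzv x q = h x" using assms unfolding near_eq_def by blast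
  then show ?thesis by (intro near_eqI[of "I \<union> J"]) (auto simp: nzv_simps)
qed

lemma near_eq_const: "near_eq (laurent_const c) (\<lambda>x. c)" by (rule near_eqI[of "{}"]) (simp_all add: nzv_simps)

lemma near_eq_zero: "near_eq 0 (\<lambda>x. 0)" using near_eq_const[of 0] by (simp add: const_arith)
lemma near_eq_one: "near_eq 1 (\<lambda>x. 1)" using near_eq_const[of 1] by (simp add: const_arith)

lemma near_eq_add: assumes "near_eq p g" "near_eq q h" shows "near_eq (p + q) (\<lambda>x. g x + h x)"
  using near_eq_diff[OF assms(1) near_eq_diff[OF near_eq_zero assms(2)]] by simp

lemma near_eq_power: assumes "near_eq p g" shows "near_eq (p ^ n) (\<lambda>x. g x ^ n)"
proof (induction n)
  case (Suc n)
  show ?case using near_eq_mult[OF assms Suc] by simp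
qed (simp add: near_eq_one)

lemma near_eq_sum:
  "finite I \<Longrightarrow> (\<And>i. i \<in> I \<Longrightarrow> near_eq (p i) (g i)) \<Longrightarrow> near_eq (sum p I) (\<lambda>x. \<Sum>i\<in>I. g i x)"
proof (induction I rule: finite_induct)
  case (insert i I)
  then show ?case using near_eq_add[of "p i" "g i" "sum p I"] by simp
qed (simp add: near_eq_zero)

lemma near_eq_prod:
  "finite I \<Longrightarrow> (\<And>i. i \<in> I \<Longrightarrow> near_eq (p i) (g i)) \<Longrightarrow> near_eq (prod p I) (\<lambda>x. \<Prod>i\<in>I. g i x)"
proof (induction I rule: finite_induct)
  case (insert i I)
  then show ?case using near_eq_mult[of "p i" "g i" "prod p I"] by simp
qed (simp add: near_eq_one)

lemma near_eq_cong: assumes "near_eq p g" "\<And>x. x \<in> V \<Longrightarrow> g x = h x" shows "near_eq p h"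
  using assms unfolding near_eq_def by force

lemma near_eq_var: "near_eq (laurent_var j 1) (f j)"
  by (rule near_eqI[of "{j}"]) (simp_all add: nzv_simps nz_def)

abbreviation "A \<equiv> (coeffs_in K :: (('j \<Rightarrow>\<^sub>0 int) \<Rightarrow>\<^sub>0 complex) set)"

lemma A_sub: "subring_set A" by (rule coeffs_in_subring[OF K])

lemma const_in_A: "c \<in> K \<Longrightarrow> laurent_const c \<in> A" unfolding laurent_const_def by (rule coeffs_in_single[OF K])

lemma var_in_A: "laurent_var j k \<in> A" unfolding laurent_var_def by (rule coeffs_in_single[OF K subring_setD(1)[OF K]])

text \<open>Elements of the coordinate ring are polynomials in the members of the family, hence images of
  Laurent polynomials.\<close>

lemma generated_near_eq:
  assumes gen: "generate_ring R ((\<lambda>c. \<lambda>x\<in>V. c) ` K \<union> range f) = carrier R" and h: "h \<in> carrier R"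
  shows "\<exists>q\<in>A. near_eq q h"
proof -
  have "h \<in> generate_ring R ((\<lambda>c. \<lambda>x\<in>V. c) ` K \<union> range f)" using h gen by simp
  then show ?thesis
  proof (induction rule: generate_ring.induct)
    case one
    have "near_eq 1 \<one>\<^bsub>R\<^esub>" by (rule near_eq_cong[OF near_eq_one]) (simp add: R_simps)
    then show ?case using subring_setD(1)[OF A_sub] by blast
  next
    case (incl h)
    then consider c where "c \<in> K" "h = (\<lambda>x\<in>V. c)" | j where "h = f j" by blast
    then show ?case
    proof cases
      case 1
      have "near_eq (laurent_const c) h" unfolding 1(2) by (rule near_eq_cong[OF near_eq_const]) simp
      then show ?thesis using const_in_A[OF 1(1)] by blast
    next
      case 2
      then show ?thesis using near_eq_var var_in_A by blast
    qed
  next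
    case (a_inv h)
    have hR: "h \<in> carrier R" using a_inv.hyps gen by simp
    from a_inv.IH obtain q where q: "q \<in> A" "near_eq q h" by blast
    have "near_eq (0 - q) (\<ominus>\<^bsub>R\<^esub> h)" unfolding R_uminus[OF hR]
      by (rule near_eq_cong[OF near_eq_diff[OF near_eq_zero q(2)]]) simp
    then show ?case using subring_setD(3)[OF A_sub subring_setD(2)[OF A_sub] q(1)] by blast
  next
    case (eng_add g h)
    from eng_add.IH obtain p q where p: "p \<in> A" "near_eq p g" and q: "q \<in> A" "near_eq q h" by blast
    have "near_eq (p + q) (g \<oplus>\<^bsub>R\<^esub> h)" unfolding R_simps
      by (rule near_eq_cong[OF near_eq_add[OF p(2) q(2)]]) simp
    then show ?case using subring_setD(6)[OF A_sub p(1) q(1)] by blast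
  next
    case (eng_mult g h)
    from eng_mult.IH obtain p q where p: "p \<in> A" "near_eq p g" and q: "q \<in> A" "near_eq q h" by blast
    have "near_eq (p * q) (g \<otimes>\<^bsub>R\<^esub> h)" unfolding R_simps
      by (rule near_eq_cong[OF near_eq_mult[OF p(2) q(2)]]) simp
    then show ?case using subring_setD(4)[OF A_sub p(1) q(1)] by blast
  qed
qed

text \<open>The coordinates of the point are the images of Laurent polynomials which represent the coordinate functions. Equations of
  \<open>V\<close> become relations in the ideal, so the point lies on \<open>V\<close>; the variables are units outside of \<open>Z\<close>, so no \<open>f j\<close> vanishes there.\<close>

lemma point_of_hom:
  assumes gen: "generate_ring R ((\<lambda>c. \<lambda>x\<in>V. c) ` K \<union> range f) = carrier R"
    and V: "affine_variety_over K V"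
    and Z: "prime_on A Z" and D: "partial_hom Z D" "fst ` D = A" "\<And>c. c \<in> K \<Longrightarrow> (laurent_const c, c) \<in> D"
    and I: "relation_ideal K V f \<subseteq> Z"
  shows "\<exists>y\<in>nonvanishing V f. \<forall>j. (laurent_var j 1, f j y) \<in> D"
proof -
  interpret D: hom_graph A Z D using A_sub Z D(1,2) by (simp add: hom_graph_def)
  have inD: "\<exists>z. (a, z) \<in> D" if "a \<in> A" for a
  proof -
    have "a \<in> fst ` D" using that D(2) by simp
    then show ?thesis by auto
  qed
  have "\<forall>i. \<exists>q\<in>A. near_eq q (\<lambda>x\<in>V. x $ i)" using generated_near_eq[OF gen coord_in_R] by blast
  then obtain q where q: "\<And>i. q i \<in> A" "\<And>i. near_eq (q i) (\<lambda>x\<in>V. x $ i)" by metis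
  have "\<forall>i. \<exists>z. (q i, z) \<in> D" using inD q(1) by blast
  then obtain c where c: "\<And>i. (q i, c i) \<in> D" by metis
  define y where "y = (\<chi> i. c i)"
  define sub where "sub p = (\<Sum>m\<in>Poly_Mapping.keys p. laurent_const (Poly_Mapping.lookup p m) *
    (\<Prod>i\<in>UNIV. q i ^ Poly_Mapping.lookup m i))" for p :: "('n \<Rightarrow>\<^sub>0 nat) \<Rightarrow>\<^sub>0 complex"
  have subA: "sub p \<in> A" if "p \<in> coeffs_in K" for p
    unfolding sub_def using that
    by (intro subring_set_sum[OF A_sub] subring_setD(4)[OF A_sub] subring_set_prod[OF A_sub]
        subring_set_power[OF A_sub] q const_in_A) (simp add: coeffs_in_iff)
  have subD: "(sub p, poly_eval p y) \<in> D" if "p \<in> coeffs_in K" for p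
    unfolding sub_def poly_eval_def y_def vec_lambda_beta using that
    by (intro D.sum_D D.mult_D D.prod_D D.power_D c D(3)) (simp add: coeffs_in_iff)
  have subN: "near_eq (sub p) (poly_eval p)" for p
  proof -
    have "near_eq (sub p) (\<lambda>x. \<Sum>m\<in>Poly_Mapping.keys p. Poly_Mapping.lookup p m *
      (\<Prod>i\<in>UNIV. (\<lambda>x\<in>V. x $ i) x ^ Poly_Mapping.lookup m i))"
      unfolding sub_def
      by (intro near_eq_sum near_eq_mult near_eq_const near_eq_prod near_eq_power q) simp_all
    then show ?thesis by (rule near_eq_cong) (simp add: poly_eval_def)
  qed
  have yV: "y \<in> V"
  proof -
    obtain P where P: "P \<subseteq> coeffs_in K" "V = {x. \<forall>p\<in>P. poly_eval p x = 0}"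
      using V unfolding affine_variety_over_def by blast
    have "poly_eval p y = 0" if "p \<in> P" for p
    proof -
      have pK: "p \<in> coeffs_in K" using P(1) that by blast
      have "near_eq (sub p) (\<lambda>x. 0)" by (rule near_eq_cong[OF subN]) (use P(2) that in blast)
      then have "sub p \<in> Z" using I subA[OF pK] relation_ideal_near_eq by blast
      then show ?thesis using D.ker_D[OF subD[OF pK]] by simp
    qed
    then show ?thesis using P(2) by blast
  qed
  have fD: "(laurent_var j 1, f j y) \<in> D" for j
  proof -
    obtain p where p: "p \<in> coeffs_in K" "f j = restrict (poly_eval p) V"
      using R_f[of j] unfolding R_carrier by (rule imageE)
    have fy: "f j y = poly_eval p y" using yV by (simp add: p(2))
    obtain u where u: "(laurent_var j 1, u) \<in> D" using inD[OF var_in_A] by blast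
    have "near_eq (laurent_var j 1 - sub p) (\<lambda>x. 0)"
      by (rule near_eq_cong[OF near_eq_diff[OF near_eq_var subN]]) (simp add: p(2))
    then have "laurent_var j 1 - sub p \<in> Z"
      using I subring_setD(3)[OF A_sub var_in_A subA[OF p(1)]] relation_ideal_near_eq by blast
    then have "u - poly_eval p y = 0" using D.ker_D[OF D.diff_D[OF u subD[OF p(1)]]] by simp
    then show ?thesis using u fy by simp
  qed
  have "f j y \<noteq> 0" for j
  proof
    assume "f j y = 0"
    then have "laurent_var j 1 \<in> Z" using D.ker_D[OF fD] by simp
    then have "laurent_var j 1 * laurent_var j (- 1) \<in> Z" by (intro D.Z_mult' var_in_A)
    then show False using D.Z1 by (simp add: var_inverse)
  qed
  then have "y \<in> nonvanishing V f" using yV by (simp add: nonvanishing_def)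
  then show ?thesis using fD by blast
qed

lemma pairing_single: "pairing v (Poly_Mapping.single j k) = v j * real_of_int k"
  by (cases "k = 0") (simp_all add: pairing_def)

lemma pairing_zero: "pairing v 0 = 0" by (simp add: pairing_def)

lemma pairing_add: "pairing v (\<omega> + \<tau>) = pairing v \<omega> + pairing v \<tau>"
proof -
  have sup: "pairing v \<rho> = (\<Sum>j\<in>S. v j * real_of_int (Poly_Mapping.lookup \<rho> j))"
    if "finite S" "Poly_Mapping.keys \<rho> \<subseteq> S" for \<rho> S
    unfolding pairing_def by (rule sum.mono_neutral_left) (use that in \<open>auto simp: in_keys_iff\<close>)
  let ?S = "Poly_Mapping.keys \<omega> \<union> Poly_Mapping.keys \<tau>"
  have "Poly_Mapping.keys (\<omega> + \<tau>) \<subseteq> ?S" by (rule keys_add)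
  then show ?thesis by (simp add: sup[of ?S] lookup_add distrib_left sum.distrib)
qed

text \<open>The seminorm comes from the quotient by the ideal of relations, where the monomial \<open>\<omega>\<close> has norm \<open>exp (pairing v \<omega>)\<close>.
  It does not vanish: if \<open>1\<close> were congruent to some \<open>g\<close> all of whose monomials have norm below \<open>1\<close>, then \<open>1 - g\<close> would be a relation whose
  constant term alone is dominant at \<open>v\<close>. The values at variables and constants are exact since their inverses
  are bounded too.\<close>

lemma tropical_seminorm:
  assumes v: "v \<in> tropical_variety (relation_ideal K V f)"
    and inv: "\<forall>c\<in>K. c \<noteq> 0 \<longrightarrow> inverse c \<in> K"
  obtains \<nu> where "mult_seminorm A \<nu>" "\<And>p. p \<in> relation_ideal K V f \<Longrightarrow> \<nu> p = 0"
    "\<And>j. \<nu> (laurent_var j 1) = exp (v j)" "\<And>c. c \<in> K \<Longrightarrow> c \<noteq> 0 \<Longrightarrow> \<nu> (laurent_const c) = 1"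
proof -
  let ?I = "relation_ideal K V f"
  note A' = subring_setD[OF A_sub]
  have I0: "0 \<in> ?I" using A'(2) near_eq_zero by (simp add: relation_ideal_near_eq)
  have Idiff: "p - q \<in> ?I" if "p \<in> ?I" "q \<in> ?I" for p q
    using that near_eq_diff[of p "\<lambda>x. 0" q "\<lambda>x. 0"] A'(3)[of p q] by (simp add: relation_ideal_near_eq)
  have Iadd: "p + q \<in> ?I" if "p \<in> ?I" "q \<in> ?I" for p q
    using that near_eq_add[of p "\<lambda>x. 0" q "\<lambda>x. 0"] A'(6)[of p q] by (simp add: relation_ideal_near_eq)
  have Imult: "p * q \<in> ?I" if "p \<in> ?I" "q \<in> A" for p q
  proof -
    have "near_eq p (\<lambda>x. 0)" using that(1) by (simp add: relation_ideal_near_eq)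
    then obtain J where "finite J" "\<forall>x\<in>V. (\<forall>j\<in>J. f j x \<noteq> 0) \<longrightarrow> nzv x p = 0"
      unfolding near_eq_def by blast
    then have "near_eq (p * q) (\<lambda>x. 0)" by (intro near_eqI[of J]) (simp_all add: nzv_simps)
    moreover have "p \<in> A" using that(1) by (simp add: relation_ideal_near_eq)
    ultimately show ?thesis using that(2) A'(4)[of p q] by (simp add: relation_ideal_near_eq)
  qed
  define bd where "bd g t \<longleftrightarrow> (\<forall>\<omega>\<in>Poly_Mapping.keys g. exp (pairing v \<omega>) \<le> t)" for g :: "('j \<Rightarrow>\<^sub>0 int) \<Rightarrow>\<^sub>0 complex" and t
  define T where "T = {(a, t). a \<in> A \<and> 0 \<le> t \<and> (\<exists>g\<in>A. a - g \<in> ?I \<and> bd g t)}"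
  have TI: "(a, t) \<in> T" if "a \<in> A" "0 \<le> t" "g \<in> A" "a - g \<in> ?I" "bd g t" for a t g
    using that unfolding T_def by blast
  have TI': "(a, t) \<in> T" if "a \<in> A" "0 \<le> t" "bd a t" for a t
    by (rule TI[OF that(1,2,1) _ that(3)]) (simp add: I0)
  have TE: "a \<in> A \<and> 0 \<le> t \<and> (\<exists>g\<in>A. a - g \<in> ?I \<and> bd g t)" if "(a, t) \<in> T" for a t
    using that unfolding T_def by simp
  have "seminorm_epigraph A T"
  proof (rule seminorm_epigraphI)
    show "T \<subseteq> A \<times> {0..}" unfolding T_def by auto
    show "\<exists>t. (a, t) \<in> T" if a: "a \<in> A" for a
    proof -
      have "bd a (\<Sum>\<omega>\<in>Poly_Mapping.keys a. exp (pairing v \<omega>))"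
        unfolding bd_def by (intro ballI member_le_sum) auto
      then have "(a, \<Sum>\<omega>\<in>Poly_Mapping.keys a. exp (pairing v \<omega>)) \<in> T"
        by (intro TI' a sum_nonneg) auto
      then show ?thesis ..
    qed
    show "(a, t) \<in> T" if "(a, s) \<in> T" "s \<le> t" for a s t
    proof -
      from TE[OF that(1)] obtain g where g: "a \<in> A" "0 \<le> s" "g \<in> A" "a - g \<in> ?I" "bd g s" by blast
      have "bd g t" unfolding bd_def
      proof
        fix \<omega> assume "\<omega> \<in> Poly_Mapping.keys g"
        then have "exp (pairing v \<omega>) \<le> s" using g(5) unfolding bd_def by blast
        then show "exp (pairing v \<omega>) \<le> t" using that(2) by (rule order_trans)
      qed
      then show ?thesis using g that(2) by (intro TI[of a t g]) auto
    qed
    show "(0, 0) \<in> T" by (rule TI'[OF A'(2)]) (simp_all add: bd_def)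
    show "(1, 1) \<in> T" by (rule TI'[OF A'(1)]) (simp_all add: bd_def pairing_zero)
    show "1 \<le> t" if t: "(1, t) \<in> T" for t
    proof (rule ccontr)
      assume "\<not> 1 \<le> t"
      then have t1: "t < 1" by simp
      from TE[OF t] obtain g where g: "1 - g \<in> ?I" "bd g t" by blast
      have neg: "pairing v \<omega> < 0" if "\<omega> \<in> Poly_Mapping.keys g" for \<omega>
      proof -
        have "exp (pairing v \<omega>) \<le> t" using g(2) that unfolding bd_def by blast
        then have "exp (pairing v \<omega>) < 1" using t1 by (rule le_less_trans)
        then show ?thesis by (simp only: exp_less_one_iff)
      qed
      have g0: "Poly_Mapping.lookup g 0 = 0"
        using neg[of 0] pairing_zero[of v] by (auto simp: in_keys_iff)
      have "0 \<in> Poly_Mapping.keys (1 - g)" using g0 by (simp add: in_keys_iff lookup_minus)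
      moreover have "pairing v \<omega> < pairing v 0" if "\<omega> \<in> Poly_Mapping.keys (1 - g) - {0}" for \<omega>
      proof -
        have "\<omega> \<in> Poly_Mapping.keys g"
          using that by (auto simp: in_keys_iff lookup_minus lookup_one when_def)
        from neg[OF this] show ?thesis by (simp add: pairing_zero)
      qed
      ultimately have "v \<notin> tropical_zeros (1 - g)" unfolding tropical_zeros_iff by blast
      then show False using v g(1) unfolding tropical_variety_def by blast
    qed
    fix a s b t assume "(a, s) \<in> T" "(b, t) \<in> T"
    from TE[OF this(1)] TE[OF this(2)] obtain g h where
      g: "a \<in> A" "0 \<le> s" "g \<in> A" "a - g \<in> ?I" "bd g s" and
      h: "b \<in> A" "0 \<le> t" "h \<in> A" "b - h \<in> ?I" "bd h t" by blast
    have "Poly_Mapping.keys (g - h) \<subseteq> Poly_Mapping.keys g \<union> Poly_Mapping.keys h"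
      by (auto simp: in_keys_iff lookup_minus)
    then have "bd (g - h) (max s t)" using g(5) h(5) unfolding bd_def le_max_iff_disj by blast
    moreover have e: "(a - b) - (g - h) = (a - g) - (b - h)" by simp
    have "(a - b) - (g - h) \<in> ?I" unfolding e by (rule Idiff[OF g(4) h(4)])
    ultimately show "(a - b, max s t) \<in> T"
      using g(2) by (intro TI[OF A'(3)[OF g(1) h(1)] _ A'(3)[OF g(3) h(3)]]) auto
    have "bd (g * h) (s * t)"
      unfolding bd_def
    proof
      fix \<omega> assume "\<omega> \<in> Poly_Mapping.keys (g * h)"
      then obtain k l where "\<omega> = k + l" "k \<in> Poly_Mapping.keys g" "l \<in> Poly_Mapping.keys h"
        using keys_mult[of g h] by blast
      moreover from this have "exp (pairing v k) \<le> s" "exp (pairing v l) \<le> t"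
        using g(5) h(5) unfolding bd_def by blast+
      then have "exp (pairing v k) * exp (pairing v l) \<le> s * t"
        by (rule mult_mono) (simp_all add: g(2))
      ultimately show "exp (pairing v \<omega>) \<le> s * t" by (simp add: pairing_add exp_add)
    qed
    moreover have e: "a * b - g * h = (a - g) * b + (b - h) * g" by (simp add: algebra_simps)
    have "a * b - g * h \<in> ?I" unfolding e by (rule Iadd[OF Imult[OF g(4) h(1)] Imult[OF h(4) g(3)]])
    ultimately show "(a * b, s * t) \<in> T"
      using g(2) h(2) by (intro TI[OF A'(4)[OF g(1) h(1)] _ A'(4)[OF g(3) h(3)]]) auto
  qed
  from exists_mult_seminorm[OF A_sub this] obtain \<nu> where
    \<nu>: "mult_seminorm A \<nu>" and le: "\<And>a t. (a, t) \<in> T \<Longrightarrow> \<nu> a \<le> t" by blast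
  note sn = mult_seminormD[OF \<nu>]
  have "\<nu> p = 0" if p: "p \<in> ?I" for p
  proof -
    have pA: "p \<in> A" using p by (simp add: relation_ideal_near_eq)
    have "(p, 0) \<in> T" by (rule TI[OF pA _ A'(2)]) (use p in \<open>simp_all add: bd_def\<close>)
    then show ?thesis using le sn(3)[OF pA] by force
  qed
  moreover have "\<nu> (laurent_var j 1) = exp (v j)" for j
  proof -
    have vk: "\<nu> (laurent_var j k) \<le> exp (v j * real_of_int k)" for k
      by (rule le, rule TI'[OF var_in_A]) (simp_all add: bd_def laurent_var_def pairing_single)
    have "\<nu> (laurent_var j 1) * \<nu> (laurent_var j (- 1)) = 1"
      using sn(4)[OF var_in_A var_in_A, of j 1 j "- 1"] by (simp only: var_inverse sn(1))
    moreover have "\<nu> (laurent_var j 1) * \<nu> (laurent_var j (- 1)) \<le> \<nu> (laurent_var j 1) * exp (- v j)"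
      using vk[of "- 1"] by (intro mult_left_mono sn(3) var_in_A) simp
    ultimately have "1 \<le> \<nu> (laurent_var j 1) * exp (- v j)" by simp
    then have "exp (v j) \<le> \<nu> (laurent_var j 1)" by (simp add: exp_minus field_simps)
    then show ?thesis using vk[of 1] by simp
  qed
  moreover have "\<nu> (laurent_const c) = 1" if c: "c \<in> K" "c \<noteq> 0" for c
  proof -
    have ck: "\<nu> (laurent_const d) \<le> 1" if "d \<in> K" for d
      by (rule le, rule TI'[OF const_in_A[OF that]]) (auto simp: bd_def laurent_const_def pairing_zero)
    have ic: "inverse c \<in> K" using inv c by blast
    have "laurent_const c * laurent_const (inverse c) = (1 :: ('j \<Rightarrow>\<^sub>0 int) \<Rightarrow>\<^sub>0 complex)"
      unfolding const_arith(2)[symmetric] right_inverse[OF c(2)] by (rule const_arith(3))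
    then have "\<nu> (laurent_const c) * \<nu> (laurent_const (inverse c)) = 1"
      using sn(4)[OF const_in_A[OF c(1)] const_in_A[OF ic]] sn(1) by simp
    moreover have "\<nu> (laurent_const c) * \<nu> (laurent_const (inverse c)) \<le> \<nu> (laurent_const c) * 1"
      by (intro mult_left_mono ck ic sn(3) const_in_A c(1))
    ultimately show ?thesis using ck[OF c(1)] by simp
  qed
  ultimately show thesis by (rule that[OF \<nu>])
qed

text \<open>Embed the quotient by the kernel of the seminorm into the complex numbers, approximate the resulting
  absolute value on the finitely many coordinates in \<open>F\<close>, and read the composed homomorphism as a point.\<close>

lemma approximating_points:
  assumes gen: "generate_ring R ((\<lambda>c. \<lambda>x\<in>V. c) ` K \<union> range f) = carrier R"
    and V: "affine_variety_over K V" and cK: "countable K" and cJ: "countable (UNIV :: 'j set)"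
    and inv: "\<forall>c\<in>K. c \<noteq> 0 \<longrightarrow> inverse c \<in> K"
    and v: "v \<in> tropical_variety (relation_ideal K V f)"
    and F: "finite F" and \<epsilon>: "0 < \<epsilon>" "0 < c\<^sub>0"
  shows "\<exists>c y. 0 < c \<and> c < c\<^sub>0 \<and> y \<in> nonvanishing V f \<and> (\<forall>j\<in>F. \<bar>c * Log_map f y j - v j\<bar> < \<epsilon>)"
proof -
  obtain \<nu> where \<nu>: "mult_seminorm A \<nu>" and \<nu>I: "\<And>p. p \<in> relation_ideal K V f \<Longrightarrow> \<nu> p = 0"
    and \<nu>v: "\<And>j. \<nu> (laurent_var j 1) = exp (v j)" and \<nu>K: "\<And>c. c \<in> K \<Longrightarrow> c \<noteq> 0 \<Longrightarrow> \<nu> (laurent_const c) = 1"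
    by (rule tropical_seminorm[OF v inv]) (rule that)
  interpret N: mult_seminormed A \<nu> using A_sub \<nu> by unfold_locales
  define Z where "Z = {a \<in> A. \<nu> a = 0}"
  have Z: "prime_on A Z"
    unfolding prime_on_def
  proof (intro conjI ballI impI)
    fix a b assume ab: "a \<in> A" "b \<in> A"
    show "a - b \<in> Z" if "a \<in> Z" "b \<in> Z"
      using N.sn(5)[OF ab] N.sn(3)[OF N.sub(3)[OF ab]] N.sub(3)[OF ab] that by (simp add: Z_def)
    show "a * b \<in> Z" if "b \<in> Z" using N.sn(4)[OF ab] N.sub(4)[OF ab] that by (simp add: Z_def)
    show "a \<in> Z \<or> b \<in> Z" if "a * b \<in> Z" using N.sn(4)[OF ab] ab that by (simp add: Z_def)
  qed (use N.sn N.sub in \<open>simp_all add: Z_def\<close>)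
  have IZ: "relation_ideal K V f \<subseteq> Z"
    unfolding Z_def using \<nu>I by (auto simp: relation_ideal_near_eq)
  \<comment> \<open>Extending the identity of \<open>K\<close> with kernel exactly \<open>Z\<close> embeds the quotient by \<open>Z\<close> into the complex numbers.\<close>
  define D0 :: "((('j \<Rightarrow>\<^sub>0 int) \<Rightarrow>\<^sub>0 complex) \<times> complex) set" where "D0 = (\<lambda>c. (laurent_const c, c)) ` K"
  have D0: "partial_hom Z D0"
    unfolding partial_hom_def
  proof (intro conjI allI impI)
    show "(1, 1) \<in> D0" unfolding D0_def
      by (rule image_eqI[OF _ subring_setD(1)[OF K]]) (simp add: const_arith)
    fix a x b y assume "(a, x) \<in> D0" "(b, y) \<in> D0"
    then have xy: "x \<in> K" "y \<in> K" "a = laurent_const x" "b = laurent_const y" by (auto simp: D0_def)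
    show "(a - b, x - y) \<in> D0" unfolding D0_def
      by (rule image_eqI[OF _ subring_setD(3)[OF K xy(1,2)]]) (simp add: xy const_arith)
    show "(a * b, x * y) \<in> D0" unfolding D0_def
      by (rule image_eqI[OF _ subring_setD(4)[OF K xy(1,2)]]) (simp add: xy const_arith)
  next
    fix a x assume "(a, x) \<in> D0"
    then have x: "x \<in> K" "a = laurent_const x" by (auto simp: D0_def)
    show "x = 0 \<longleftrightarrow> a \<in> Z"
    proof (cases "x = 0")
      case True
      then show ?thesis using N.sn(2) N.sub(2) by (simp add: Z_def x(2) const_arith)
    next
      case False
      then show ?thesis using \<nu>K[OF x(1) False] by (simp add: Z_def x(2))
    qed
  qed
  have cA: "countable A"
  proof -
    have "countable {p :: 'j \<Rightarrow>\<^sub>0 int. \<forall>k. Poly_Mapping.lookup p k \<in> UNIV}"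
      by (rule countable_poly_mapping[OF _ cJ]) simp
    then have "countable (UNIV :: ('j \<Rightarrow>\<^sub>0 int) set)" by simp
    from countable_poly_mapping[OF cK this] show ?thesis
      by (simp add: coeffs_in_iff[abs_def] coeffs_in_def image_subset_iff)
  qed
  have "fst ` D0 \<subseteq> A" unfolding D0_def using const_in_A by auto
  from extend_partial_hom[OF A_sub cA Z D0 this] obtain D1 where
    D1: "D0 \<subseteq> D1" "partial_hom Z D1" "fst ` D1 = A" .
  interpret D1: hom_graph A Z D1 using A_sub Z D1(2,3) by (simp add: hom_graph_def)
  have D1K: "(laurent_const c, c) \<in> D1" if "c \<in> K" for c using that D1(1) by (auto simp: D0_def)
  define B where "B = snd ` D1"
  have B: "subring_set B"
    unfolding subring_set_def
  proof (intro conjI ballI)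
    show "1 \<in> B" unfolding B_def by (rule image_eqI[OF _ D1.one_D]) simp
    fix x y assume "x \<in> B" "y \<in> B"
    then obtain a b where ab: "(a, x) \<in> D1" "(b, y) \<in> D1" by (auto simp: B_def)
    show "x - y \<in> B" unfolding B_def by (rule image_eqI[OF _ D1.diff_D[OF ab]]) simp
    show "x * y \<in> B" unfolding B_def by (rule image_eqI[OF _ D1.mult_D[OF ab]]) simp
  qed
  have cB: "countable B" unfolding B_def by (rule D1.countable_ran[OF cA])
  have KB: "K \<subseteq> B"
  proof
    fix c assume "c \<in> K"
    from D1K[OF this] show "c \<in> B" unfolding B_def by (rule image_eqI[rotated]) simp
  qed
  \<comment> \<open>The preimages of \<open>z\<close> differ by elements of the kernel of \<open>\<nu>\<close>, so the choice of a preimage does not matter.\<close>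
  define \<mu> where "\<mu> z = \<nu> (SOME a. (a, z) \<in> D1)" for z
  have \<mu>: "\<mu> z = \<nu> a" if az: "(a, z) \<in> D1" for a z
  proof -
    define b where "b = (SOME a. (a, z) \<in> D1)"
    have b: "(b, z) \<in> D1" unfolding b_def using az by (rule someI)
    have ab: "a \<in> A" "b \<in> A" using D1.in_dom az b by auto
    have "a - b \<in> Z" using D1.ker_D[OF D1.diff_D[OF az b]] by simp
    then have d: "\<nu> (a - b) = 0" "a - b \<in> A" by (simp_all add: Z_def)
    have "\<nu> a \<le> \<nu> b" using N.\<nu>_add[OF d(2) ab(2)] d(1) N.sn(3)[OF ab(2)] by simp
    moreover have "\<nu> b \<le> \<nu> a" using N.sn(5)[OF ab(1) d(2)] d(1) N.sn(3)[OF ab(1)] by simp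
    ultimately show ?thesis by (simp add: \<mu>_def b_def)
  qed
  have av: "abs_value K B \<mu>"
    unfolding abs_value_def mult_seminorm_def
  proof (intro conjI ballI impI)
    show "\<mu> 1 = 1" "\<mu> 0 = 0" using \<mu>[OF D1.one_D] \<mu>[OF D1.zero_D] N.sn(1,2) by simp_all
    show "\<mu> c = 1" if "c \<in> K" "c \<noteq> 0" for c using \<mu>[OF D1K[OF that(1)]] \<nu>K[OF that] by simp
    show "0 \<le> \<mu> x" if "x \<in> B" for x
    proof -
      from that obtain a where a: "(a, x) \<in> D1" by (auto simp: B_def)
      show ?thesis using \<mu>[OF a] N.sn(3)[OF D1.in_dom[OF a]] by simp
    qed
    show "0 < \<mu> x" if x: "x \<in> B" "x \<noteq> 0" for x
    proof -
      from x(1) obtain a where a: "(a, x) \<in> D1" by (auto simp: B_def)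
      have "a \<notin> Z" using D1.ker_D[OF a] x(2) by simp
      then show ?thesis using \<mu>[OF a] N.sn(3)[OF D1.in_dom[OF a]] D1.in_dom[OF a] by (simp add: Z_def)
    qed
    fix x y assume "x \<in> B" "y \<in> B"
    then obtain a b where ab: "(a, x) \<in> D1" "(b, y) \<in> D1" by (auto simp: B_def)
    note dom = D1.in_dom[OF ab(1)] D1.in_dom[OF ab(2)]
    show "\<mu> (x * y) = \<mu> x * \<mu> y" using \<mu>[OF D1.mult_D[OF ab]] \<mu>[OF ab(1)] \<mu>[OF ab(2)] N.sn(4)[OF dom] by simp
    show "\<mu> (x - y) \<le> max (\<mu> x) (\<mu> y)"
      using \<mu>[OF D1.diff_D[OF ab]] \<mu>[OF ab(1)] \<mu>[OF ab(2)] N.sn(5)[OF dom] by simp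
  qed
  have "\<forall>j. \<exists>x. (laurent_var j 1, x) \<in> D1"
  proof
    fix j :: 'j
    have "laurent_var j 1 \<in> fst ` D1" using var_in_A D1(3) by simp
    then show "\<exists>x. (laurent_var j 1, x) \<in> D1" by auto
  qed
  then obtain x where x: "\<And>j. (laurent_var j 1, x j) \<in> D1" by metis
  have \<mu>x: "\<mu> (x j) = exp (v j)" for j using \<mu>[OF x] \<nu>v by simp
  have xB: "x j \<in> B" for j unfolding B_def by (rule image_eqI[OF _ x]) simp
  have x0: "x j \<noteq> 0" for j using \<mu>x[of j] av by (auto simp: abs_value_def mult_seminorm_def)
  \<comment> \<open>Approximation is available over finitely generated rings. The homomorphism obtained for the
    coordinates in \<open>F\<close> extends to \<open>B\<close>, and there its size at the other coordinates is irrelevant.\<close>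
  obtain js where js: "set js = F" using finite_list[OF F] by blast
  define C where "C = adjoin_list (map x js) K"
  have KC: "K \<subseteq> C" unfolding C_def by (rule adjoin_list_base[OF K])
  have C: "subring_set C" "countable C" unfolding C_def by (intro adjoin_list_subring adjoin_list_countable K cK)+
  have xC: "x j \<in> C" if "j \<in> F" for j
    using adjoin_list_gen[OF K, of "map x js"] that js unfolding C_def by auto
  have CB: "C \<subseteq> B"
  proof -
    have sub: "adjoin_list as K \<subseteq> B" if "set as \<subseteq> B" for as
      using that
    proof (induction as)
      case (Cons a as)
      then show ?case unfolding adjoin_list_simps by (intro poly_ring_least[OF B]) auto
    qed (simp add: adjoin_list_simps KB)
    show ?thesis unfolding C_def by (rule sub) (use xB in auto)
  qed
  have ap: "approximable K C" unfolding C_def by (rule approximable_fg[OF K cK])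
  have G: "finite (x ` F)" "x ` F \<subseteq> C - {0}" using F xC x0 by auto
  from approximableD[OF ap abs_value_subset[OF av CB] G \<epsilon>] obtain c D where
    c: "0 < c" "c < c\<^sub>0" and D: "partial_hom {0} D" "fst ` D = C" "Id_on K \<subseteq> D"
    and close: "\<And>g z. (g, z) \<in> D \<Longrightarrow> g \<in> x ` F \<Longrightarrow> \<bar>c * ln (cmod z) - ln (\<mu> g)\<bar> < \<epsilon>" by blast
  have "fst ` D \<subseteq> B" using D(2) CB by simp
  from extend_partial_hom[OF B cB prime_zero D(1) this] obtain D2 where
    D2: "D \<subseteq> D2" "partial_hom {0} D2" "fst ` D2 = B" .
  interpret D2: hom_graph B "{0}" D2 by (rule hom_graph_zero[OF B D2(2)]) (simp add: D2(3))
  have comp: "partial_hom Z (D1 O D2)" by (rule partial_hom_comp[OF D1(2) D2(2)])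
  have domc: "fst ` (D1 O D2) = A"
  proof (intro equalityI subsetI)
    fix a assume "a \<in> fst ` (D1 O D2)"
    then show "a \<in> A" using D1.in_dom by auto
  next
    fix a assume "a \<in> A"
    then have "a \<in> fst ` D1" using D1(3) by simp
    then obtain z where z: "(a, z) \<in> D1" by auto
    then have "z \<in> B" unfolding B_def by (rule image_eqI[rotated]) simp
    then have "z \<in> fst ` D2" using D2(3) by simp
    then obtain w where "(z, w) \<in> D2" by auto
    then have "(a, w) \<in> D1 O D2" using z by (intro relcompI)
    then show "a \<in> fst ` (D1 O D2)" by (rule image_eqI[rotated]) simp
  qed
  have Kc: "(laurent_const c, c) \<in> D1 O D2" if "c \<in> K" for c
    using D1K[OF that] D(3) D2(1) that by (intro relcompI[of _ c]) auto
  from point_of_hom[OF gen V Z comp domc Kc IZ] obtain y where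
    y: "y \<in> nonvanishing V f" "\<And>j. (laurent_var j 1, f j y) \<in> D1 O D2" by blast
  have "\<bar>c * Log_map f y j - v j\<bar> < \<epsilon>" if j: "j \<in> F" for j
  proof -
    obtain w where w: "(laurent_var j 1, w) \<in> D1" "(w, f j y) \<in> D2" using y(2)[of j] by blast
    have wx: "w = x j" by (rule D1.fun_D[OF w(1) x])
    have "x j \<in> fst ` D" using xC[OF j] D(2) by simp
    then obtain u where u: "(x j, u) \<in> D" by auto
    then have "(x j, u) \<in> D2" using D2(1) by blast
    then have "u = f j y" using w(2) wx by (intro D2.fun_D) auto
    then show ?thesis using close[OF u] j by (simp add: \<mu>x Log_map_def)
  qed
  then show ?thesis using c y(1) by blast
qed

text \<open>A diagonal sequence: the finite sets of coordinates exhaust the index set while the errors and the scaling factors tend to zero.\<close>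

lemma tropical_subset_cone:
  assumes gen: "generate_ring R ((\<lambda>c. \<lambda>x\<in>V. c) ` K \<union> range f) = carrier R"
    and V: "affine_variety_over K V" and cK: "countable K" and cJ: "countable (UNIV :: 'j set)"
    and inv: "\<forall>c\<in>K. c \<noteq> 0 \<longrightarrow> inverse c \<in> K"
  shows "tropical_variety (relation_ideal K V f) \<subseteq> cone_ideal_points V f"
proof
  fix v assume v: "v \<in> tropical_variety (relation_ideal K V f)"
  define F :: "nat \<Rightarrow> 'j set" where "F n = from_nat_into UNIV ` {..<n}" for n
  have finF: "finite (F n)" for n by (simp add: F_def)
  have jF: "\<exists>N. \<forall>n\<ge>N. j \<in> F n" for j :: 'j
  proof -
    have "range (from_nat_into UNIV) = (UNIV :: 'j set)" by (rule range_from_nat_into[OF UNIV_not_empty cJ])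
    then obtain k where k: "j = from_nat_into UNIV k" by (metis UNIV_I imageE)
    show ?thesis unfolding F_def k by (intro exI[of _ "Suc k"]) auto
  qed
  define e where "e n = inverse (real (Suc n))" for n
  have e0: "0 < e n" for n by (simp add: e_def)
  have elim0: "e \<longlonglongrightarrow> 0" unfolding e_def by (rule LIMSEQ_inverse_real_of_nat)
  have "\<forall>n. \<exists>c y. 0 < c \<and> c < e n \<and> y \<in> nonvanishing V f \<and> (\<forall>j\<in>F n. \<bar>c * Log_map f y j - v j\<bar> < e n)"
    using approximating_points[OF gen V cK cJ inv v finF e0 e0] by blast
  then obtain c y where c: "\<And>n. 0 < c n" "\<And>n. c n < e n" and y: "\<And>n. y n \<in> nonvanishing V f"
    and close: "\<And>n j. j \<in> F n \<Longrightarrow> \<bar>c n * Log_map f (y n) j - v j\<bar> < e n" by metis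
  have ne: "nonvanishing V f \<noteq> {}" using y by blast
  show "v \<in> cone_ideal_points V f"
  proof (cases "v = (\<lambda>_. 0)")
    case True
    then show ?thesis using ne by (simp add: cone_ideal_points_def)
  next
    case False
    then obtain j0 where j0: "v j0 \<noteq> 0" by blast
    define L where "L n j = c n * Log_map f (y n) j" for n j
    have lim: "(\<lambda>n. L n j) \<longlonglongrightarrow> v j" for j
    proof (rule tendstoI)
      fix \<epsilon> :: real assume "\<epsilon> > 0"
      obtain N where N: "\<forall>n\<ge>N. j \<in> F n" using jF by blast
      have "\<forall>\<^sub>F n in sequentially. e n < \<epsilon>" using order_tendstoD(2)[OF elim0 \<open>\<epsilon> > 0\<close>] .
      then show "\<forall>\<^sub>F n in sequentially. dist (L n j) (v j) < \<epsilon>"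
        using eventually_ge_at_top[of N]
      proof eventually_elim
        case (elim n)
        then show ?case using close[of j n] N by (simp add: L_def dist_real_def)
      qed
    qed
    have c0: "c \<longlonglongrightarrow> 0"
      by (rule tendsto_sandwich[OF _ _ tendsto_const elim0]) (use c in \<open>auto intro!: always_eventually less_imp_le\<close>)
    have Lnz: "\<forall>\<^sub>F n in sequentially. L n j0 \<noteq> 0" by (rule tendsto_imp_eventually_ne[OF lim j0])
    \<comment> \<open>On a compact set the coordinate \<open>j0\<close> of \<open>Log\<close> is bounded, but it grows like \<open>v j0 / c n\<close>.\<close>
    have leave: "\<forall>\<^sub>F n in sequentially. y n \<notin> C" if C: "compact C" "C \<subseteq> nonvanishing V f" for C
    proof -
      have CV: "C \<subseteq> V" using C(2) by (auto simp: nonvanishing_def)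
      have "continuous_on C (\<lambda>x. ln (cmod (f j0 x)))"
        using C(2) by (intro continuous_intros continuous_on_subset[OF f_continuous CV]) (auto simp: nonvanishing_def)
      then have "bounded ((\<lambda>x. ln (cmod (f j0 x))) ` C)"
        using C(1) by (intro compact_imp_bounded compact_continuous_image)
      then obtain M where M: "\<And>x. x \<in> C \<Longrightarrow> \<bar>ln (cmod (f j0 x))\<bar> \<le> M"
        unfolding bounded_iff by auto
      have "(\<lambda>n. c n * M) \<longlonglongrightarrow> 0 * M" by (intro tendsto_intros c0)
      then have "\<forall>\<^sub>F n in sequentially. c n * M < \<bar>v j0\<bar> / 2"
        using j0 by (intro order_tendstoD(2)) auto
      moreover have "(\<lambda>n. \<bar>L n j0\<bar>) \<longlonglongrightarrow> \<bar>v j0\<bar>" by (intro tendsto_intros lim)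
      then have "\<forall>\<^sub>F n in sequentially. \<bar>v j0\<bar> / 2 < \<bar>L n j0\<bar>"
        using j0 by (intro order_tendstoD(1)) auto
      ultimately show ?thesis
      proof eventually_elim
        case (elim n)
        show ?case
        proof
          assume "y n \<in> C"
          from M[OF this] have "\<bar>L n j0\<bar> \<le> c n * M"
            using c(1)[of n] by (simp add: L_def Log_map_def abs_mult mult_left_mono)
          then show False using elim by linarith
        qed
      qed
    qed
    have "limitin ray_space (\<lambda>n. ray (Log_map f (y n))) (ray v) sequentially"
      unfolding limitin_def
    proof (intro conjI allI impI)
      have "ray ` (- {\<lambda>_. 0}) = (topspace ray_space :: ('j \<Rightarrow> real) set set)"
        using quotient_imp_surjective_map[OF quotient_map_ray] by simp
      then show "ray v \<in> topspace ray_space" using False by blast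
      fix U assume U: "openin ray_space U \<and> ray v \<in> U"
      then obtain Op where Op: "open Op" "{w \<in> - {\<lambda>_. 0}. ray w \<in> U} = (- {\<lambda>_. 0}) \<inter> Op"
        unfolding openin_ray_space openin_open by blast
      have "v \<in> Op" using Op(2) U False by blast
      have "limitin euclidean (\<lambda>n. L n) v sequentially"
        unfolding euclidean_product_topology[symmetric] limitin_componentwise by (simp add: lim)
      then have "\<forall>\<^sub>F n in sequentially. L n \<in> Op"
        using Op(1) \<open>v \<in> Op\<close> unfolding limitin_def by simp
      then show "\<forall>\<^sub>F n in sequentially. ray (Log_map f (y n)) \<in> U"
        using Lnz
      proof eventually_elim
        case (elim n)
        have "L n \<noteq> (\<lambda>_. 0)" using elim(2) by auto
        then have "ray (L n) \<in> U" using elim(1) Op(2) by blast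
        moreover have "ray (L n) = ray (Log_map f (y n))"
          using ray_scale[OF c(1)] by (simp add: L_def[abs_def])
        ultimately show ?case by simp
      qed
    qed
    then have "ray v \<in> ideal_points V f"
      unfolding ideal_points_def using y leave by blast
    then show ?thesis using ne False by (simp add: cone_ideal_points_def)
  qed
qed

end

theorem mainTheorem3:
  fixes K :: "complex set"
    and V :: "(complex ^ 'n::finite) set"
    and f :: "'j \<Rightarrow> complex ^ 'n \<Rightarrow> complex"
  assumes "subfield K (univ_ring :: complex ring)"
    and "countable K"
    and "affine_variety_over K V"
    and "infinite (UNIV :: 'j set)"
    and "generating_family K V f"
  shows "cone_ideal_points V f = tropical_variety (relation_ideal K V f)"
proof -
  note KF = subfield_set[OF assms(1)]
  have gf: "countable (UNIV :: 'j set)" "range f \<subseteq> carrier (coordinate_ring K V)"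
    "generate_ring (coordinate_ring K V) ((\<lambda>c. \<lambda>x\<in>V. c) ` K \<union> range f) = carrier (coordinate_ring K V)"
    using assms(5) unfolding generating_family_def by blast+
  interpret family K V f by unfold_locales (fact KF(1), fact gf(2))
  show ?thesis
    using cone_subset_tropical[OF affine_variety_closed[OF assms(3)] gf(3)]
      tropical_subset_cone[OF gf(3) assms(3,2) gf(1) KF(2)] by (rule equalityI)
qed

end
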